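(* Let $f:\mathbb{R}^d\to\mathbb{R}$ be bounded below and $L$-Lipschitz, fix $\delta>0$, and let $f_\delta(x):=\mathbb{E}[f(x+\delta V)]$ with $V$ uniform on the closed unit Euclidean ball. Put $L_\delta:=L\sqrt d/\delta$, $B:=2L\delta$, $f_\delta^\star:=\inf_x f_\delta(x)$ and $\Delta_0:=f_\delta(x_0)-f_\delta^\star$. Run Comparison-SGD (defined in the context) on $f_\delta$ from $x_0\in\mathbb{R}^d$ for $T$ steps with step size $$\eta\le\frac{1}{L_\delta}=\frac{\delta}{L\sqrt d},$$ and suppose that for some constant $C_\Delta<\infty$ the gap estimates satisfy $$\mathbb{E}\big[\widehat\Delta_t^{\,2}\,\big|\,x_t,u_t\big]\le C_\Delta B^2\qquad\text{for all } t .$$ Let $R$ be uniform on $\{0,\dots,T-1\}$, independent of the randomness of the algorithm. Then: (1) $$\mathbb{E}\big[\|\nabla f_\delta(x_R)\|^2\big]\le \frac{2\Delta_0}{\eta T}+\eta L_\delta\cdot\frac{d^2}{4\delta^2}\,C_\Delta B^2 .$$ (2) In particular, choosing $$\eta=\min\left\{\frac1{L_\delta},\ \sqrt{\frac{2\Delta_0}{L_\delta T\cdot\frac{d^2}{4\delta^2}C_\Delta B^2}}\right\}$$ yields $$\mathbb{E}\big[\|\nabla f_\delta(x_R)\|^2\big]\le 2\sqrt{\frac{2L_\delta\Delta_0}{T}\cdot\frac{d^2}{4\delta^2}C_\Delta B^2}.$$ (3) Consequently, for $\varepsilon>0$ it suffices to take $$T\ge \frac{8L_\delta\Delta_0}{\varepsilon^4}\cdot\frac{d^2}{4\delta^2}C_\Delta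 B^2$$ to ensure $\mathbb{E}[\|\nabla f_\delta(x_R)\|]\le\varepsilon$, and this implies that $x_R$ is $(\delta,\varepsilon)$-Goldstein stationary. (4) Moreover, if each gap estimate uses a (random) number $N$ of comparisons with $\mathbb{E}[N]<\infty$, then the expected total number of comparisons used by the algorithm is at most $T\cdot\mathbb{E}[N]$.
   Context: Goldstein stationarity: for locally Lipschitz $f$, $\partial_\delta f(x):=\mathrm{conv}\big(\bigcup_{\|z-x\|\le\delta}\partial^C f(z)\big)$, where $\partial^C f$ is the Clarke subdifferential. A point $x$ is $(\delta,\varepsilon)$-Goldstein stationary if $\mathrm{dist}(0,\partial_\delta f(x))\le\varepsilon$. Norms are Euclidean. Comparison oracle: $\sigma:\mathbb{R}\to(0,1)$ is a known strictly increasing link with $\sigma(-t)=1-\sigma(t)$, $g=\sigma^{-1}$, and $\tau>0$ is a temperature. A query at $(x,y)$ returns $Y\in\{0,1\}$ with $\mathbb{P}(Y=1\mid x,y)=\sigma((f(y)-f(x))/\tau)$; repeated queries are independent. When $|f(y)-f(x)|\le B$, the probability $p=\sigma((f(y)-f(x))/\tau)$ lies in $[p_-,p_+]$, $p_\pm:=\sigma(\pm B/\tau)$. Gap estimator (Russian roulette): $g$ has a known expansion $g(p)=\sum_{k\ge1}c_{m_k}\big(p^{m_k}-(1-p)^{m_k}\big)$, absolutely convergent on $[p_-,p_+]$ (for the logistic link $\sigma(t)=1/(1+e^{-t})$: $m_k=k$, $c_k=1/k$; for general symmetric links: $m_k=2k-1$). Let $M$ be a random variable in $\{1,2,\dots\}$,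 independent of all comparisons, with $q_k:=\mathbb{P}(M\ge k)$. For each $k\le M$ use a fresh block of $m_k$ repeated comparisons of $(x,y)$ (independent across $k$), let $A_{m_k}$ (resp. $B_{m_k}$) be the indicator that all outcomes in the block equal $1$ (resp. $0$), and set $$\widehat\Delta(x,y):=\tau\sum_{k=1}^M\frac{c_{m_k}}{q_k}\,(A_{m_k}-B_{m_k}).$$ This is used as an unbiased estimator of $f(y)-f(x)$. Comparison-SGD: given $x_0\in\mathbb{R}^d$, for $t=0,\dots,T-1$ sample $u_t$ uniformly on the unit sphere $\mathbb{S}^{d-1}$, form the unbiased gap estimate $\widehat\Delta_t:=\widehat\Delta(x_t-\delta u_t,\,x_t+\delta u_t)$ with fresh comparisons, so that $\mathbb{E}[\widehat\Delta_t\mid x_t,u_t]=f(x_t+\delta u_t)-f(x_t-\delta u_t)$, set $G_t:=\frac{d}{2\delta}\widehat\Delta_t u_t$, and update $x_{t+1}=x_t-\eta G_t$. The output is $x_R$.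
   Formalization: In (3), "x_R is (δ,ε)-Goldstein stationary" is stated as E[dist(0,∂_δ f(x_R))] ≤ ε, plus the pointwise implication from ‖∇f_δ(z)‖ ≤ ε, since x_R is random and the almost-sure claim fails; in (2),(3), if C_Δ=0 the undefined quotient is read as 0. *)

theory Defs
  imports "HOL-Probability.Probability"
begin

section \<open>Uniform distributions and randomized smoothing\<close>

definition ball_uniform :: "'a::euclidean_space measure" where
  "ball_uniform = uniform_measure lborel (cball 0 1)"

text \<open>Normalized surface measure on the unit sphere, obtained as the cone measure: the radial
  projection of the uniform distribution on the ball. The centre, which \<^const>\<open>sgn\<close> maps to \<open>0\<close>,
  is a null set.\<close>

definition sphere_uniform :: "'a::euclidean_space measure" where
  "sphere_uniform = distr ball_uniform borel sgn"

definition ball_smoothing :: "real \<Rightarrow> ('a::euclidean_space \<Rightarrow> real) \<Rightarrow> 'a \<Rightarrow> real" where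
  "ball_smoothing \<delta> f x = (\<integral>v. f (x + \<delta> *\<^sub>R v) \<partial>ball_uniform)"

text \<open>Unspecified where \<open>f\<close> is not differentiable; the ball smoothing of a Lipschitz function is
  differentiable everywhere.\<close>

definition gradient :: "('a::euclidean_space \<Rightarrow> real) \<Rightarrow> 'a \<Rightarrow> 'a" where
  "gradient f x = (THE D. GDERIV f x :> D)"


section \<open>Clarke subdifferential and Goldstein stationarity\<close>

definition clarke_derivative :: "('a::euclidean_space \<Rightarrow> real) \<Rightarrow> 'a \<Rightarrow> 'a \<Rightarrow> ereal" where
  "clarke_derivative f x h =
     Limsup (nhds x \<times>\<^sub>F at_right 0) (\<lambda>(y, s). ereal ((f (y + s *\<^sub>R h) - f y) / s))"

definition clarke_subdifferential :: "('a::euclidean_space \<Rightarrow> real) \<Rightarrow> 'a \<Rightarrow> 'a set" where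
  "clarke_subdifferential f x = {\<xi>. \<forall>h. ereal (\<xi> \<bullet> h) \<le> clarke_derivative f x h}"

definition goldstein_subdifferential ::
    "real \<Rightarrow> ('a::euclidean_space \<Rightarrow> real) \<Rightarrow> 'a \<Rightarrow> 'a set" where
  "goldstein_subdifferential \<delta> f x = convex hull (\<Union>z\<in>cball x \<delta>. clarke_subdifferential f z)"

text \<open>The distance to the empty set is infinite in the literature, whereas
  \<^term>\<open>infdist x {} = 0\<close>; hence the nonemptiness condition.\<close>

definition goldstein_stationary ::
    "('a::euclidean_space \<Rightarrow> real) \<Rightarrow> real \<Rightarrow> real \<Rightarrow> 'a \<Rightarrow> bool" where
  "goldstein_stationary f \<delta> \<epsilon> x \<longleftrightarrow>
     goldstein_subdifferential \<delta> f x \<noteq> {} \<and> infdist 0 (goldstein_subdifferential \<delta> f x) \<le> \<epsilon>"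

text \<open>For a random point, \<open>(\<delta>, \<epsilon>)\<close>-Goldstein stationarity is understood in expectation.\<close>

definition goldstein_stationary_in_expectation ::
    "'w measure \<Rightarrow> ('a::euclidean_space \<Rightarrow> real) \<Rightarrow> real \<Rightarrow> real \<Rightarrow> ('w \<Rightarrow> 'a) \<Rightarrow> bool" where
  "goldstein_stationary_in_expectation P f \<delta> \<epsilon> X \<longleftrightarrow>
     (AE \<omega> in P. goldstein_subdifferential \<delta> f (X \<omega>) \<noteq> {}) \<and>
     integrable P (\<lambda>\<omega>. infdist 0 (goldstein_subdifferential \<delta> f (X \<omega>))) \<and>
     (\<integral>\<omega>. infdist 0 (goldstein_subdifferential \<delta> f (X \<omega>)) \<partial>P) \<le> \<epsilon>"


section \<open>Comparison oracle and Russian roulette gap estimator\<close>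

definition symmetric_link :: "(real \<Rightarrow> real) \<Rightarrow> bool" where
  "symmetric_link \<sigma> \<longleftrightarrow>
     strict_mono \<sigma> \<and> (\<forall>t. 0 < \<sigma> t \<and> \<sigma> t < 1) \<and> (\<forall>t. \<sigma> (- t) = 1 - \<sigma> t)"

definition comparison_prob ::
    "(real \<Rightarrow> real) \<Rightarrow> real \<Rightarrow> ('a \<Rightarrow> real) \<Rightarrow> 'a \<Rightarrow> 'a \<Rightarrow> real" where
  "comparison_prob \<sigma> \<tau> f x y = \<sigma> ((f y - f x) / \<tau>)"

text \<open>The expansion of \<open>g = inv \<sigma>\<close> on the interval from \<open>\<sigma> (- a)\<close> to \<open>\<sigma> a\<close>, with \<open>a = B / \<tau>\<close> in
  the application. The series starts at \<open>k = 1\<close>, hence the shift by \<^const>\<open>Suc\<close>. Since \<open>\<sigma>\<close> is not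
  assumed to be continuous, \<open>g\<close> is only defined on the range of \<open>\<sigma>\<close>.\<close>

definition link_expansion ::
    "(real \<Rightarrow> real) \<Rightarrow> (nat \<Rightarrow> real) \<Rightarrow> (nat \<Rightarrow> nat) \<Rightarrow> real \<Rightarrow> bool" where
  "link_expansion \<sigma> c m a \<longleftrightarrow>
     (\<forall>k\<ge>1. m k \<ge> 1) \<and>
     (\<forall>p\<in>{\<sigma> (- a)..\<sigma> a}.
        summable (\<lambda>k. \<bar>c (m (Suc k)) * (p ^ m (Suc k) - (1 - p) ^ m (Suc k))\<bar>)) \<and>
     (\<forall>p\<in>{\<sigma> (- a)..\<sigma> a} \<inter> range \<sigma>.
        inv \<sigma> p = (\<Sum>k. c (m (Suc k)) * (p ^ m (Suc k) - (1 - p) ^ m (Suc k))))"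

definition roulette_tail :: "nat pmf \<Rightarrow> nat \<Rightarrow> real" where
  "roulette_tail \<rho> k = measure_pmf.prob \<rho> {k..}"

text \<open>The second condition says that the weights \<open>c (m k) / q k\<close> of the estimator are meaningful,
  i.e. that no nonzero term of the expansion is cut off with probability one, which would make the
  estimator biased.\<close>

definition valid_roulette :: "(nat \<Rightarrow> real) \<Rightarrow> (nat \<Rightarrow> nat) \<Rightarrow> nat pmf \<Rightarrow> bool" where
  "valid_roulette c m \<rho> \<longleftrightarrow>
     set_pmf \<rho> \<subseteq> {1..} \<and> (\<forall>k\<ge>1. c (m k) \<noteq> 0 \<longrightarrow> roulette_tail \<rho> k > 0)"

text \<open>The value of the estimator when the roulette variable takes the value \<open>n\<close> and \<open>y k j\<close> is the
  \<open>j\<close>-th outcome in the \<open>k\<close>-th block.\<close>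

definition gap_estimate ::
    "real \<Rightarrow> (nat \<Rightarrow> real) \<Rightarrow> (nat \<Rightarrow> nat) \<Rightarrow> nat pmf \<Rightarrow> nat \<Rightarrow> (nat \<Rightarrow> nat \<Rightarrow> bool) \<Rightarrow> real" where
  "gap_estimate \<tau> c m \<rho> n y =
     \<tau> * (\<Sum>k=1..n. c (m k) / roulette_tail \<rho> k *
            (of_bool (\<forall>j<m k. y k j) - of_bool (\<forall>j<m k. \<not> y k j)))"

definition comparisons_used :: "(nat \<Rightarrow> nat) \<Rightarrow> nat \<Rightarrow> nat" where
  "comparisons_used m n = (\<Sum>k=1..n. m k)"


section \<open>Comparison-SGD\<close>

definition join_algebra :: "'w measure \<Rightarrow> 'w measure \<Rightarrow> 'w measure" where
  "join_algebra F G = sigma (space F) (sets F \<union> sets G)"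

text \<open>Everything drawn before step \<open>t\<close>: the directions \<open>u s\<close>, the roulette variables \<open>K s\<close> and the
  comparison outcomes \<open>Y s k j\<close> for \<open>s < t\<close>.\<close>

definition sgd_history ::
    "'w measure \<Rightarrow> (nat \<Rightarrow> 'w \<Rightarrow> 'a::euclidean_space) \<Rightarrow> (nat \<Rightarrow> 'w \<Rightarrow> nat) \<Rightarrow>
     (nat \<Rightarrow> nat \<Rightarrow> nat \<Rightarrow> 'w \<Rightarrow> bool) \<Rightarrow> nat \<Rightarrow> 'w measure" where
  "sgd_history P u K Y t = sigma (space P)
     (\<Union>s<t. sets (vimage_algebra (space P) (u s) borel) \<union>
            sets (vimage_algebra (space P) (K s) (count_space UNIV)) \<union>
            (\<Union>k j. sets (vimage_algebra (space P) (Y s k j) (count_space UNIV))))"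

text \<open>A run of \<open>T\<close> steps on an arbitrary probability space. Step \<open>t\<close> uses a direction \<open>u t\<close>
  independent of the past, a roulette variable \<open>K t\<close> (the variable \<open>M\<close> of the estimator) with law
  \<open>\<rho>\<close> independent of the past and of \<open>u t\<close>, and fresh outcomes \<open>Y t k j\<close> of the query at
  \<open>(x t - \<delta> u t, x t + \<delta> u t)\<close>, which are, conditionally on all of these, independent and
  identically distributed with the success probability prescribed by the oracle. Only the outcomes
  with \<open>1 \<le> k \<le> K t\<close> and \<open>j < m k\<close> enter the gap estimate \<open>D t\<close>.\<close>

locale comparison_sgd = prob_space P for P :: "'w measure" +
  fixes f :: "'a::euclidean_space \<Rightarrow> real"
    and \<sigma> :: "real \<Rightarrow> real" and \<tau> :: real
    and c :: "nat \<Rightarrow> real" and m :: "nat \<Rightarrow> nat" and \<rho> :: "nat pmf"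
    and \<delta> \<eta> :: real and x0 :: 'a and T :: nat
    and u :: "nat \<Rightarrow> 'w \<Rightarrow> 'a" and K :: "nat \<Rightarrow> 'w \<Rightarrow> nat"
    and Y :: "nat \<Rightarrow> nat \<Rightarrow> nat \<Rightarrow> 'w \<Rightarrow> bool"
    and D :: "nat \<Rightarrow> 'w \<Rightarrow> real" and x :: "nat \<Rightarrow> 'w \<Rightarrow> 'a"
  assumes u_measurable: "\<And>t. t < T \<Longrightarrow> random_variable borel (u t)"
    and K_measurable: "\<And>t. t < T \<Longrightarrow> random_variable (count_space UNIV) (K t)"
    and Y_measurable: "\<And>t k j. t < T \<Longrightarrow> random_variable (count_space UNIV) (Y t k j)"
    and u_law: "\<And>t. t < T \<Longrightarrow> distr P borel (u t) = sphere_uniform"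
    and u_indep: "\<And>t. t < T \<Longrightarrow>
      indep_set (sets (sgd_history P u K Y t)) (sets (vimage_algebra (space P) (u t) borel))"
    and K_law: "\<And>t. t < T \<Longrightarrow> distr P (count_space UNIV) (K t) = measure_pmf \<rho>"
    and K_indep: "\<And>t. t < T \<Longrightarrow>
      indep_set
        (sets (join_algebra (sgd_history P u K Y t) (vimage_algebra (space P) (u t) borel)))
        (sets (vimage_algebra (space P) (K t) (count_space UNIV)))"
    and Y_law: "\<And>t J b. t < T \<Longrightarrow> finite J \<Longrightarrow>
      AE \<omega> in P.
        real_cond_exp P
          (join_algebra
            (join_algebra (sgd_history P u K Y t) (vimage_algebra (space P) (u t) borel))
            (vimage_algebra (space P) (K t) (count_space UNIV)))
          (indicator {\<omega> \<in> space P. \<forall>(k, j)\<in>J. Y t k j \<omega> = b k j}) \<omega> =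
        (\<Prod>(k, j)\<in>J.
           let p = comparison_prob \<sigma> \<tau> f (x t \<omega> - \<delta> *\<^sub>R u t \<omega>) (x t \<omega> + \<delta> *\<^sub>R u t \<omega>)
           in if b k j then p else 1 - p)"
    and gap: "\<And>t \<omega>. t < T \<Longrightarrow> \<omega> \<in> space P \<Longrightarrow>
      D t \<omega> = gap_estimate \<tau> c m \<rho> (K t \<omega>) (\<lambda>k j. Y t k j \<omega>)"
    and start: "\<And>\<omega>. \<omega> \<in> space P \<Longrightarrow> x 0 \<omega> = x0"
    and step: "\<And>t \<omega>. t < T \<Longrightarrow> \<omega> \<in> space P \<Longrightarrow>
      x (Suc t) \<omega> = x t \<omega> - \<eta> *\<^sub>R ((real DIM('a) / (2 * \<delta>) * D t \<omega>) *\<^sub>R u t \<omega>)"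

end

theory Submission
  imports Defs
begin

text \<open>The randomized smoothing \<open>f\<^sub>\<delta>\<close> is differentiable with gradient
  \<open>(d/\<delta>) E[f(x + \<delta>U) U]\<close>, \<open>U\<close> uniform on the sphere. No surface integration is needed: replace the
  indicator of the ball by the hat function that decreases linearly to \<open>0\<close> on a shell of thickness
  \<open>e\<close>, differentiate under the integral sign, and let \<open>e \<rightarrow> 0\<close>; the integral over the shell of a function
  that is homogeneous of degree \<open>0\<close> follows from the scaling of Lebesgue measure. For linear \<open>f\<close> the
  formula says \<open>E[(U \<bullet> h)\<^sup>2] = |h|\<^sup>2/d\<close>, which makes the gradient Lipschitz with constant \<open>L\<^sub>\<delta>\<close>.

  The directional derivative of \<open>f\<^sub>\<delta>\<close> is at most the mean of the Clarke derivatives of \<open>f\<close> over the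
  ball, so by separation the gradient lies in the closure of the Goldstein subdifferential.

  The roulette estimator is unbiased by interchanging sum and expectation; the absolute convergence
  this needs comes from the expansion at the right end point \<open>p\<^sub>+ > 1/2\<close>, where
  \<open>p\<^sup>m - (1 - p)\<^sup>m\<close> is comparable to \<open>p\<^sup>m\<close>. Then the usual descent argument applies. In part (2), when
  the step size is \<open>1/L\<^sub>\<delta>\<close>, the bound of part (1) is too weak, and one uses instead that
  \<open>E|\<nabla>f\<^sub>\<delta>(x\<^sub>t)|\<^sup>2\<close> is at most the second moment of \<open>G\<^sub>t\<close>, because \<open>G\<^sub>t\<close> is unbiased.\<close>

section \<open>Differentiating integrals over the ball\<close>

text \<open>Convergence of the hat integrals and of their derivatives would not by itself make the
  limit differentiable. What survives is a quadratic remainder whose constant is free of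
  \<open>e\<close>: the slope \<open>1 / e\<close> of the hat is paid for by the volume of the
  shell, which is at most \<open>e\<close> times d times the volume of the unit ball. The resulting
  constant d L / \<delta> gives differentiability but is too crude for
  \<open>L\<^sub>\<delta>\<close>; the factor sqrt d is gained afterwards, from the first absolute
  moment of U \<bullet> a on the sphere. Unbiasedness is used in the tested form E[Z D] = E[Z gap],
  with Z bounded and measurable with respect to the past and the direction; the test function u
  \<bullet> grad is bounded because the gradient has norm at most d L. The optimal step size can be
  0, which is why a bound on the gradient by the function gap enters. Stationarity in expectation
  integrates the distance of 0 to the Goldstein subdifferential, so this distance must be
  measurable; its sublevel sets are closed, by compactness and the closed graph of the Clarke
  subdifferential.\<close>

lemma has_real_derivative_integral:
  fixes q :: "real \<Rightarrow> 'b \<Rightarrow> real"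
  assumes int: "\<And>s. integrable M (q s)" and meas: "q' \<in> borel_measurable M"
    and deriv: "AE v in M. ((\<lambda>s. q s v) has_real_derivative q' v) (at 0)"
    and bound: "\<And>s. AE v in M. \<bar>s\<bar> \<le> 1 \<longrightarrow> \<bar>q s v - q 0 v\<bar> \<le> \<bar>s\<bar> * W v"
    and W: "integrable M W"
  shows "((\<lambda>s. \<integral>v. q s v \<partial>M) has_real_derivative (\<integral>v. q' v \<partial>M)) (at 0)"
  unfolding has_field_derivative_iff tendsto_at_iff_sequentially
proof (intro allI impI)
  fix X :: "nat \<Rightarrow> real" assume X: "\<forall>i. X i \<in> UNIV - {0}" "X \<longlonglongrightarrow> 0"
  then have "eventually (\<lambda>n. \<bar>X n\<bar> < 1) sequentially"
    using tendstoD[OF X(2), of 1] by (simp add: dist_norm)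
  then obtain N where "\<And>n. n \<ge> N \<Longrightarrow> \<bar>X n\<bar> < 1"
    unfolding eventually_sequentially by blast
  \<comment> \<open>The domination in \<open>bound\<close> is available for
    \<open>\<bar>s\<bar> \<le> 1\<close> only, hence the shift of the sequence by
    \<open>N\<close>.\<close>
  then have N: "\<bar>X (n + N)\<bar> \<le> 1" for n
    by (meson le_add2 less_imp_le)
  have XN: "(\<lambda>n. X (n + N)) \<longlonglongrightarrow> 0"
    using X(2) by (rule LIMSEQ_ignore_initial_segment)
  have q_meas[measurable]: "q s \<in> borel_measurable M" for s
    using int by (rule borel_measurable_integrable)
  note meas[measurable]
  have "(\<lambda>n. \<integral>v. (q (X (n + N)) v - q 0 v) / X (n + N) \<partial>M) \<longlonglongrightarrow> (\<integral>v. q' v \<partial>M)"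
  proof (rule integral_dominated_convergence[where w=W])
    show "AE v in M. (\<lambda>n. (q (X (n + N)) v - q 0 v) / X (n + N)) \<longlonglongrightarrow> q' v"
      using deriv
    proof eventually_elim
      case (elim v)
      then have "(\<lambda>s. (q s v - q 0 v) / s) \<midarrow>0\<rightarrow> q' v"
        by (simp add: has_field_derivative_iff)
      moreover have "filterlim (\<lambda>n. X (n + N)) (at 0) sequentially"
        using X(1) XN by (simp add: filterlim_at)
      ultimately show ?case
        by (rule filterlim_compose)
    qed
    show "AE v in M. norm ((q (X (n + N)) v - q 0 v) / X (n + N)) \<le> W v" for n
      using bound[of "X (n + N)"]
    proof eventually_elim
      case (elim v)
      have "\<bar>X (n + N)\<bar> > 0" using X(1) by simp
      moreover have "\<bar>q (X (n + N)) v - q 0 v\<bar> \<le> \<bar>X (n + N)\<bar> * W v"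
        using elim N[of n] by simp
      ultimately show ?case by (simp add: abs_divide pos_divide_le_eq mult.commute)
    qed
    show "(\<lambda>v. (q (X (n + N)) v - q 0 v) / X (n + N)) \<in> borel_measurable M" for n
      by measurable
    show "q' \<in> borel_measurable M" "integrable M W" by fact+
  qed
  moreover have "(\<integral>v. (q (X (n + N)) v - q 0 v) / X (n + N) \<partial>M) =
      ((\<integral>v. q (X (n + N)) v \<partial>M) - (\<integral>v. q 0 v \<partial>M)) / X (n + N)" for n
    using int by (simp only: Bochner_Integration.integral_divide_zero Bochner_Integration.integral_diff)
  ultimately have "(\<lambda>n. ((\<lambda>s. (integral\<^sup>L M (q s) - integral\<^sup>L M (q 0)) / (s - 0)) \<circ> X) (n + N))
      \<longlonglongrightarrow> integral\<^sup>L M q'"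
    by (simp only: o_def diff_0_right)
  then show "((\<lambda>s. (integral\<^sup>L M (q s) - integral\<^sup>L M (q 0)) / (s - 0)) \<circ> X) \<longlonglongrightarrow> integral\<^sup>L M q'"
    by (rule LIMSEQ_offset)
qed

section \<open>Lebesgue integrals under translation and scaling\<close>

lemma lborel_integral_translate:
  fixes f :: "'a::euclidean_space \<Rightarrow> 'b::{banach, second_countable_topology}"
  assumes [measurable]: "f \<in> borel_measurable borel"
  shows "(\<integral>v. f (c + v) \<partial>lborel) = (\<integral>v. f v \<partial>lborel)"
  by (subst (2) lborel_distr_plus[symmetric, of c]) (simp add: integral_distr)

lemma lborel_integral_scale:
  fixes f :: "'a::euclidean_space \<Rightarrow> 'b::{banach, second_countable_topology}"
  assumes [measurable]: "f \<in> borel_measurable borel" and "r \<noteq> 0"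
  shows "(\<integral>v. f v \<partial>lborel) = \<bar>r\<bar> ^ DIM('a) *\<^sub>R (\<integral>v. f (r *\<^sub>R v) \<partial>lborel)"
  by (subst lborel_affine[OF \<open>r \<noteq> 0\<close>, of 0]) (simp add: integral_density integral_distr)

lemma sgn_measurable_borel[measurable]: "(sgn :: 'a::euclidean_space \<Rightarrow> 'a) \<in> borel_measurable borel"
  unfolding sgn_div_norm[abs_def] by measurable

lemma cball_borel[measurable]: "cball (c::'a::euclidean_space) r \<in> sets borel"
  by simp

text \<open>The integrand is homogeneous of degree 0, so the substitution of r v for v changes only
  the ball and produces the volume factor.\<close>

lemma set_integral_ball_radial:
  fixes \<phi> :: "'a::euclidean_space \<Rightarrow> 'b::{banach, second_countable_topology}"
  assumes [measurable]: "\<phi> \<in> borel_measurable borel" and r: "r > 0"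
  shows "(\<integral>v. indicat_real (cball 0 r) v *\<^sub>R \<phi> (sgn v) \<partial>lborel) =
    r ^ DIM('a) *\<^sub>R (\<integral>v. indicat_real (cball 0 1) v *\<^sub>R \<phi> (sgn v) \<partial>lborel)"
proof -
  have eq: "(indicat_real (cball 0 r) (r *\<^sub>R v)) = indicator (cball 0 1) v" for v :: 'a
    using r by (auto simp: indicator_def)
  have m: "(\<lambda>v. indicat_real (cball 0 r) v *\<^sub>R \<phi> (sgn v)) \<in> borel_measurable borel"
    by (intro borel_measurable_scaleR borel_measurable_indicator
        measurable_compose[OF sgn_measurable_borel assms(1)]) simp
  show ?thesis
    by (subst lborel_integral_scale[where r=r, OF m]) (use r in \<open>simp_all only: sgn_scaleR eq sgn_pos scaleR_one abs_of_pos\<close>)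
qed

section \<open>The hat function and its shell\<close>

definition hat :: "real \<Rightarrow> 'a::euclidean_space \<Rightarrow> real" where
  "hat e v = max 0 (min 1 ((1 - norm v) / e))"

definition shell :: "real \<Rightarrow> 'a::euclidean_space set" where
  "shell e = cball 0 1 - cball 0 (1 - e)"

lemma hat_measurable[measurable]: "hat e \<in> borel_measurable borel"
  unfolding hat_def[abs_def] by measurable

lemma shell_sets[measurable]: "shell e \<in> sets borel"
  unfolding shell_def by measurable

lemma hat_lipschitz: "e > 0 \<Longrightarrow> \<bar>hat e v - hat e w\<bar> \<le> norm (v - w) / e"
proof -
  assume e: "e > 0"
  have "\<bar>hat e v - hat e w\<bar> \<le> \<bar>(1 - norm v) / e - (1 - norm w) / e\<bar>"
    unfolding hat_def by linarith
  also have "\<dots> = \<bar>norm v - norm w\<bar> / e"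
    using e by (simp add: abs_minus_commute flip: diff_divide_distrib)
  also have "\<dots> \<le> norm (v - w) / e"
    using e by (intro divide_right_mono norm_triangle_ineq3) auto
  finally show ?thesis .
qed

lemma hat_bounds: "0 \<le> hat e v" "hat e v \<le> 1"
  unfolding hat_def by auto

lemma hat_outside: "e > 0 \<Longrightarrow> norm v \<ge> 1 \<Longrightarrow> hat e v = 0"
  unfolding hat_def by (simp add: divide_nonpos_pos)

lemma hat_inside: "e > 0 \<Longrightarrow> norm v \<le> 1 - e \<Longrightarrow> hat e v = 1"
  unfolding hat_def by simp

text \<open>The hat has kinks exactly on the two excluded spheres, which are null sets. Elsewhere it
  is locally constant or an affine function of the norm. The derivative is positive along
  \<open>sgn v\<close> because the argument moves against \<open>h\<close>.\<close>

lemma DERIV_hat: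
  assumes e: "0 < e" "e < 1" and v: "norm v \<noteq> 1" "norm v \<noteq> 1 - e"
  shows "((\<lambda>s. hat e (v - s *\<^sub>R h)) has_real_derivative indicator (shell e) v * (sgn v \<bullet> h) / e) (at 0)"
proof -
  have cont: "((\<lambda>s. norm (v - s *\<^sub>R h)) \<longlongrightarrow> norm v) (at 0)"
    by (auto intro!: tendsto_eq_intros)
  have cont': "((\<lambda>s. norm (v - s *\<^sub>R h)) \<longlongrightarrow> norm v) (nhds 0)"
    using cont tendsto_at_iff_tendsto_nhds[of "\<lambda>s. norm (v - s *\<^sub>R h)" 0] by simp
  consider "norm v < 1 - e" | "1 < norm v" | "1 - e < norm v" "norm v < 1"
    using v by linarith
  then show ?thesis
  proof cases
    case 1
    have ev: "eventually (\<lambda>s. hat e (v - s *\<^sub>R h) = 1) (nhds 0)"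
      using order_tendstoD(2)[OF cont' 1] by eventually_elim (use e in \<open>auto intro: hat_inside\<close>)
    show ?thesis
      by (subst DERIV_cong_ev[OF refl ev refl]) (use 1 in \<open>simp add: shell_def\<close>)
  next
    case 2
    have ev: "eventually (\<lambda>s. hat e (v - s *\<^sub>R h) = 0) (nhds 0)"
      using order_tendstoD(1)[OF cont' 2] by eventually_elim (use e in \<open>auto intro: hat_outside\<close>)
    show ?thesis
      by (subst DERIV_cong_ev[OF refl ev refl]) (use 2 in \<open>simp add: shell_def\<close>)
  next
    case 3
    have v0: "v \<noteq> 0" using 3 e by auto
    have ev: "eventually (\<lambda>s. hat e (v - s *\<^sub>R h) = (1 - norm (v - s *\<^sub>R h)) / e) (nhds 0)"
      using order_tendstoD(1)[OF cont' 3(1)] order_tendstoD(2)[OF cont' 3(2)]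
      by eventually_elim (use e in \<open>auto simp: hat_def\<close>)
    have g: "((\<lambda>s. v - s *\<^sub>R h) has_derivative (\<lambda>s. - (s *\<^sub>R h))) (at 0)"
      by (auto intro!: derivative_eq_intros)
    have n: "(norm has_derivative (\<lambda>k. k \<bullet> sgn v)) (at (v - 0 *\<^sub>R h))"
      using has_derivative_norm[OF v0] GDERIV_norm[OF v0] by (simp add: gderiv_def)
    have "((\<lambda>s. norm (v - s *\<^sub>R h)) has_derivative (\<lambda>s. - (s *\<^sub>R h) \<bullet> sgn v)) (at 0)"
      using has_derivative_compose[OF g n] .
    then have "((\<lambda>s. norm (v - s *\<^sub>R h)) has_real_derivative - (sgn v \<bullet> h)) (at 0)"
      unfolding has_field_derivative_def
      by (rule has_derivative_eq_rhs) (rule ext, simp only: inner_minus_left inner_scaleR_left inner_commute[of h] mult_minus_left mult.commute)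
    then have "((\<lambda>s. (1 - norm (v - s *\<^sub>R h)) / e) has_real_derivative (0 - - (sgn v \<bullet> h)) / e) (at 0)"
      by (intro DERIV_cdivide DERIV_diff DERIV_const)
    moreover have "indicator (shell e) v = (1::real)"
      using 3 by (auto simp: shell_def)
    ultimately show ?thesis
      by (subst DERIV_cong_ev[OF refl ev refl]) (simp only: mult_1 diff_0 minus_minus)
  qed
qed

lemma integrable_indicator_cball:
  "integrable lborel (indicat_real (cball (c::'a::euclidean_space) r))"
  using emeasure_lborel_cball_finite[of c r] by (intro integrable_real_indicator) auto

lemma integrable_bounded_support:
  fixes g :: "'a::euclidean_space \<Rightarrow> 'b::{banach, second_countable_topology}"
  assumes "g \<in> borel_measurable borel" "\<And>v. norm (g v) \<le> C * indicator (cball 0 r) v"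
  shows "integrable lborel g"
proof (rule Bochner_Integration.integrable_bound)
  show "integrable lborel (\<lambda>v. C * indicator (cball (0::'a) r) v)"
    by (intro integrable_mult_right integrable_indicator_cball)
qed (use assms in \<open>auto simp: order.trans[OF _ abs_ge_self]\<close>)

lemma lipschitz_bound:
  fixes f :: "'a::real_normed_vector \<Rightarrow> real"
  assumes "L-lipschitz_on UNIV f"
  shows "\<bar>f y - f z\<bar> \<le> L * norm (y - z)"
  using lipschitz_onD[OF assms, of y z] by (simp add: dist_norm)

lemma lipschitz_measurable:
  fixes f :: "'a::euclidean_space \<Rightarrow> real"
  assumes "L-lipschitz_on UNIV f"
  shows "f \<in> borel_measurable borel"
  using lipschitz_on_continuous_on[OF assms] by (rule borel_measurable_continuous_onI)

lemma AE_not_sphere: "AE v in lborel. norm (v::'a::euclidean_space) \<noteq> r"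
proof (rule AE_I')
  have "negligible (sphere (0::'a) r)" by (rule negligible_sphere)
  then show "sphere (0::'a) r \<in> null_sets lborel"
    by (auto simp: null_sets_completion_iff negligible_iff_null_sets)
qed auto

text \<open>As \<open>f\<close> need not be differentiable, a translation of the integral moves the
  increment from \<open>f\<close> to the hat, which is differentiable almost everywhere and
  Lipschitz.\<close>

lemma DERIV_smoothing_hat:
  fixes f :: "'a::euclidean_space \<Rightarrow> real"
  assumes lip: "L-lipschitz_on UNIV f" and e: "0 < e" "e < 1"
  shows "((\<lambda>s. \<integral>v. f (x + s *\<^sub>R h + v) * hat e v \<partial>lborel) has_real_derivative
    (\<integral>v. f (x + v) * (indicator (shell e) v * (sgn v \<bullet> h) / e) \<partial>lborel)) (at 0)"
proof -
  note [measurable] = lipschitz_measurable[OF lip]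
  have L0: "L \<ge> 0" using lip by (rule lipschitz_on_nonneg)
  have fb: "\<bar>f (x + v)\<bar> \<le> \<bar>f x\<bar> + L * r" if "norm v \<le> r" for v r
  proof -
    have "\<bar>f (x + v) - f x\<bar> \<le> L * norm v" using lipschitz_bound[OF lip, of "x + v" x] by simp
    also have "\<dots> \<le> L * r" using L0 that by (rule mult_left_mono[rotated])
    finally show ?thesis by linarith
  qed
  have shift: "(\<integral>v. f (x + s *\<^sub>R h + v) * hat e v \<partial>lborel) = (\<integral>v. f (x + v) * hat e (v - s *\<^sub>R h) \<partial>lborel)" for s
    using lborel_integral_translate[of "\<lambda>v. f (x + s *\<^sub>R h + v) * hat e v" "- s *\<^sub>R h"]
    by (simp add: algebra_simps)
  have supp: "hat e (v - s *\<^sub>R h) = 0" if "norm v > 1 + \<bar>s\<bar> * norm h" for v s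
  proof (rule hat_outside[OF e(1)])
    show "1 \<le> norm (v - s *\<^sub>R h)" using that norm_triangle_ineq2[of v "s *\<^sub>R h"] by simp
  qed
  show ?thesis unfolding shift
  proof (rule has_real_derivative_integral)
    \<comment> \<open>A bound for \<open>f\<close> on the ball of radius \<open>1 + norm h\<close>,
      which contains the supports of all hats shifted by \<open>s *\<^sub>R h\<close> with
      \<open>\<bar>s\<bar> \<le> 1\<close>, times the Lipschitz estimate of the hat.\<close>
    let ?C = "(\<bar>f x\<bar> + L * (1 + norm h)) * (norm h / e)"
    show "integrable lborel (\<lambda>v. f (x + v) * hat e (v - s *\<^sub>R h))" for s
    proof (rule integrable_bounded_support)
      show "norm (f (x + v) * hat e (v - s *\<^sub>R h)) \<le>
          (\<bar>f x\<bar> + L * (1 + \<bar>s\<bar> * norm h)) * indicator (cball 0 (1 + \<bar>s\<bar> * norm h)) v" for v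
      proof (cases "norm v > 1 + \<bar>s\<bar> * norm h")
        case False
        have "\<bar>f (x + v)\<bar> * \<bar>hat e (v - s *\<^sub>R h)\<bar> \<le> (\<bar>f x\<bar> + L * (1 + \<bar>s\<bar> * norm h)) * 1"
          using fb[of v "1 + \<bar>s\<bar> * norm h"] False hat_bounds[of e "v - s *\<^sub>R h"] L0
          by (intro mult_mono) auto
        then show ?thesis using False by (simp add: abs_mult)
      qed (simp add: supp)
    qed measurable
    show "(\<lambda>v. f (x + v) * (indicator (shell e) v * (sgn v \<bullet> h) / e)) \<in> borel_measurable lborel"
      by measurable
    show "AE v in lborel. ((\<lambda>s. f (x + v) * hat e (v - s *\<^sub>R h)) has_real_derivative
        f (x + v) * (indicator (shell e) v * (sgn v \<bullet> h) / e)) (at 0)"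
      using AE_not_sphere[of 1] AE_not_sphere[of "1 - e"]
      by eventually_elim (intro DERIV_cmult DERIV_hat e)
    show "AE v in lborel. \<bar>s\<bar> \<le> 1 \<longrightarrow> \<bar>f (x + v) * hat e (v - s *\<^sub>R h) - f (x + v) * hat e (v - 0 *\<^sub>R h)\<bar>
        \<le> \<bar>s\<bar> * (?C * indicator (cball 0 (1 + norm h)) v)" for s
    proof (intro AE_I2 impI)
      fix v :: 'a assume s: "\<bar>s\<bar> \<le> 1"
      show "\<bar>f (x + v) * hat e (v - s *\<^sub>R h) - f (x + v) * hat e (v - 0 *\<^sub>R h)\<bar>
        \<le> \<bar>s\<bar> * (?C * indicator (cball 0 (1 + norm h)) v)"
      proof (cases "norm v > 1 + norm h")
        case True
        have "\<bar>s\<bar> * norm h \<le> 1 * norm h" using s by (intro mult_right_mono) auto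
        then have "hat e (v - s *\<^sub>R h) = 0" "hat e (v - 0 *\<^sub>R h) = 0"
          using True supp[of s v] supp[of 0 v] norm_ge_zero[of h] by (auto simp del: norm_ge_zero)
        then show ?thesis using True by simp
      next
        case False
        have "\<bar>f (x + v) * (hat e (v - s *\<^sub>R h) - hat e v)\<bar> = \<bar>f (x + v)\<bar> * \<bar>hat e (v - s *\<^sub>R h) - hat e v\<bar>"
          by (rule abs_mult)
        also have "\<dots> \<le> (\<bar>f x\<bar> + L * (1 + norm h)) * (norm (v - s *\<^sub>R h - v) / e)"
          using fb[of v "1 + norm h"] False L0 by (intro mult_mono hat_lipschitz e) auto
        also have "\<dots> = \<bar>s\<bar> * ?C" by simp
        finally show ?thesis using False by (simp add: right_diff_distrib)
      qed
    qed
    show "integrable lborel (\<lambda>v. ?C * indicator (cball 0 (1 + norm h)) v)"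
      by (intro integrable_mult_right integrable_indicator_cball)
  qed
qed

text \<open>The shell is the difference of two concentric balls, and the integral over each of them
  scales like its volume.\<close>

lemma integral_shell_radial:
  fixes \<phi> :: "'a::euclidean_space \<Rightarrow> real"
  assumes [measurable]: "\<phi> \<in> borel_measurable borel" and bound: "\<And>v. \<bar>\<phi> (sgn v)\<bar> \<le> C"
    and e: "0 < e" "e < 1"
  shows "(\<integral>v. indicator (shell e) v * \<phi> (sgn v) \<partial>lborel) =
    (1 - (1 - e) ^ DIM('a)) * (\<integral>v. indicator (cball 0 1) v * \<phi> (sgn v) \<partial>lborel)"
proof -
  have int: "integrable lborel (\<lambda>v. indicat_real (cball 0 r) v * \<phi> (sgn v))" for r
  proof (rule integrable_bounded_support)
    show "norm (indicat_real (cball 0 r) v * \<phi> (sgn v)) \<le> C * indicator (cball 0 r) v" for v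
      using bound[of v] by (auto simp: indicator_def)
  qed measurable
  have "indicator (shell e) v = indicat_real (cball 0 1) v - indicator (cball 0 (1 - e)) v" for v :: 'a
    using e by (auto simp: shell_def indicator_def)
  then have "(\<integral>v. indicator (shell e) v * \<phi> (sgn v) \<partial>lborel) =
      (\<integral>v. indicator (cball 0 1) v * \<phi> (sgn v) \<partial>lborel) - (\<integral>v. indicator (cball 0 (1 - e)) v * \<phi> (sgn v) \<partial>lborel)"
    using Bochner_Integration.integral_diff[OF int int] by (simp only: left_diff_distrib)
  also have "(\<integral>v. indicator (cball 0 (1 - e)) v * \<phi> (sgn v) \<partial>lborel) =
      (1 - e) ^ DIM('a) * (\<integral>v. indicator (cball 0 1) v * \<phi> (sgn v) \<partial>lborel)"
    using set_integral_ball_radial[of \<phi> "1 - e"] e by simp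
  finally show ?thesis by (simp add: algebra_simps)
qed

lemma measure_shell:
  assumes e: "0 < e" "e < 1"
  shows "measure lborel (shell e :: 'a::euclidean_space set) =
    (1 - (1 - e) ^ DIM('a)) * measure lborel (cball (0::'a) 1)"
  using integral_shell_radial[of "\<lambda>_::'a. 1" 1, OF _ _ e] by simp

text \<open>Bernoulli's inequality. The factor \<open>e\<close> is the one that cancels the slope
  \<open>1 / e\<close> of the hat.\<close>

lemma measure_shell_le:
  assumes e: "0 < e" "e < 1"
  shows "measure lborel (shell e :: 'a::euclidean_space set) \<le> e * (real DIM('a) * measure lborel (cball (0::'a) 1))"
proof -
  have "1 - real DIM('a) * e \<le> (1 - e) ^ DIM('a)"
    using Bernoulli_inequality[of "- e" "DIM('a)"] e by simp
  then have "(1 - (1 - e) ^ DIM('a)) * measure lborel (cball (0::'a) 1)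
      \<le> (real DIM('a) * e) * measure lborel (cball (0::'a) 1)"
    by (intro mult_right_mono) auto
  then show ?thesis unfolding measure_shell[OF e] by (simp add: mult_ac)
qed

lemma integrable_indicator_shell: "integrable lborel (indicat_real (shell e :: 'a::euclidean_space set))"
proof (rule integrable_bounded_support)
  show "norm (indicat_real (shell e) v) \<le> 1 * indicator (cball 0 1) v" for v :: 'a
    by (auto simp: shell_def indicator_def)
qed measurable

text \<open>By the mean value theorem the remainder is the change of the derivative \<open>H\<close>
  between \<open>x\<close> and an intermediate point. There \<open>f\<close> changes by at most
  \<open>L * norm h\<close>, the hat contributes \<open>norm h / e\<close>, and the shell has volume
  of order \<open>e\<close>. Since \<open>e\<close> drops out, the estimate passes to the
  limit.\<close>

lemma smoothing_hat_quadratic: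
  fixes f :: "'a::euclidean_space \<Rightarrow> real"
  assumes lip: "L-lipschitz_on UNIV f" and e: "0 < e" "e < 1"
  shows "\<bar>(\<integral>v. f (x + h + v) * hat e v \<partial>lborel) - (\<integral>v. f (x + v) * hat e v \<partial>lborel)
      - (\<integral>v. f (x + v) * (indicator (shell e) v * (sgn v \<bullet> h) / e) \<partial>lborel)\<bar>
    \<le> real DIM('a) * measure lborel (cball (0::'a) 1) * L * (norm h)\<^sup>2"
proof -
  note [measurable] = lipschitz_measurable[OF lip]
  have L0: "L \<ge> 0" using lip by (rule lipschitz_on_nonneg)
  define J where "J s = (\<integral>v. f (x + s *\<^sub>R h + v) * hat e v \<partial>lborel)" for s
  define H where "H y = (\<integral>v. f (y + v) * (indicator (shell e) v * (sgn v \<bullet> h) / e) \<partial>lborel)" for y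
  \<comment> \<open>The derivative at 0 is known for every base point; moving the base point along
    \<open>h\<close> gives the derivative at every \<open>s\<close>.\<close>
  have "(J has_real_derivative H (x + s *\<^sub>R h)) (at s)" for s
    using DERIV_smoothing_hat[OF lip e, of "x + s *\<^sub>R h" h] DERIV_shift[of J _ 0 s]
    unfolding J_def H_def by (simp add: algebra_simps)
  then obtain z where z: "0 < z" "z < 1" "J 1 - J 0 = (1 - 0) * H (x + z *\<^sub>R h)"
    using MVT2[of 0 1 J "\<lambda>s. H (x + s *\<^sub>R h)"] by auto
  have int: "integrable lborel (\<lambda>v. f (y + v) * (indicator (shell e) v * (sgn v \<bullet> h) / e))" for y
  proof (rule integrable_bounded_support)
    show "norm (f (y + v) * (indicator (shell e) v * (sgn v \<bullet> h) / e))
        \<le> ((\<bar>f y\<bar> + L) * (norm h / e)) * indicator (cball 0 1) v" for v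
    proof (cases "v \<in> shell e")
      case True
      then have v: "norm v \<le> 1" by (auto simp: shell_def)
      have "\<bar>f (y + v) - f y\<bar> \<le> L * norm v" using lipschitz_bound[OF lip, of "y + v" y] by simp
      also have "\<dots> \<le> L * 1" using v L0 by (intro mult_left_mono) auto
      finally have 1: "\<bar>f (y + v)\<bar> \<le> \<bar>f y\<bar> + L" by simp
      have "\<bar>sgn v \<bullet> h\<bar> \<le> norm (sgn v) * norm h" by (rule Cauchy_Schwarz_ineq2)
      also have "\<dots> \<le> 1 * norm h" by (intro mult_right_mono) (auto simp: norm_sgn)
      finally have 2: "\<bar>sgn v \<bullet> h\<bar> / e \<le> norm h / e" using e by (simp add: divide_right_mono)
      have "\<bar>f (y + v)\<bar> * (\<bar>sgn v \<bullet> h\<bar> / e) \<le> (\<bar>f y\<bar> + L) * (norm h / e)"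
        using 1 2 e L0 by (intro mult_mono) auto
      then show ?thesis using True v e by (simp add: abs_mult)
    qed (use L0 e in auto)
  qed measurable
  have "\<bar>H (x + z *\<^sub>R h) - H x\<bar> =
      \<bar>\<integral>v. (f (x + z *\<^sub>R h + v) - f (x + v)) * (indicator (shell e) v * (sgn v \<bullet> h) / e) \<partial>lborel\<bar>"
    unfolding H_def Bochner_Integration.integral_diff[OF int int, symmetric] by (simp only: left_diff_distrib)
  also have "\<dots> \<le> (\<integral>v. L * norm h * norm h / e * indicator (shell e :: 'a set) v \<partial>lborel)"
    unfolding real_norm_def[symmetric]
  proof (rule Bochner_Integration.integral_norm_bound_integral)
    show "integrable lborel (\<lambda>v. (f (x + z *\<^sub>R h + v) - f (x + v)) * (indicator (shell e) v * (sgn v \<bullet> h) / e))"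
      using Bochner_Integration.integrable_diff[OF int[of "x + z *\<^sub>R h"] int[of x]] by (simp only: left_diff_distrib)
    show "integrable lborel (\<lambda>v::'a. L * norm h * norm h / e * indicator (shell e) v)"
      by (intro integrable_mult_right integrable_indicator_shell)
    fix v :: 'a
    have "\<bar>f (x + z *\<^sub>R h + v) - f (x + v)\<bar> \<le> L * (z * norm h)"
      using lipschitz_bound[OF lip, of "x + z *\<^sub>R h + v" "x + v"] z by simp
    also have "\<dots> \<le> L * (1 * norm h)" using z L0 by (intro mult_left_mono mult_right_mono) auto
    finally have 1: "\<bar>f (x + z *\<^sub>R h + v) - f (x + v)\<bar> \<le> L * norm h" by simp
    have "\<bar>sgn v \<bullet> h\<bar> \<le> norm (sgn v) * norm h" by (rule Cauchy_Schwarz_ineq2)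
    also have "\<dots> \<le> 1 * norm h" by (intro mult_right_mono) (auto simp: norm_sgn)
    finally have 2: "\<bar>sgn v \<bullet> h\<bar> / e \<le> norm h / e" using e by (simp add: divide_right_mono)
    have "\<bar>f (x + z *\<^sub>R h + v) - f (x + v)\<bar> * (\<bar>sgn v \<bullet> h\<bar> / e) \<le> (L * norm h) * (norm h / e)"
      using 1 2 e L0 by (intro mult_mono) auto
    then show "norm ((f (x + z *\<^sub>R h + v) - f (x + v)) * (indicator (shell e) v * (sgn v \<bullet> h) / e))
        \<le> L * norm h * norm h / e * indicator (shell e) v"
      using e by (auto simp: indicator_def abs_mult)
  qed
  also have "\<dots> = L * norm h * norm h / e * measure lborel (shell e :: 'a set)"
    by simp
  also have "\<dots> \<le> L * norm h * norm h / e * (e * (real DIM('a) * measure lborel (cball (0::'a) 1)))"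
    using L0 e by (intro mult_left_mono measure_shell_le e) auto
  also have "\<dots> = real DIM('a) * measure lborel (cball (0::'a) 1) * L * (norm h)\<^sup>2"
    using e by (simp add: power2_eq_square)
  finally show ?thesis
    using z(3) unfolding J_def H_def by simp
qed

text \<open>Points of the shell are within \<open>e\<close> of their radial projection, so replacing
  \<open>f (x + v)\<close> by \<open>f (x + sgn v)\<close> costs only O(e). The new integrand is
  homogeneous of degree 0, and its integral is the one over the ball times
  \<open>(1 - (1 - e) ^ DIM('a)) / e\<close>, a difference quotient that tends to the
  dimension.\<close>

lemma shell_integral_tendsto:
  fixes f :: "'a::euclidean_space \<Rightarrow> real"
  assumes lip: "L-lipschitz_on UNIV f" and e: "\<And>n. 0 < e n" "\<And>n. e n < 1" "e \<longlonglongrightarrow> 0"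
  shows "(\<lambda>n. \<integral>v. f (x + v) * (indicator (shell (e n)) v * (sgn v \<bullet> h) / e n) \<partial>lborel)
    \<longlonglongrightarrow> real DIM('a) * (\<integral>v. indicator (cball 0 1) v * (f (x + sgn v) * (sgn v \<bullet> h)) \<partial>lborel)"
proof -
  note [measurable] = lipschitz_measurable[OF lip]
  have L0: "L \<ge> 0" using lip by (rule lipschitz_on_nonneg)
  have sh: "\<bar>sgn v \<bullet> h\<bar> \<le> norm h" for v
    using Cauchy_Schwarz_ineq2[of "sgn v" h] by (auto simp: norm_sgn split: if_splits)
  have fb: "\<bar>f (x + v)\<bar> \<le> \<bar>f x\<bar> + L" if "norm v \<le> 1" for v
  proof -
    have "\<bar>f (x + v) - f x\<bar> \<le> L * norm v" using lipschitz_bound[OF lip, of "x + v" x] by simp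
    also have "\<dots> \<le> L * 1" using that L0 by (intro mult_left_mono) auto
    finally show ?thesis by simp
  qed
  let ?V = "measure lborel (cball (0::'a) 1)"
  let ?I = "\<integral>v. indicator (cball 0 1) v * (f (x + sgn v) * (sgn v \<bullet> h)) \<partial>lborel"
  let ?H = "\<lambda>n. \<integral>v. f (x + v) * (indicator (shell (e n)) v * (sgn v \<bullet> h) / e n) \<partial>lborel"
  let ?A = "\<lambda>n. (1 - (1 - e n) ^ DIM('a)) / e n"
  have int: "integrable lborel (\<lambda>v. g (x + v) * (indicator (shell (e n)) v * (sgn v \<bullet> h) / e n))"
    if [measurable]: "(\<lambda>v. g (x + v)) \<in> borel_measurable borel"
    and g: "\<And>v. v \<in> shell (e n) \<Longrightarrow> \<bar>g (x + v)\<bar> \<le> \<bar>f x\<bar> + L" for g n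
  proof (rule integrable_bounded_support)
    show "norm (g (x + v) * (indicator (shell (e n)) v * (sgn v \<bullet> h) / e n))
        \<le> ((\<bar>f x\<bar> + L) * (norm h / e n)) * indicator (cball 0 1) v" for v
    proof (cases "v \<in> shell (e n)")
      case True
      have "\<bar>g (x + v)\<bar> * (\<bar>sgn v \<bullet> h\<bar> / e n) \<le> (\<bar>f x\<bar> + L) * (norm h / e n)"
        using g[OF True] sh[of v] e(1)[of n] L0 by (intro mult_mono divide_right_mono) auto
      moreover have "v \<in> cball 0 1" using True by (auto simp: shell_def)
      ultimately show ?thesis using True e(1)[of n] by (simp add: abs_mult)
    qed (use L0 e(1)[of n] in auto)
  qed measurable
  have "\<bar>?H n - ?A n * ?I\<bar> \<le> e n * (L * norm h * real DIM('a) * ?V)" for n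
  proof -
    have "?A n * ?I = (\<integral>v. indicator (shell (e n)) v * (f (x + sgn v) * (sgn v \<bullet> h)) \<partial>lborel) / e n"
    proof (subst integral_shell_radial[where \<phi>="\<lambda>w. f (x + w) * (w \<bullet> h)" and C="(\<bar>f x\<bar> + L) * norm h"])
      show "\<bar>f (x + sgn v) * (sgn v \<bullet> h)\<bar> \<le> (\<bar>f x\<bar> + L) * norm h" for v
        unfolding abs_mult using L0 by (intro mult_mono sh fb) (auto simp: norm_sgn)
    qed (use e in auto)
    also have "\<dots> = (\<integral>v. f (x + sgn v) * (indicator (shell (e n)) v * (sgn v \<bullet> h) / e n) \<partial>lborel)"
      by (simp add: mult_ac flip: Bochner_Integration.integral_divide_zero)
    finally have A: "?A n * ?I = \<dots>" .
    have i1: "integrable lborel (\<lambda>v. f (x + v) * (indicator (shell (e n)) v * (sgn v \<bullet> h) / e n))"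
      by (rule int) (auto intro!: fb simp: shell_def)
    \<comment> \<open>\<open>int\<close> evaluates its function at \<open>x + v\<close>; the shifted
      argument \<open>v - x\<close> turns this into the radial projection of
      \<open>v\<close>.\<close>
    have i2: "integrable lborel (\<lambda>v. f (x + sgn v) * (indicator (shell (e n)) v * (sgn v \<bullet> h) / e n))"
      using int[of "\<lambda>v. f (x + sgn (v - x))" n] by (simp add: fb norm_sgn)
    have "\<bar>?H n - ?A n * ?I\<bar> =
        norm (\<integral>v. (f (x + v) - f (x + sgn v)) * (indicator (shell (e n)) v * (sgn v \<bullet> h) / e n) \<partial>lborel)"
      unfolding A real_norm_def Bochner_Integration.integral_diff[OF i1 i2, symmetric] by (simp only: left_diff_distrib)
    also have "\<dots> \<le> (\<integral>v. L * norm h * indicator (shell (e n) :: 'a set) v \<partial>lborel)"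
    proof (rule Bochner_Integration.integral_norm_bound_integral)
      show "integrable lborel (\<lambda>v. (f (x + v) - f (x + sgn v)) * (indicator (shell (e n)) v * (sgn v \<bullet> h) / e n))"
        using Bochner_Integration.integrable_diff[OF i1 i2] by (simp only: left_diff_distrib)
      show "integrable lborel (\<lambda>v::'a. L * norm h * indicator (shell (e n)) v)"
        by (intro integrable_mult_right integrable_indicator_shell)
      fix v :: 'a
      show "norm ((f (x + v) - f (x + sgn v)) * (indicator (shell (e n)) v * (sgn v \<bullet> h) / e n))
        \<le> L * norm h * indicator (shell (e n)) v"
      proof (cases "v \<in> shell (e n)")
        case True
        then have v: "norm v \<le> 1" "1 - norm v \<le> e n" "v \<noteq> 0" using e(2)[of n] by (auto simp: shell_def)
        have "v - sgn v = (norm v - 1) *\<^sub>R sgn v"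
          using v(3) by (simp add: sgn_div_norm left_diff_distrib scaleR_left_diff_distrib)
        then have "norm (v - sgn v) = 1 - norm v"
          using v by (simp add: norm_sgn)
        then have "\<bar>f (x + v) - f (x + sgn v)\<bar> \<le> L * (1 - norm v)"
          using lipschitz_bound[OF lip, of "x + v" "x + sgn v"] by simp
        also have "\<dots> \<le> L * e n" using v L0 by (intro mult_left_mono) auto
        finally have "\<bar>f (x + v) - f (x + sgn v)\<bar> * (\<bar>sgn v \<bullet> h\<bar> / e n) \<le> (L * e n) * (norm h / e n)"
          using sh[of v] e(1)[of n] L0 by (intro mult_mono divide_right_mono) auto
        then show ?thesis using True e(1)[of n] by (simp add: abs_mult)
      qed simp
    qed
    also have "\<dots> = L * norm h * measure lborel (shell (e n) :: 'a set)" by simp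
    also have "\<dots> \<le> L * norm h * (e n * (real DIM('a) * ?V))"
      using L0 e by (intro mult_left_mono measure_shell_le) auto
    finally show ?thesis by (simp add: mult_ac)
  qed
  moreover have "(\<lambda>n. e n * (L * norm h * real DIM('a) * ?V)) \<longlonglongrightarrow> 0"
    using e(3) by (auto intro!: tendsto_eq_intros)
  ultimately have "(\<lambda>n. ?H n - ?A n * ?I) \<longlonglongrightarrow> 0"
    by (intro Lim_null_comparison[of "\<lambda>n. ?H n - ?A n * ?I" "\<lambda>n. e n * (L * norm h * real DIM('a) * ?V)"]) auto
  moreover have "?A \<longlonglongrightarrow> real DIM('a)"
  proof -
    have "((\<lambda>s::real. - ((1 - s) ^ DIM('a))) has_real_derivative real DIM('a)) (at 0)"
      by (auto intro!: derivative_eq_intros)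
    then have "(\<lambda>s. (1 - (1 - s) ^ DIM('a)) / s) \<midarrow>0\<rightarrow> real DIM('a)"
      by (simp add: has_field_derivative_iff)
    moreover have "filterlim e (at 0) sequentially"
      using e(1,3) by (simp add: filterlim_at less_imp_neq[symmetric])
    ultimately show ?thesis by (rule filterlim_compose)
  qed
  ultimately have "(\<lambda>n. (?H n - ?A n * ?I) + ?A n * ?I) \<longlonglongrightarrow> 0 + real DIM('a) * ?I"
    by (intro tendsto_add tendsto_mult tendsto_const)
  then show ?thesis by simp
qed

text \<open>The hats converge to the indicator of the open ball. On the sphere they vanish, but the
  sphere is a null set.\<close>

lemma smoothing_hat_tendsto:
  fixes f :: "'a::euclidean_space \<Rightarrow> real"
  assumes lip: "L-lipschitz_on UNIV f" and e: "\<And>n. 0 < e n" "\<And>n. e n < 1" "e \<longlonglongrightarrow> 0"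
  shows "(\<lambda>n. \<integral>v. f (x + v) * hat (e n) v \<partial>lborel) \<longlonglongrightarrow> (\<integral>v. indicator (cball 0 1) v * f (x + v) \<partial>lborel)"
proof (rule integral_dominated_convergence[where w="\<lambda>v. (\<bar>f x\<bar> + L) * indicator (cball 0 1) v"])
  note [measurable] = lipschitz_measurable[OF lip]
  have L0: "L \<ge> 0" using lip by (rule lipschitz_on_nonneg)
  show "(\<lambda>v. indicator (cball 0 1) v * f (x + v)) \<in> borel_measurable lborel"
    "(\<lambda>v. f (x + v) * hat (e n) v) \<in> borel_measurable lborel" for n
    by measurable
  show "integrable lborel (\<lambda>v::'a. (\<bar>f x\<bar> + L) * indicator (cball 0 1) v)"
    by (intro integrable_mult_right integrable_indicator_cball)
  show "AE v in lborel. (\<lambda>n. f (x + v) * hat (e n) v) \<longlonglongrightarrow> indicator (cball 0 1) v * f (x + v)"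
    using AE_not_sphere[of 1]
  proof eventually_elim
    case (elim v)
    show ?case
    proof (cases "norm v < 1")
      case True
      have "eventually (\<lambda>n. e n < 1 - norm v) sequentially"
        using order_tendstoD(2)[OF e(3)] True by simp
      then have "eventually (\<lambda>n. f (x + v) * hat (e n) v = f (x + v)) sequentially"
        by eventually_elim (use e(1) in \<open>simp add: hat_inside\<close>)
      then show ?thesis using True by (simp add: tendsto_eventually)
    qed (use elim e(1) in \<open>simp add: hat_outside\<close>)
  qed
  show "AE v in lborel. norm (f (x + v) * hat (e n) v) \<le> (\<bar>f x\<bar> + L) * indicator (cball 0 1) v" for n
  proof (rule AE_I2)
    fix v :: 'a
    show "norm (f (x + v) * hat (e n) v) \<le> (\<bar>f x\<bar> + L) * indicator (cball 0 1) v"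
    proof (cases "norm v \<le> 1")
      case True
      have "\<bar>f (x + v) - f x\<bar> \<le> L * norm v" using lipschitz_bound[OF lip, of "x + v" x] by simp
      also have "\<dots> \<le> L * 1" using True L0 by (intro mult_left_mono) auto
      finally have "\<bar>f (x + v)\<bar> * \<bar>hat (e n) v\<bar> \<le> (\<bar>f x\<bar> + L) * 1"
        using hat_bounds[of "e n" v] L0 by (intro mult_mono) auto
      then show ?thesis using True by (simp add: abs_mult)
    qed (use e(1) in \<open>simp add: hat_outside\<close>)
  qed
qed

text \<open>The limit of the estimate for the hats; a non-strict inequality with a constant free of
  \<open>e\<close> is preserved.\<close>

lemma integral_ball_quadratic:
  fixes f :: "'a::euclidean_space \<Rightarrow> real"
  assumes lip: "L-lipschitz_on UNIV f"
  shows "\<bar>(\<integral>v. indicator (cball 0 1) v * f (x + h + v) \<partial>lborel) - (\<integral>v. indicator (cball 0 1) v * f (x + v) \<partial>lborel)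
      - real DIM('a) * (\<integral>v. indicator (cball 0 1) v * (f (x + sgn v) * (sgn v \<bullet> h)) \<partial>lborel)\<bar>
    \<le> real DIM('a) * measure lborel (cball (0::'a) 1) * L * (norm h)\<^sup>2"
proof -
  \<comment> \<open>The offset 2 keeps every width strictly below 1.\<close>
  let ?e = "\<lambda>n. 1 / real (n + 2)"
  have e: "0 < ?e n" "?e n < 1" "?e \<longlonglongrightarrow> 0" for n
    using LIMSEQ_ignore_initial_segment[OF lim_1_over_n, of 2] by auto
  show ?thesis
    by (rule LIMSEQ_le_const2[OF tendsto_rabs[OF tendsto_diff[OF tendsto_diff[OF
      smoothing_hat_tendsto[OF lip e] smoothing_hat_tendsto[OF lip e]] shell_integral_tendsto[OF lip e]]]])
      (intro exI allI impI smoothing_hat_quadratic[OF lip e(1,2)])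
qed

section \<open>Randomized smoothing\<close>

lemma emeasure_unit_ball: "emeasure lborel (cball (0::'a::euclidean_space) 1) \<noteq> 0" "emeasure lborel (cball (0::'a) 1) \<noteq> top"
proof -
  show "emeasure lborel (cball (0::'a) 1) \<noteq> 0"
    by (simp add: emeasure_cball less_imp_neq[symmetric])
  show "emeasure lborel (cball (0::'a) 1) \<noteq> top"
    using emeasure_lborel_cball_finite[of "0::'a" 1] by simp
qed

lemma measure_unit_ball_pos: "measure lborel (cball (0::'a::euclidean_space) 1) > 0"
  using content_cball[of 1 "0::'a"] by simp

lemma prob_space_ball_uniform: "prob_space (ball_uniform :: 'a::euclidean_space measure)"
  unfolding ball_uniform_def using emeasure_unit_ball by (intro prob_space_uniform_measure) auto

lemma sets_ball_uniform[measurable_cong, simp]: "sets ball_uniform = sets borel"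
  by (simp add: ball_uniform_def)

lemma space_ball_uniform[simp]: "space ball_uniform = UNIV"
  by (simp add: ball_uniform_def)

lemma sets_sphere_uniform[measurable_cong, simp]: "sets sphere_uniform = sets borel"
  by (simp add: sphere_uniform_def)

lemma space_sphere_uniform[simp]: "space sphere_uniform = UNIV"
  by (simp add: sphere_uniform_def)

lemma sgn_measurable_ball_uniform[measurable]:
  "(sgn :: 'a::euclidean_space \<Rightarrow> 'a) \<in> ball_uniform \<rightarrow>\<^sub>M borel"
  using sgn_measurable_borel by (simp cong: measurable_cong_sets)

lemma prob_space_sphere_uniform: "prob_space (sphere_uniform :: 'a::euclidean_space measure)"
  unfolding sphere_uniform_def by (rule prob_space.prob_space_distr[OF prob_space_ball_uniform]) measurable

lemma integral_ball_uniform: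
  fixes g :: "'a::euclidean_space \<Rightarrow> 'b::{banach, second_countable_topology}"
  assumes [measurable]: "g \<in> borel_measurable borel"
  shows "(\<integral>v. g v \<partial>ball_uniform) =
    (\<integral>v. indicator (cball 0 1) v *\<^sub>R g v \<partial>lborel) /\<^sub>R measure lborel (cball (0::'a) 1)"
proof -
  let ?V = "measure lborel (cball (0::'a) 1)"
  have "indicator (cball 0 1) x / emeasure lborel (cball (0::'a) 1) = ennreal (indicator (cball 0 1) x / ?V)" for x :: 'a
    using measure_unit_ball_pos[where 'a='a]
    by (auto simp: emeasure_eq_ennreal_measure[OF emeasure_unit_ball(2)] divide_ennreal[symmetric] indicator_def)
  then have "ball_uniform = density lborel (\<lambda>x::'a. ennreal (indicator (cball 0 1) x / ?V))"
    by (simp add: ball_uniform_def uniform_measure_def)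
  then have "(\<integral>v. g v \<partial>ball_uniform) = (\<integral>v. (indicator (cball 0 1) v / ?V) *\<^sub>R g v \<partial>lborel)"
    using integral_density[of g lborel "\<lambda>x. indicator (cball 0 1) x / ?V"] by simp
  also have "\<dots> = (\<integral>v. inverse ?V *\<^sub>R (indicator (cball 0 1) v *\<^sub>R g v) \<partial>lborel)"
    by (simp add: divide_inverse_commute)
  finally show ?thesis by (simp only: integral_scaleR_right)
qed

lemma integral_sphere_uniform:
  fixes g :: "'a::euclidean_space \<Rightarrow> 'b::{banach, second_countable_topology}"
  assumes [measurable]: "g \<in> borel_measurable borel"
  shows "(\<integral>u. g u \<partial>sphere_uniform) =
    (\<integral>v. indicator (cball 0 1) v *\<^sub>R g (sgn v) \<partial>lborel) /\<^sub>R measure lborel (cball (0::'a) 1)"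
  unfolding sphere_uniform_def by (simp add: integral_distr integral_ball_uniform)

text \<open>Reflection preserves the ball and Lebesgue measure and commutes with \<open>sgn\<close>.
  This lets both halves of a central difference contribute equally.\<close>

lemma integral_sphere_uniform_uminus:
  fixes g :: "'a::euclidean_space \<Rightarrow> 'b::{banach, second_countable_topology}"
  assumes [measurable]: "g \<in> borel_measurable borel"
  shows "(\<integral>u. g (- u) \<partial>sphere_uniform) = (\<integral>u. g u \<partial>sphere_uniform)"
proof -
  have m: "(\<lambda>v::'a. indicat_real (cball 0 1) v *\<^sub>R g (sgn v)) \<in> borel_measurable borel"
    by measurable
  have "indicat_real (cball 0 1) (- v) = indicator (cball 0 1) v" for v :: 'a
    by (simp add: indicator_def)
  then show ?thesis
    using lborel_integral_scale[OF m, of "- 1"] by (simp add: integral_sphere_uniform sgn_minus)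
qed

lemma AE_ball_uniform: "AE v in ball_uniform. norm (v::'a::euclidean_space) \<le> 1"
  unfolding ball_uniform_def by (rule AE_uniform_measureI) auto

lemma AE_sphere_uniform: "AE u in sphere_uniform. norm (u::'a::euclidean_space) = 1"
proof -
  have "AE v in lborel. v \<noteq> (0::'a)"
    using AE_not_sphere[of 0] by simp
  then have "AE v in ball_uniform. norm (sgn v :: 'a) = 1"
    unfolding ball_uniform_def by (intro AE_uniform_measureI) (auto simp: norm_sgn elim: eventually_mono)
  then show ?thesis
    unfolding sphere_uniform_def by (subst AE_distr_iff) auto
qed

section \<open>The gradient of the smoothing\<close>

definition smoothing_gradient :: "real \<Rightarrow> ('a::euclidean_space \<Rightarrow> real) \<Rightarrow> 'a \<Rightarrow> 'a" where
  "smoothing_gradient \<delta> f x = (real DIM('a) / \<delta>) *\<^sub>R (\<integral>u. f (x + \<delta> *\<^sub>R u) *\<^sub>R u \<partial>sphere_uniform)"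

lemma lipschitz_bound_cball:
  fixes f :: "'a::real_normed_vector \<Rightarrow> real"
  assumes lip: "L-lipschitz_on UNIV f" and u: "norm u \<le> 1"
  shows "\<bar>f (x + \<delta> *\<^sub>R u)\<bar> \<le> \<bar>f x\<bar> + L * \<bar>\<delta>\<bar>"
proof -
  have "L * (\<bar>\<delta>\<bar> * norm u) \<le> L * (\<bar>\<delta>\<bar> * 1)"
    using u lipschitz_on_nonneg[OF lip] by (intro mult_left_mono) auto
  then show ?thesis using lipschitz_bound[OF lip, of "x + \<delta> *\<^sub>R u" x] by simp
qed

lemma integrable_ball_uniform_lipschitz:
  fixes f :: "'a::euclidean_space \<Rightarrow> real"
  assumes lip: "L-lipschitz_on UNIV f"
  shows "integrable ball_uniform (\<lambda>v. f (x + \<delta> *\<^sub>R v))"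
proof -
  interpret prob_space "ball_uniform :: 'a measure" by (rule prob_space_ball_uniform)
  note [measurable] = lipschitz_measurable[OF lip]
  show ?thesis
    by (rule integrable_const_bound[where B="\<bar>f x\<bar> + L * \<bar>\<delta>\<bar>"])
      (use AE_ball_uniform lipschitz_bound_cball[OF lip] in \<open>auto elim!: eventually_mono\<close>)
qed

lemma integrable_sphere_uniform_lipschitz:
  fixes f :: "'a::euclidean_space \<Rightarrow> real"
  assumes lip: "L-lipschitz_on UNIV f"
  shows "integrable sphere_uniform (\<lambda>u. f (x + \<delta> *\<^sub>R u) *\<^sub>R u)"
proof -
  interpret prob_space "sphere_uniform :: 'a measure" by (rule prob_space_sphere_uniform)
  note [measurable] = lipschitz_measurable[OF lip]
  show ?thesis
  proof (rule integrable_const_bound[where B="\<bar>f x\<bar> + L * \<bar>\<delta>\<bar>"])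
    show "AE u in sphere_uniform. norm (f (x + \<delta> *\<^sub>R u) *\<^sub>R u) \<le> \<bar>f x\<bar> + L * \<bar>\<delta>\<bar>"
      using AE_sphere_uniform by eventually_elim (use lipschitz_bound_cball[OF lip] in simp)
  qed measurable
qed

lemma smoothing_gradient_inner:
  fixes f :: "'a::euclidean_space \<Rightarrow> real"
  assumes lip: "L-lipschitz_on UNIV f"
  shows "smoothing_gradient \<delta> f x \<bullet> h = real DIM('a) / \<delta> * (\<integral>u. f (x + \<delta> *\<^sub>R u) * (u \<bullet> h) \<partial>sphere_uniform)"
    and "integrable sphere_uniform (\<lambda>u. f (x + \<delta> *\<^sub>R u) * (u \<bullet> h))"
  using integral_inner_left[OF integrable_sphere_uniform_lipschitz[OF lip, of x \<delta>], of h]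
    integrable_inner_left[OF integrable_sphere_uniform_lipschitz[OF lip, of x \<delta>], of h]
  by (simp_all add: smoothing_gradient_def)

lemma lipschitz_scale:
  fixes f :: "'a::euclidean_space \<Rightarrow> real"
  assumes lip: "L-lipschitz_on UNIV f" and "\<delta> > 0"
  shows "(L * \<delta>)-lipschitz_on UNIV (\<lambda>y. f (\<delta> *\<^sub>R y))"
proof (rule lipschitz_onI)
  show "dist (f (\<delta> *\<^sub>R x)) (f (\<delta> *\<^sub>R y)) \<le> L * \<delta> * dist x y" for x y
    using lipschitz_onD[OF lip, of "\<delta> *\<^sub>R x" "\<delta> *\<^sub>R y"] \<open>\<delta> > 0\<close> by (simp add: dist_norm flip: scaleR_diff_right)
qed (use assms lipschitz_on_nonneg[OF lip] in simp)

text \<open>Reduction to radius 1: the function y \<mapsto> f(\<delta> y) has Lipschitz constant L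
  \<delta>, and the unit ball estimate is applied to it at x/\<delta> with increment
  h/\<delta>.\<close>

lemma ball_smoothing_quadratic:
  fixes f :: "'a::euclidean_space \<Rightarrow> real"
  assumes lip: "L-lipschitz_on UNIV f" and d: "\<delta> > 0"
  shows "\<bar>ball_smoothing \<delta> f (x + h) - ball_smoothing \<delta> f x - smoothing_gradient \<delta> f x \<bullet> h\<bar>
    \<le> real DIM('a) * L / \<delta> * (norm h)\<^sup>2"
proof -
  note [measurable] = lipschitz_measurable[OF lip]
  let ?V = "measure lborel (cball (0::'a) 1)"
  let ?J = "\<lambda>y. \<integral>v. indicator (cball 0 1) v * f (y + \<delta> *\<^sub>R v) \<partial>lborel"
  let ?H = "\<integral>v. indicator (cball 0 1) v * (f (x + \<delta> *\<^sub>R sgn v) * (sgn v \<bullet> h)) \<partial>lborel"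
  have V: "?V > 0" by (rule measure_unit_ball_pos)
  have "\<bar>?J (x + h) - ?J x - real DIM('a) * (?H / \<delta>)\<bar> \<le> real DIM('a) * ?V * (L * \<delta>) * (norm h / \<delta>)\<^sup>2"
    using integral_ball_quadratic[OF lipschitz_scale[OF lip d], of "x /\<^sub>R \<delta>" "h /\<^sub>R \<delta>"] d
    by (simp add: scaleR_add_right divide_inverse mult_ac)
  also have "\<dots> = ?V * (real DIM('a) * L / \<delta> * (norm h)\<^sup>2)"
    using d by (simp add: power2_eq_square)
  finally have *: "\<bar>?J (x + h) - ?J x - real DIM('a) * (?H / \<delta>)\<bar> \<le> ?V * (real DIM('a) * L / \<delta> * (norm h)\<^sup>2)" .
  have "ball_smoothing \<delta> f y = ?J y / ?V" for y
    by (simp add: ball_smoothing_def integral_ball_uniform divide_inverse mult.commute)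
  moreover have "smoothing_gradient \<delta> f x \<bullet> h = real DIM('a) * (?H / \<delta>) / ?V"
    by (simp add: smoothing_gradient_inner[OF lip] integral_sphere_uniform divide_inverse mult_ac)
  ultimately have "\<bar>ball_smoothing \<delta> f (x + h) - ball_smoothing \<delta> f x - smoothing_gradient \<delta> f x \<bullet> h\<bar> =
      \<bar>?J (x + h) - ?J x - real DIM('a) * (?H / \<delta>)\<bar> / ?V"
    using V by (simp only: diff_divide_distrib[symmetric] abs_divide abs_of_pos)
  also have "\<dots> \<le> real DIM('a) * L / \<delta> * (norm h)\<^sup>2"
    using * V by (simp add: pos_divide_le_eq mult.commute)
  finally show ?thesis .
qed

lemma GDERIV_quadratic:
  fixes F :: "'a::euclidean_space \<Rightarrow> real"
  assumes "\<And>h. \<bar>F (x + h) - F x - g \<bullet> h\<bar> \<le> C * (norm h)\<^sup>2"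
  shows "GDERIV F x :> g"
  unfolding gderiv_def has_derivative_at
proof
  show "bounded_linear (\<lambda>h. h \<bullet> g)" by (rule bounded_linear_inner_left)
  have "((\<lambda>h::'a. C * norm h) \<longlongrightarrow> C * norm (0::'a)) (at 0)" by (intro tendsto_intros)
  then have lim: "((\<lambda>h::'a. C * norm h) \<longlongrightarrow> 0) (at 0)" by simp
  show "(\<lambda>h. norm (F (x + h) - F x - h \<bullet> g) / norm h) \<midarrow>0\<rightarrow> 0"
  proof (rule Lim_null_comparison[OF _ lim])
    have "norm (norm (F (x + h) - F x - h \<bullet> g) / norm h) \<le> C * norm h" for h
      using assms[of h] by (cases "h = 0") (simp_all add: inner_commute pos_divide_le_eq power2_eq_square mult.assoc)
    then show "\<forall>\<^sub>F h in at 0. norm (norm (F (x + h) - F x - h \<bullet> g) / norm h) \<le> C * norm h" by simp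
  qed
qed

lemma GDERIV_unique: "GDERIV F x :> g \<Longrightarrow> GDERIV F x :> g' \<Longrightarrow> g = g'"
  unfolding gderiv_def by (drule (1) has_derivative_unique) (simp add: fun_eq_iff vector_eq_ldot)

lemma GDERIV_ball_smoothing:
  assumes "L-lipschitz_on UNIV f" "\<delta> > 0"
  shows "GDERIV (ball_smoothing \<delta> f) x :> smoothing_gradient \<delta> f x"
  by (rule GDERIV_quadratic[OF ball_smoothing_quadratic[OF assms]])

lemma gradient_ball_smoothing:
  assumes "L-lipschitz_on UNIV f" "\<delta> > 0"
  shows "gradient (ball_smoothing \<delta> f) x = smoothing_gradient \<delta> f x"
  unfolding gradient_def using GDERIV_ball_smoothing[OF assms] by (blast intro: the_equality GDERIV_unique)

text \<open>Isotropy of the sphere comes for free from the gradient formula, applied to a linear function.\<close>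

lemma sphere_uniform_second_moment:
  fixes a :: "'a::euclidean_space"
  shows "(\<integral>u. (u \<bullet> a)\<^sup>2 \<partial>sphere_uniform) = (norm a)\<^sup>2 / real DIM('a)"
    and "integrable sphere_uniform (\<lambda>u. (u \<bullet> a)\<^sup>2)"
proof -
  have lip: "(norm a)-lipschitz_on UNIV (\<lambda>y. y \<bullet> a)"
    by (rule lipschitz_onI) (auto simp: dist_norm inner_diff_left[symmetric] mult.commute[of "norm a"] Cauchy_Schwarz_ineq2)
  have "ball_smoothing 1 (\<lambda>y. y \<bullet> a) x = x \<bullet> a + ball_smoothing 1 (\<lambda>y. y \<bullet> a) 0" for x
  proof -
    interpret prob_space "ball_uniform :: 'a measure" by (rule prob_space_ball_uniform)
    show ?thesis
      using integrable_ball_uniform_lipschitz[OF lip, of 0 1] prob_space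
      by (simp add: ball_smoothing_def inner_add_left)
  qed
  then have "ball_smoothing 1 (\<lambda>y. y \<bullet> a) = (\<lambda>x. x \<bullet> a + ball_smoothing 1 (\<lambda>y. y \<bullet> a) 0)" ..
  moreover have "GDERIV (\<lambda>x. x \<bullet> a + k) 0 :> a" for k
    unfolding gderiv_def by (auto intro!: derivative_eq_intros)
  ultimately have "GDERIV (ball_smoothing 1 (\<lambda>y. y \<bullet> a)) 0 :> a" by metis
  then have "smoothing_gradient 1 (\<lambda>y. y \<bullet> a) 0 = a"
    using GDERIV_unique GDERIV_ball_smoothing[OF lip zero_less_one] by blast
  then have "real DIM('a) * (\<integral>u. (u \<bullet> a)\<^sup>2 \<partial>sphere_uniform) = (norm a)\<^sup>2"
    using smoothing_gradient_inner(1)[OF lip, of 1 0 a] by (simp add: power2_eq_square power2_norm_eq_inner[symmetric])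
  then show "(\<integral>u. (u \<bullet> a)\<^sup>2 \<partial>sphere_uniform) = (norm a)\<^sup>2 / real DIM('a)"
    by (simp add: field_simps)
  show "integrable sphere_uniform (\<lambda>u. (u \<bullet> a)\<^sup>2)"
    using smoothing_gradient_inner(2)[OF lip, of 0 1 a] by (simp add: power2_eq_square)
qed

text \<open>The first absolute moment is at most the root of the second one. This is obtained by
  integrating the elementary inequality s \<le> k s^2 / 2 + 1 / (2 k).\<close>

lemma sphere_uniform_abs_inner_le:
  fixes a :: "'a::euclidean_space"
  shows "(\<integral>u. \<bar>u \<bullet> a\<bar> \<partial>sphere_uniform) \<le> norm a / sqrt (real DIM('a))"
proof (cases "a = 0")
  case False
  interpret prob_space "sphere_uniform :: 'a measure" by (rule prob_space_sphere_uniform)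
  \<comment> \<open>The reciprocal of the root mean square of \<open>u \<bullet> a\<close>, which
    balances the two terms.\<close>
  define k where "k = sqrt (real DIM('a)) / norm a"
  have k: "k > 0" using False by (simp add: k_def)
  have "(\<integral>u. \<bar>u \<bullet> a\<bar> \<partial>sphere_uniform) \<le> (\<integral>u. k / 2 * (u \<bullet> a)\<^sup>2 + 1 / (2 * k) \<partial>sphere_uniform)"
  proof (rule integral_mono')
    show "integrable sphere_uniform (\<lambda>u. k / 2 * (u \<bullet> a)\<^sup>2 + 1 / (2 * k))"
      using sphere_uniform_second_moment(2)[of a] by simp
    show "\<bar>u \<bullet> a\<bar> \<le> k / 2 * (u \<bullet> a)\<^sup>2 + 1 / (2 * k)" for u
    proof -
      have "0 \<le> (k * \<bar>u \<bullet> a\<bar> - 1)\<^sup>2" by simp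
      then have "2 * k * \<bar>u \<bullet> a\<bar> \<le> k\<^sup>2 * (u \<bullet> a)\<^sup>2 + 1" by (simp add: power2_diff power_mult_distrib)
      then show ?thesis using k by (simp add: field_simps power2_eq_square)
    qed
    show "0 \<le> k / 2 * (u \<bullet> a)\<^sup>2 + 1 / (2 * k)" for u using k by simp
  qed
  also have "\<dots> = k / 2 * ((norm a)\<^sup>2 / real DIM('a)) + 1 / (2 * k)"
    using sphere_uniform_second_moment[of a] prob_space by simp
  also have "\<dots> = norm a / sqrt (real DIM('a))"
    using False by (simp add: k_def power2_eq_square field_simps)
  finally show ?thesis .
qed simp

text \<open>The difference \<open>D\<close> of the gradients is tested against itself. After the
  Lipschitz bound for \<open>f\<close>, what remains is the mean of
  \<open>\<bar>u \<bullet> D\<bar>\<close>, which is smaller than \<open>norm D\<close> by the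
  factor sqrt d; this turns the prefactor d of the gradient formula into sqrt d.\<close>

lemma smoothing_gradient_lipschitz:
  fixes f :: "'a::euclidean_space \<Rightarrow> real"
  assumes lip: "L-lipschitz_on UNIV f" and d: "\<delta> > 0"
  shows "norm (smoothing_gradient \<delta> f x - smoothing_gradient \<delta> f y) \<le> L * sqrt (real DIM('a)) / \<delta> * norm (x - y)"
proof -
  interpret prob_space "sphere_uniform :: 'a measure" by (rule prob_space_sphere_uniform)
  have L0: "L \<ge> 0" using lip by (rule lipschitz_on_nonneg)
  define D where "D = smoothing_gradient \<delta> f x - smoothing_gradient \<delta> f y"
  let ?I = "\<integral>u. (f (x + \<delta> *\<^sub>R u) - f (y + \<delta> *\<^sub>R u)) * (u \<bullet> D) \<partial>sphere_uniform"
  note int = smoothing_gradient_inner(2)[OF lip, of _ \<delta> D]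
  have intd: "integrable sphere_uniform (\<lambda>u. (f (x + \<delta> *\<^sub>R u) - f (y + \<delta> *\<^sub>R u)) * (u \<bullet> D))"
    using Bochner_Integration.integrable_diff[OF int[of x] int[of y]] by (simp only: left_diff_distrib)
  have inta: "integrable sphere_uniform (\<lambda>u. u \<bullet> D)"
    by (rule square_integrable_imp_integrable[OF _ sphere_uniform_second_moment(2)]) simp
  have "(norm D)\<^sup>2 = D \<bullet> D" by (rule power2_norm_eq_inner)
  also have "\<dots> = smoothing_gradient \<delta> f x \<bullet> D - smoothing_gradient \<delta> f y \<bullet> D"
    by (subst (1) D_def) (rule inner_diff_left)
  also have "\<dots> = real DIM('a) / \<delta> * ?I"
    using Bochner_Integration.integral_diff[OF int[of x] int[of y]]
    by (simp only: smoothing_gradient_inner(1)[OF lip] left_diff_distrib right_diff_distrib)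
  also have "?I \<le> (\<integral>u. L * norm (x - y) * \<bar>u \<bullet> D\<bar> \<partial>sphere_uniform)"
  proof (rule integral_mono[OF intd])
    show "integrable sphere_uniform (\<lambda>u. L * norm (x - y) * \<bar>u \<bullet> D\<bar>)" using inta by simp
    fix u :: 'a
    have "\<bar>f (x + \<delta> *\<^sub>R u) - f (y + \<delta> *\<^sub>R u)\<bar> * \<bar>u \<bullet> D\<bar> \<le> L * norm (x - y) * \<bar>u \<bullet> D\<bar>"
      using lipschitz_bound[OF lip, of "x + \<delta> *\<^sub>R u" "y + \<delta> *\<^sub>R u"] by (intro mult_right_mono) auto
    then show "(f (x + \<delta> *\<^sub>R u) - f (y + \<delta> *\<^sub>R u)) * (u \<bullet> D) \<le> L * norm (x - y) * \<bar>u \<bullet> D\<bar>"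
      by (metis abs_ge_self abs_mult order_trans)
  qed
  also have "\<dots> = L * norm (x - y) * (\<integral>u. \<bar>u \<bullet> D\<bar> \<partial>sphere_uniform)" by simp
  also have "\<dots> \<le> L * norm (x - y) * (norm D / sqrt (real DIM('a)))"
    using L0 by (intro mult_left_mono sphere_uniform_abs_inner_le) auto
  finally have "(norm D)\<^sup>2 \<le> real DIM('a) / \<delta> * (L * norm (x - y) * (norm D / sqrt (real DIM('a))))"
    using d by (simp add: mult_left_mono divide_right_mono)
  also have "\<dots> = norm D * ((real DIM('a) / sqrt (real DIM('a))) * L / \<delta> * norm (x - y))"
    by (simp add: mult_ac)
  also have "real DIM('a) / sqrt (real DIM('a)) = sqrt (real DIM('a))"
    by (simp add: real_div_sqrt)
  finally have "norm D * norm D \<le> norm D * (L * sqrt (real DIM('a)) / \<delta> * norm (x - y))"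
    by (simp add: power2_eq_square mult.commute)
  then have "norm D \<le> L * sqrt (real DIM('a)) / \<delta> * norm (x - y)"
    using L0 d mult_left_le_imp_le[of "norm D" "norm D" "L * sqrt (real DIM('a)) / \<delta> * norm (x - y)"]
    by (cases "D = 0") auto
  then show ?thesis unfolding D_def .
qed

text \<open>The central difference form of the gradient, since \<open>u\<close> and
  \<open>- u\<close> have the same law. It is the form in which the algorithm samples the
  gradient.\<close>

lemma smoothing_gradient_symmetric:
  fixes f :: "'a::euclidean_space \<Rightarrow> real"
  assumes lip: "L-lipschitz_on UNIV f" and d: "\<delta> > 0"
  shows "(\<integral>u. (u \<bullet> h) * (f (x + \<delta> *\<^sub>R u) - f (x - \<delta> *\<^sub>R u)) \<partial>sphere_uniform) =
    2 * \<delta> / real DIM('a) * (smoothing_gradient \<delta> f x \<bullet> h)"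
    and "integrable sphere_uniform (\<lambda>u. (u \<bullet> h) * (f (x + \<delta> *\<^sub>R u) - f (x - \<delta> *\<^sub>R u)))"
proof -
  note [measurable] = lipschitz_measurable[OF lip]
  have i1: "integrable sphere_uniform (\<lambda>u. f (x + \<delta> *\<^sub>R u) * (u \<bullet> h))"
    and i2: "integrable sphere_uniform (\<lambda>u. f (x - \<delta> *\<^sub>R u) * (u \<bullet> h))"
    using smoothing_gradient_inner(2)[OF lip, of x \<delta> h] smoothing_gradient_inner(2)[OF lip, of x "- \<delta>" h]
    by simp_all
  have eq: "(u \<bullet> h) * (f (x + \<delta> *\<^sub>R u) - f (x - \<delta> *\<^sub>R u)) = f (x + \<delta> *\<^sub>R u) * (u \<bullet> h) - f (x - \<delta> *\<^sub>R u) * (u \<bullet> h)" for u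
    by (simp add: algebra_simps)
  show "integrable sphere_uniform (\<lambda>u. (u \<bullet> h) * (f (x + \<delta> *\<^sub>R u) - f (x - \<delta> *\<^sub>R u)))"
    unfolding eq using i1 i2 by simp
  have "(\<integral>u. f (x - \<delta> *\<^sub>R u) * (u \<bullet> h) \<partial>sphere_uniform) = - (\<integral>u. f (x + \<delta> *\<^sub>R u) * (u \<bullet> h) \<partial>sphere_uniform)"
    using integral_sphere_uniform_uminus[of "\<lambda>u. f (x + \<delta> *\<^sub>R u) * (u \<bullet> h)"] by simp
  then show "(\<integral>u. (u \<bullet> h) * (f (x + \<delta> *\<^sub>R u) - f (x - \<delta> *\<^sub>R u)) \<partial>sphere_uniform) =
    2 * \<delta> / real DIM('a) * (smoothing_gradient \<delta> f x \<bullet> h)"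
    unfolding eq using i1 i2 d by (simp add: smoothing_gradient_inner(1)[OF lip])
qed

text \<open>A crude bound that serves integrability: it makes the test functions of the stochastic
  part bounded.\<close>

lemma smoothing_gradient_norm_le:
  fixes f :: "'a::euclidean_space \<Rightarrow> real"
  assumes lip: "L-lipschitz_on UNIV f" and d: "\<delta> > 0"
  shows "norm (smoothing_gradient \<delta> f x) \<le> real DIM('a) * L"
proof -
  interpret prob_space "sphere_uniform :: 'a measure" by (rule prob_space_sphere_uniform)
  have L0: "L \<ge> 0" using lip by (rule lipschitz_on_nonneg)
  let ?g = "smoothing_gradient \<delta> f x"
  have "2 * \<delta> / real DIM('a) * (?g \<bullet> ?g) =
      (\<integral>u. (u \<bullet> ?g) * (f (x + \<delta> *\<^sub>R u) - f (x - \<delta> *\<^sub>R u)) \<partial>sphere_uniform)"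
    by (rule smoothing_gradient_symmetric(1)[OF lip d, symmetric])
  also have "\<dots> \<le> (\<integral>u. norm ?g * (L * (2 * \<delta>)) \<partial>(sphere_uniform :: 'a measure))"
  proof (rule integral_mono_AE[OF smoothing_gradient_symmetric(2)[OF lip d]])
    show "AE u in sphere_uniform. (u \<bullet> ?g) * (f (x + \<delta> *\<^sub>R u) - f (x - \<delta> *\<^sub>R u)) \<le> norm ?g * (L * (2 * \<delta>))"
      using AE_sphere_uniform
    proof eventually_elim
      case (elim u)
      have "norm (x + \<delta> *\<^sub>R u - (x - \<delta> *\<^sub>R u)) = norm ((2 * \<delta>) *\<^sub>R u)"
        by (simp only: scaleR_2 flip: scaleR_scaleR) (simp add: algebra_simps)
      then have "\<bar>f (x + \<delta> *\<^sub>R u) - f (x - \<delta> *\<^sub>R u)\<bar> \<le> L * (2 * \<delta>)"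
        using lipschitz_bound[OF lip, of "x + \<delta> *\<^sub>R u" "x - \<delta> *\<^sub>R u"] elim d by simp
      moreover have "\<bar>u \<bullet> ?g\<bar> \<le> norm ?g" using Cauchy_Schwarz_ineq2[of u ?g] elim by simp
      ultimately have "\<bar>u \<bullet> ?g\<bar> * \<bar>f (x + \<delta> *\<^sub>R u) - f (x - \<delta> *\<^sub>R u)\<bar> \<le> norm ?g * (L * (2 * \<delta>))"
        by (intro mult_mono) auto
      then show ?case by (metis abs_ge_self abs_mult order_trans)
    qed
  qed simp
  also have "\<dots> = norm ?g * (L * (2 * \<delta>))" using prob_space by simp
  finally have "norm ?g * norm ?g \<le> norm ?g * (real DIM('a) * L)"
    using d by (simp add: field_simps power2_norm_eq_inner[symmetric] power2_eq_square)
  then show ?thesis using L0 by (cases "?g = 0") auto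
qed

text \<open>Twice the sharp constant, which the slack in part (1) of the theorem absorbs.\<close>

lemma ball_smoothing_smooth:
  fixes f :: "'a::euclidean_space \<Rightarrow> real"
  assumes lip: "L-lipschitz_on UNIV f" and d: "\<delta> > 0"
  shows "\<bar>ball_smoothing \<delta> f (x + h) - ball_smoothing \<delta> f x - smoothing_gradient \<delta> f x \<bullet> h\<bar>
    \<le> L * sqrt (real DIM('a)) / \<delta> * (norm h)\<^sup>2"
proof -
  let ?g = "smoothing_gradient \<delta> f"
  let ?S = "closed_segment x (x + h)"
  have L0: "L \<ge> 0" using lip by (rule lipschitz_on_nonneg)
  \<comment> \<open>The variation of the gradient is replaced by its maximal bound over the segment
    instead of being integrated; this is where the factor 1/2 is lost.\<close>
  have "norm (ball_smoothing \<delta> f (x + h) - ball_smoothing \<delta> f x - (\<lambda>k. k \<bullet> ?g x) (x + h - x))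
    \<le> norm (x + h - x) * (L * sqrt (real DIM('a)) / \<delta> * norm h)"
  proof (rule differentiable_bound_linearization[where S="?S" and f'="\<lambda>y k. k \<bullet> ?g y"])
    show "x + t *\<^sub>R (x + h - x) \<in> ?S" if "t \<in> {0..1}" for t
      using that by (auto simp: in_segment algebra_simps intro!: exI[of _ t])
    show "(ball_smoothing \<delta> f has_derivative (\<lambda>k. k \<bullet> ?g y)) (at y within ?S)" for y
      using GDERIV_ball_smoothing[OF lip d, of y] unfolding gderiv_def by (rule has_derivative_at_withinI)
    fix y assume "y \<in> ?S"
    then have y: "norm (y - x) \<le> norm h" using segment_bound1[of y x "x + h"] by simp
    have "onorm ((\<lambda>k. k \<bullet> ?g y) - (\<lambda>k. k \<bullet> ?g x)) \<le> norm (?g y - ?g x)"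
      by (rule onorm_bound) (simp_all add: inner_diff_right[symmetric] Cauchy_Schwarz_ineq2 mult.commute[of "norm (?g y - ?g x)"])
    also have "\<dots> \<le> L * sqrt (real DIM('a)) / \<delta> * norm (y - x)"
      by (rule smoothing_gradient_lipschitz[OF lip d])
    also have "\<dots> \<le> L * sqrt (real DIM('a)) / \<delta> * norm h"
      using y L0 d by (intro mult_left_mono) auto
    finally show "onorm ((\<lambda>k. k \<bullet> ?g y) - (\<lambda>k. k \<bullet> ?g x)) \<le> L * sqrt (real DIM('a)) / \<delta> * norm h" .
  qed simp
  then show ?thesis by (simp add: inner_commute power2_eq_square mult_ac)
qed

lemma ball_smoothing_lipschitz:
  fixes f :: "'a::euclidean_space \<Rightarrow> real"
  assumes lip: "L-lipschitz_on UNIV f"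
  shows "L-lipschitz_on UNIV (ball_smoothing \<delta> f)"
proof (rule lipschitz_onI)
  interpret prob_space "ball_uniform :: 'a measure" by (rule prob_space_ball_uniform)
  note int = integrable_ball_uniform_lipschitz[OF lip]
  fix x y :: 'a
  have "\<bar>ball_smoothing \<delta> f x - ball_smoothing \<delta> f y\<bar> = norm (\<integral>v. f (x + \<delta> *\<^sub>R v) - f (y + \<delta> *\<^sub>R v) \<partial>ball_uniform)"
    using int by (simp add: ball_smoothing_def)
  also have "\<dots> \<le> (\<integral>v. L * norm (x - y) \<partial>(ball_uniform :: 'a measure))"
    using int lipschitz_bound[OF lip, of "x + \<delta> *\<^sub>R v" "y + \<delta> *\<^sub>R v" for v]
    by (intro Bochner_Integration.integral_norm_bound_integral) auto
  finally show "dist (ball_smoothing \<delta> f x) (ball_smoothing \<delta> f y) \<le> L * dist x y"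
    using prob_space by (simp add: dist_norm)
qed (rule lipschitz_on_nonneg[OF lip])

lemma ball_smoothing_bdd_below:
  fixes f :: "'a::euclidean_space \<Rightarrow> real"
  assumes lip: "L-lipschitz_on UNIV f" and "bdd_below (range f)"
  shows "bdd_below (range (ball_smoothing \<delta> f))"
proof -
  interpret prob_space "ball_uniform :: 'a measure" by (rule prob_space_ball_uniform)
  obtain b where b: "\<And>y. b \<le> f y" using assms(2) by (auto simp: bdd_below_def)
  have "b \<le> ball_smoothing \<delta> f x" for x
    using integral_mono[OF _ integrable_ball_uniform_lipschitz[OF lip, of x \<delta>], of "\<lambda>_. b"] b prob_space
    by (simp add: ball_smoothing_def)
  then show ?thesis by (auto intro: bdd_belowI[of _ b])
qed

section \<open>Clarke and Goldstein subdifferentials\<close>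

lemma eventually_clarke_filter:
  fixes x :: "'a::euclidean_space"
  shows "eventually P (nhds x \<times>\<^sub>F at_right (0::real)) \<longleftrightarrow>
    (\<exists>r>0. \<forall>y s. norm (y - x) < r \<and> 0 < s \<and> s < r \<longrightarrow> P (y, s))"
proof
  assume "eventually P (nhds x \<times>\<^sub>F at_right (0::real))"
  then obtain Q R where Q: "eventually Q (nhds x)" and R: "eventually R (at_right (0::real))"
    and QR: "\<And>y s. Q y \<Longrightarrow> R s \<Longrightarrow> P (y, s)"
    unfolding eventually_prod_filter by blast
  obtain a where a: "a > 0" "\<And>y. dist y x < a \<Longrightarrow> Q y" using Q unfolding eventually_nhds_metric by blast
  obtain b where b: "b > 0" "\<And>s. 0 < s \<Longrightarrow> s < b \<Longrightarrow> R s"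
    using R unfolding eventually_at_right[OF zero_less_one] by blast
  show "\<exists>r>0. \<forall>y s. norm (y - x) < r \<and> 0 < s \<and> s < r \<longrightarrow> P (y, s)"
    using a b QR by (intro exI[of _ "min a b"]) (auto simp: dist_norm)
next
  assume "\<exists>r>0. \<forall>y s. norm (y - x) < r \<and> 0 < s \<and> s < r \<longrightarrow> P (y, s)"
  then obtain r where r: "r > 0" "\<And>y s. norm (y - x) < r \<Longrightarrow> 0 < s \<Longrightarrow> s < r \<Longrightarrow> P (y, s)" by blast
  have "eventually (\<lambda>y. norm (y - x) < r) (nhds x)"
    unfolding eventually_nhds_metric using r(1) by (auto simp: dist_norm)
  moreover have "eventually (\<lambda>s. 0 < s \<and> s < r) (at_right 0)"
    unfolding eventually_at_right[OF zero_less_one] using r(1) by auto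
  ultimately show "eventually P (nhds x \<times>\<^sub>F at_right (0::real))"
    unfolding eventually_prod_filter using r(2) by blast
qed

lemma clarke_derivative_lessD:
  assumes "clarke_derivative f x h < ereal b"
  obtains r where "r > 0" "\<And>y s. norm (y - x) < r \<Longrightarrow> 0 < s \<Longrightarrow> s < r \<Longrightarrow> f (y + s *\<^sub>R h) - f y < s * b"
proof -
  from Limsup_lessD[OF assms[unfolded clarke_derivative_def]]
  obtain r where r: "r > 0" "\<And>y s. norm (y - x) < r \<Longrightarrow> 0 < s \<Longrightarrow> s < r \<Longrightarrow> (f (y + s *\<^sub>R h) - f y) / s < b"
    unfolding eventually_clarke_filter by auto
  show thesis
    by (rule that[OF r(1)]) (use r(2) in \<open>simp add: pos_divide_less_eq mult.commute\<close>)
qed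

lemma clarke_derivative_leI:
  assumes "r > 0" "\<And>y s. norm (y - x) < r \<Longrightarrow> 0 < s \<Longrightarrow> s < r \<Longrightarrow> f (y + s *\<^sub>R h) - f y \<le> s * b"
  shows "clarke_derivative f x h \<le> ereal b"
  unfolding clarke_derivative_def
proof (rule Limsup_bounded)
  show "\<forall>\<^sub>F z in nhds x \<times>\<^sub>F at_right 0. (case z of (y, s) \<Rightarrow> ereal ((f (y + s *\<^sub>R h) - f y) / s)) \<le> ereal b"
    unfolding eventually_clarke_filter using assms by (auto simp: pos_divide_le_eq mult.commute intro!: exI[of _ r])
qed

lemma clarke_derivative_le:
  fixes f :: "'a::euclidean_space \<Rightarrow> real"
  assumes lip: "L-lipschitz_on UNIV f"
  shows "clarke_derivative f x h \<le> ereal (L * norm h)"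
proof (rule clarke_derivative_leI[of 1])
  show "f (y + s *\<^sub>R h) - f y \<le> s * (L * norm h)" if "0 < s" for y s
    using lipschitz_bound[OF lip, of "y + s *\<^sub>R h" y] that by (simp add: mult_ac)
qed simp

lemma clarke_derivative_ge:
  fixes f :: "'a::euclidean_space \<Rightarrow> real"
  assumes lip: "L-lipschitz_on UNIV f"
  shows "ereal (- (L * norm h)) \<le> clarke_derivative f x h"
proof (rule ccontr)
  assume "\<not> ereal (- (L * norm h)) \<le> clarke_derivative f x h"
  then have "clarke_derivative f x h < ereal (- (L * norm h))" by simp
  then obtain r where r: "r > 0" "\<And>y s. norm (y - x) < r \<Longrightarrow> 0 < s \<Longrightarrow> s < r \<Longrightarrow> f (y + s *\<^sub>R h) - f y < s * (- (L * norm h))"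
    by (rule clarke_derivative_lessD) blast
  have "f (x + (r / 2) *\<^sub>R h) - f x < (r / 2) * (- (L * norm h))"
    using r(1) by (intro r(2)) auto
  moreover have "- (f (x + (r / 2) *\<^sub>R h) - f x) \<le> L * ((r / 2) * norm h)"
    using lipschitz_bound[OF lip, of "x + (r / 2) *\<^sub>R h" x] r(1)
    by (intro order_trans[OF abs_ge_minus_self]) simp
  ultimately show False by (simp add: mult_ac)
qed

text \<open>For Lipschitz functions the Clarke derivative lies between \<open>- (L * norm h)\<close>
  and \<open>L * norm h\<close>, so nothing is lost in passing to a real value, with which ordinary
  arithmetic is possible.\<close>

definition clarke_real :: "('a::euclidean_space \<Rightarrow> real) \<Rightarrow> 'a \<Rightarrow> 'a \<Rightarrow> real" where
  "clarke_real f x h = real_of_ereal (clarke_derivative f x h)"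

lemma ereal_clarke_real:
  fixes f :: "'a::euclidean_space \<Rightarrow> real"
  assumes lip: "L-lipschitz_on UNIV f"
  shows "ereal (clarke_real f x h) = clarke_derivative f x h"
  unfolding clarke_real_def using clarke_derivative_le[OF lip, of x h] clarke_derivative_ge[OF lip, of h x]
  by (cases "clarke_derivative f x h") auto

lemma clarke_real_lessD:
  fixes f :: "'a::euclidean_space \<Rightarrow> real"
  assumes lip: "L-lipschitz_on UNIV f" and "clarke_real f x h < b"
  obtains r where "r > 0" "\<And>y s. norm (y - x) < r \<Longrightarrow> 0 < s \<Longrightarrow> s < r \<Longrightarrow> f (y + s *\<^sub>R h) - f y < s * b"
proof -
  have "clarke_derivative f x h < ereal b"
    using assms(2) by (simp add: ereal_clarke_real[OF lip, symmetric])
  then show thesis by (rule clarke_derivative_lessD) (rule that)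
qed

lemma clarke_real_leI:
  fixes f :: "'a::euclidean_space \<Rightarrow> real"
  assumes lip: "L-lipschitz_on UNIV f"
    and "r > 0" "\<And>y s. norm (y - x) < r \<Longrightarrow> 0 < s \<Longrightarrow> s < r \<Longrightarrow> f (y + s *\<^sub>R h) - f y \<le> s * b"
  shows "clarke_real f x h \<le> b"
proof -
  have "clarke_derivative f x h \<le> ereal b"
    by (rule clarke_derivative_leI) (fact assms)+
  then show ?thesis by (simp add: ereal_clarke_real[OF lip, symmetric])
qed

lemma clarke_subdifferential_iff:
  fixes f :: "'a::euclidean_space \<Rightarrow> real"
  assumes lip: "L-lipschitz_on UNIV f"
  shows "\<xi> \<in> clarke_subdifferential f x \<longleftrightarrow> (\<forall>h. \<xi> \<bullet> h \<le> clarke_real f x h)"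
  unfolding clarke_subdifferential_def by (simp add: ereal_clarke_real[OF lip, symmetric])

lemma clarke_real_le:
  fixes f :: "'a::euclidean_space \<Rightarrow> real"
  assumes lip: "L-lipschitz_on UNIV f"
  shows "clarke_real f x h \<le> L * norm h"
  using clarke_derivative_le[OF lip, of x h] by (simp add: ereal_clarke_real[OF lip, symmetric])

text \<open>A step along \<open>h + k\<close> is a step along \<open>k\<close> followed by a step
  along \<open>h\<close>. The second one starts at a displaced point, which is harmless because the
  Clarke derivative takes the upper limit over nearby base points as well.\<close>

lemma clarke_real_add:
  fixes f :: "'a::euclidean_space \<Rightarrow> real"
  assumes lip: "L-lipschitz_on UNIV f"
  shows "clarke_real f x (h + k) \<le> clarke_real f x h + clarke_real f x k"
proof (rule field_le_epsilon)
  fix e :: real assume e: "e > 0"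
  obtain r where r: "r > 0" "\<And>y s. norm (y - x) < r \<Longrightarrow> 0 < s \<Longrightarrow> s < r \<Longrightarrow>
      f (y + s *\<^sub>R h) - f y < s * (clarke_real f x h + e / 2)"
    using clarke_real_lessD[OF lip, of x h "clarke_real f x h + e / 2"] e by auto
  obtain r' where r': "r' > 0" "\<And>y s. norm (y - x) < r' \<Longrightarrow> 0 < s \<Longrightarrow> s < r' \<Longrightarrow>
      f (y + s *\<^sub>R k) - f y < s * (clarke_real f x k + e / 2)"
    using clarke_real_lessD[OF lip, of x k "clarke_real f x k + e / 2"] e by auto
  \<comment> \<open>With this choice \<open>y + s *\<^sub>R k\<close> stays within \<open>r\<close>
    of \<open>x\<close>, for its distance is at most \<open>q * (1 + norm k)\<close>, which is at
    most \<open>r / 2\<close>.\<close>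
  define q where "q = min r' (r / (2 * (1 + norm k)))"
  have nk: "1 + norm k > 0" using norm_ge_zero[of k] by linarith
  have q: "q > 0" "q \<le> r'" using r(1) r'(1) nk by (auto simp: q_def)
  have qr: "q * (2 * (1 + norm k)) \<le> r"
  proof -
    have "q \<le> r / (2 * (1 + norm k))" by (simp add: q_def)
    then show ?thesis using nk by (subst (asm) pos_le_divide_eq) auto
  qed
  show "clarke_real f x (h + k) \<le> clarke_real f x h + clarke_real f x k + e"
  proof (rule clarke_real_leI[OF lip q(1)])
    fix y s assume y: "norm (y - x) < q" and s: "0 < s" "s < q"
    have "norm (y + s *\<^sub>R k - x) \<le> norm (y - x) + norm (s *\<^sub>R k)"
      using norm_triangle_ineq[of "y - x" "s *\<^sub>R k"] by (simp add: algebra_simps)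
    also have "\<dots> \<le> q + q * norm k" using y s by (intro add_mono) (auto intro: mult_right_mono)
    also have "\<dots> < q * (2 * (1 + norm k))"
    proof -
      have "q * (2 * (1 + norm k)) = 2 * q + 2 * (q * norm k)" by (simp add: algebra_simps)
      moreover have "0 \<le> q * norm k" using q(1) by simp
      ultimately show ?thesis using q(1) by linarith
    qed
    finally have 1: "norm (y + s *\<^sub>R k - x) < r" using qr by linarith
    have "q * 1 \<le> q * (2 * (1 + norm k))" using q(1) norm_ge_zero[of k] by (intro mult_left_mono) auto
    then have "s < r" using s qr by linarith
    then have "f (y + s *\<^sub>R k + s *\<^sub>R h) - f (y + s *\<^sub>R k) < s * (clarke_real f x h + e / 2)"
      using r(2) 1 s by blast
    moreover have "f (y + s *\<^sub>R k) - f y < s * (clarke_real f x k + e / 2)"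
      using r'(2)[of y s] y s q by auto
    ultimately show "f (y + s *\<^sub>R (h + k)) - f y \<le> s * (clarke_real f x h + clarke_real f x k + e)"
      by (simp add: algebra_simps)
  qed
qed

text \<open>A step of length \<open>s\<close> along \<open>t *\<^sub>R h\<close> is a step of length
  \<open>s * t\<close> along \<open>h\<close>. The reverse inequality is the same one for
  \<open>inverse t\<close>.\<close>

lemma clarke_real_scale_le:
  fixes f :: "'a::euclidean_space \<Rightarrow> real"
  assumes lip: "L-lipschitz_on UNIV f" and t: "t > 0"
  shows "clarke_real f x (t *\<^sub>R h) \<le> t * clarke_real f x h"
proof (rule field_le_epsilon)
  fix e :: real assume e: "e > 0"
  obtain r where r: "r > 0" "\<And>y s. norm (y - x) < r \<Longrightarrow> 0 < s \<Longrightarrow> s < r \<Longrightarrow>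
      f (y + s *\<^sub>R h) - f y < s * (clarke_real f x h + e / t)"
    using clarke_real_lessD[OF lip, of x h "clarke_real f x h + e / t"] e t by auto
  show "clarke_real f x (t *\<^sub>R h) \<le> t * clarke_real f x h + e"
  proof (rule clarke_real_leI[OF lip])
    show "min r (r / t) > 0" using r t by simp
    fix y s assume y: "norm (y - x) < min r (r / t)" and s: "0 < s" "s < min r (r / t)"
    then have "0 < s * t" "s * t < r" using t by (auto simp: pos_less_divide_eq)
    then have "f (y + (s * t) *\<^sub>R h) - f y < (s * t) * (clarke_real f x h + e / t)"
      using r(2)[of y "s * t"] y by simp
    then show "f (y + s *\<^sub>R t *\<^sub>R h) - f y \<le> s * (t * clarke_real f x h + e)"
      using t by (simp add: algebra_simps)
  qed
qed

lemma clarke_real_0: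
  fixes f :: "'a::euclidean_space \<Rightarrow> real"
  assumes lip: "L-lipschitz_on UNIV f"
  shows "clarke_real f x 0 = 0"
  using clarke_derivative_le[OF lip, of x 0] clarke_derivative_ge[OF lip, of 0 x]
  by (simp add: ereal_clarke_real[OF lip, symmetric])

lemma clarke_real_scale:
  fixes f :: "'a::euclidean_space \<Rightarrow> real"
  assumes lip: "L-lipschitz_on UNIV f" and t: "t > 0"
  shows "clarke_real f x (t *\<^sub>R h) = t * clarke_real f x h"
proof (rule antisym[OF clarke_real_scale_le[OF assms]])
  show "t * clarke_real f x h \<le> clarke_real f x (t *\<^sub>R h)"
    using clarke_real_scale_le[OF lip, of "inverse t" x "t *\<^sub>R h"] t by (simp add: field_simps)
qed

text \<open>The Hahn-Banach theorem in finite dimension, by separating a point of the graph from the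
  strict epigraph.\<close>

lemma sublinear_support:
  fixes p :: "'a::euclidean_space \<Rightarrow> real"
  assumes add: "\<And>h k. p (h + k) \<le> p h + p k" and scale: "\<And>t h. t > 0 \<Longrightarrow> p (t *\<^sub>R h) = t * p h"
    and zero: "p 0 = 0"
  obtains \<xi> where "\<And>h. \<xi> \<bullet> h \<le> p h" "\<xi> \<bullet> h0 = p h0"
proof -
  define S where "S = {(h, r). p h < r}"
  have "convex S"
  proof (rule convexI)
    fix a b :: "'a \<times> real" and u v :: real
    assume ab: "a \<in> S" "b \<in> S" and uv: "0 \<le> u" "0 \<le> v" "u + v = 1"
    have sc: "p (t *\<^sub>R h) = t * p h" if "t \<ge> 0" for t h
      using scale[of t h] zero that by (cases "t = 0") auto
    have "p (u *\<^sub>R fst a + v *\<^sub>R fst b) \<le> u * p (fst a) + v * p (fst b)"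
      using add[of "u *\<^sub>R fst a" "v *\<^sub>R fst b"] sc uv by simp
    also have "\<dots> < u * snd a + v * snd b"
    proof (cases "u = 0")
      case False
      then have "u * p (fst a) < u * snd a" using ab(1) uv by (auto simp: S_def)
      moreover have "v * p (fst b) \<le> v * snd b" using ab(2) uv by (auto simp: S_def intro: mult_left_mono)
      ultimately show ?thesis by simp
    qed (use ab uv in \<open>auto simp: S_def\<close>)
    finally show "u *\<^sub>R a + v *\<^sub>R b \<in> S" by (simp add: S_def split_beta)
  qed
  moreover have "S \<inter> {(h0, p h0)} = {}" "S \<noteq> {}" by (auto simp: S_def intro!: exI[of _ 0] exI[of _ "p 0 + 1"])
  ultimately have "\<exists>a b. a \<noteq> 0 \<and> (\<forall>z\<in>S. a \<bullet> z \<le> b) \<and> (\<forall>z\<in>{(h0, p h0)}. a \<bullet> z \<ge> b)"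
    by (intro separating_hyperplane_sets) simp_all
  then obtain a b where ab: "a \<noteq> 0" "\<And>z. z \<in> S \<Longrightarrow> a \<bullet> z \<le> b" "a \<bullet> (h0, p h0) \<ge> b"
    by blast
  obtain \<alpha> \<beta> where a: "a = (\<alpha>, \<beta>)" by fastforce
  have sep: "\<alpha> \<bullet> h + \<beta> * r \<le> \<alpha> \<bullet> h0 + \<beta> * p h0" if "p h < r" for h r
    using ab(2)[of "(h, r)"] ab(3) that by (auto simp: a S_def inner_Pair)
  have "\<beta> \<le> 0"
  proof (rule ccontr)
    assume b: "\<not> \<beta> \<le> 0"
    let ?r = "\<bar>p h0\<bar> + 1"
    have "\<beta> * (\<bar>p h0\<bar> + 1) \<le> \<beta> * p h0" using sep[of h0 ?r] by simp
    then show False using b by (simp add: mult_le_cancel_left)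
  qed
  \<comment> \<open>The hyperplane is not vertical because the epigraph has points above every
    \<open>h\<close>, in particular above \<open>h0 + \<alpha>\<close>.\<close>
  moreover have "\<beta> \<noteq> 0"
  proof
    assume b: "\<beta> = 0"
    have "\<alpha> \<bullet> (h0 + \<alpha>) \<le> \<alpha> \<bullet> h0" using sep[of "h0 + \<alpha>" "p (h0 + \<alpha>) + 1"] b by simp
    then have "\<alpha> \<bullet> \<alpha> \<le> 0" by (simp add: inner_add_right)
    then have "\<alpha> = 0" by (metis inner_gt_zero_iff not_less)
    then show False using ab(1) a b by (simp add: zero_prod_def)
  qed
  ultimately have b: "\<beta> < 0" by simp
  define \<xi> where "\<xi> = \<alpha> /\<^sub>R (- \<beta>)"
  have \<alpha>: "\<alpha> = (- \<beta>) *\<^sub>R \<xi>" using b by (simp add: \<xi>_def)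
  have sup: "\<xi> \<bullet> h - p h \<le> \<xi> \<bullet> h0 - p h0" for h
  proof (rule field_le_epsilon)
    fix e :: real assume "e > 0"
    then have "(- \<beta>) * (\<xi> \<bullet> h - (p h + e)) \<le> (- \<beta>) * (\<xi> \<bullet> h0 - p h0)"
      using sep[of h "p h + e"] by (simp add: \<alpha> algebra_simps)
    then show "\<xi> \<bullet> h - p h \<le> \<xi> \<bullet> h0 - p h0 + e" using b by (simp add: mult_le_cancel_left)
  qed
  have le: "\<xi> \<bullet> h \<le> p h" for h
  proof (rule ccontr)
    assume "\<not> \<xi> \<bullet> h \<le> p h"
    then have pos: "\<xi> \<bullet> h - p h > 0" by simp
    \<comment> \<open>By homogeneity a violation \<open>\<xi> \<bullet> h > p h\<close> can be
      scaled up; this \<open>t\<close> makes it exceed the bound given by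
      \<open>sup\<close>.\<close>
    define t where "t = (\<bar>\<xi> \<bullet> h0 - p h0\<bar> + 1) / (\<xi> \<bullet> h - p h)"
    have t: "t > 0" using pos by (simp add: t_def)
    have "t * (\<xi> \<bullet> h - p h) \<le> \<xi> \<bullet> h0 - p h0"
      using sup[of "t *\<^sub>R h"] scale[OF t, of h] by (simp add: algebra_simps)
    moreover have "t * (\<xi> \<bullet> h - p h) = \<bar>\<xi> \<bullet> h0 - p h0\<bar> + 1" using pos by (simp add: t_def)
    ultimately show False by simp
  qed
  show thesis
    \<comment> \<open>Taking \<open>h = 0\<close> in \<open>sup\<close> yields the inequality
      opposite to \<open>le h0\<close>, hence equality at \<open>h0\<close>.\<close>
    by (rule that[of \<xi>, OF le]) (use sup[of 0] zero le[of h0] in simp)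
qed

text \<open>Hahn-Banach: the Clarke derivative is the support function of the Clarke subdifferential
  and is attained, so that the subdifferential is in particular nonempty.\<close>

lemma clarke_support:
  fixes f :: "'a::euclidean_space \<Rightarrow> real"
  assumes lip: "L-lipschitz_on UNIV f"
  obtains \<xi> where "\<xi> \<in> clarke_subdifferential f x" "\<xi> \<bullet> h = clarke_real f x h"
proof -
  obtain \<xi> where "\<And>k. \<xi> \<bullet> k \<le> clarke_real f x k" "\<xi> \<bullet> h = clarke_real f x h"
    using sublinear_support[of "clarke_real f x" h, OF clarke_real_add[OF lip] clarke_real_scale[OF lip] clarke_real_0[OF lip]]
    by blast
  then show thesis using that clarke_subdifferential_iff[OF lip] by blast
qed

lemma clarke_subdifferential_norm_le:
  fixes f :: "'a::euclidean_space \<Rightarrow> real"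
  assumes lip: "L-lipschitz_on UNIV f" and "\<xi> \<in> clarke_subdifferential f x"
  shows "norm \<xi> \<le> L"
proof -
  have "norm \<xi> * norm \<xi> \<le> L * norm \<xi>"
    using assms(2) clarke_real_le[OF lip, of x \<xi>] clarke_subdifferential_iff[OF lip, of \<xi> x]
    by (metis order_trans norm_eq_sqrt_inner power2_eq_square power2_norm_eq_inner)
  then show ?thesis using lipschitz_on_nonneg[OF lip] by (cases "\<xi> = 0") auto
qed

text \<open>The Clarke derivative is upper semicontinuous in the base point: an estimate of
  difference quotients within \<open>r\<close> of the limit \<open>z'\<close> holds within
  \<open>r / 2\<close> of every point that is \<open>r / 2\<close>-close to
  \<open>z'\<close>.\<close>

lemma clarke_subdifferential_closed_graph:
  fixes f :: "'a::euclidean_space \<Rightarrow> real"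
  assumes lip: "L-lipschitz_on UNIV f"
    and mem: "\<And>n. \<xi> n \<in> clarke_subdifferential f (z n)" and lim: "\<xi> \<longlonglongrightarrow> \<xi>'" "z \<longlonglongrightarrow> z'"
  shows "\<xi>' \<in> clarke_subdifferential f z'"
  unfolding clarke_subdifferential_iff[OF lip]
proof
  fix h
  show "\<xi>' \<bullet> h \<le> clarke_real f z' h"
  proof (rule field_le_epsilon)
    fix e :: real assume "e > 0"
    then obtain r where r: "r > 0" "\<And>y s. norm (y - z') < r \<Longrightarrow> 0 < s \<Longrightarrow> s < r \<Longrightarrow>
        f (y + s *\<^sub>R h) - f y < s * (clarke_real f z' h + e)"
      using clarke_real_lessD[OF lip, of z' h "clarke_real f z' h + e"] by auto
    have "eventually (\<lambda>n. norm (z n - z') < r / 2) sequentially"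
      using tendstoD[OF lim(2), of "r / 2"] r(1) by (simp add: dist_norm)
    then have ev: "eventually (\<lambda>n. \<xi> n \<bullet> h \<le> clarke_real f z' h + e) sequentially"
    proof eventually_elim
      case (elim n)
      have "\<xi> n \<bullet> h \<le> clarke_real f (z n) h" using mem[of n] clarke_subdifferential_iff[OF lip] by blast
      also have "\<dots> \<le> clarke_real f z' h + e"
      proof (rule clarke_real_leI[OF lip])
        show "r / 2 > 0" using r(1) by simp
        fix y s assume y: "norm (y - z n) < r / 2" "0 < s" "s < r / 2"
        have "norm (y - z') < r" using norm_triangle_ineq[of "y - z n" "z n - z'"] y elim by simp
        then show "f (y + s *\<^sub>R h) - f y \<le> s * (clarke_real f z' h + e)"
          using r(2)[of y s] y by simp
      qed
      finally show ?case .
    qed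
    have "(\<lambda>n. \<xi> n \<bullet> h) \<longlonglongrightarrow> \<xi>' \<bullet> h" using lim(1) by (intro tendsto_intros)
    then show "\<xi>' \<bullet> h \<le> clarke_real f z' h + e"
      by (rule tendsto_upperbound[OF _ ev]) simp
  qed
qed

text \<open>\<open>M\<close> bounds the linear functional given by \<open>h\<close> on the Goldstein
  subdifferential. The difference quotients \<open>q n\<close> of \<open>f\<close> average to those
  of the smoothing and have upper limit at most \<open>M\<close> at every point, but may fail to
  converge. Truncating them from below at \<open>M\<close> produces a bounded sequence that does
  converge to \<open>M\<close>, so dominated convergence applies.\<close>

lemma smoothing_gradient_inner_le:
  fixes f :: "'a::euclidean_space \<Rightarrow> real"
  assumes lip: "L-lipschitz_on UNIV f" and d: "\<delta> > 0"
    and M: "\<And>z \<xi>. z \<in> cball x \<delta> \<Longrightarrow> \<xi> \<in> clarke_subdifferential f z \<Longrightarrow> \<xi> \<bullet> h \<le> M"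
  shows "smoothing_gradient \<delta> f x \<bullet> h \<le> M"
proof -
  interpret prob_space "ball_uniform :: 'a measure" by (rule prob_space_ball_uniform)
  note [measurable] = lipschitz_measurable[OF lip]
  let ?s = "\<lambda>n. inverse (real (Suc n))"
  define q where "q n v = (f (x + ?s n *\<^sub>R h + \<delta> *\<^sub>R v) - f (x + \<delta> *\<^sub>R v)) / ?s n" for n v
  have [measurable]: "q n \<in> borel_measurable borel" for n unfolding q_def[abs_def] by measurable
  have intq: "integrable ball_uniform (q n)" for n
    unfolding q_def[abs_def] using integrable_ball_uniform_lipschitz[OF lip] by simp
  have Eq: "expectation (q n) = (ball_smoothing \<delta> f (x + ?s n *\<^sub>R h) - ball_smoothing \<delta> f x) / ?s n" for n
    unfolding q_def[abs_def] ball_smoothing_def using integrable_ball_uniform_lipschitz[OF lip]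
    by (simp only: Bochner_Integration.integral_divide_zero Bochner_Integration.integral_diff)
  have s0: "?s \<longlonglongrightarrow> 0" by (rule LIMSEQ_inverse_real_of_nat)
  have lim1: "(\<lambda>n. expectation (q n)) \<longlonglongrightarrow> smoothing_gradient \<delta> f x \<bullet> h"
  proof (rule LIM_zero_cancel)
    let ?C = "real DIM('a) * L / \<delta> * (norm h)\<^sup>2"
    have bound: "norm (expectation (q n) - smoothing_gradient \<delta> f x \<bullet> h) \<le> ?s n * ?C" for n
    proof -
      have Eq': "ball_smoothing \<delta> f (x + ?s n *\<^sub>R h) - ball_smoothing \<delta> f x = ?s n * expectation (q n)"
        unfolding Eq by simp
      have "\<bar>ball_smoothing \<delta> f (x + ?s n *\<^sub>R h) - ball_smoothing \<delta> f x - ?s n * (smoothing_gradient \<delta> f x \<bullet> h)\<bar>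
          \<le> ?s n * (?s n * ?C)"
        using ball_smoothing_quadratic[OF lip d, of x "?s n *\<^sub>R h"]
        by (simp add: power_mult_distrib power2_eq_square mult_ac del: of_nat_Suc)
      then have "\<bar>?s n * (expectation (q n) - smoothing_gradient \<delta> f x \<bullet> h)\<bar> \<le> ?s n * (?s n * ?C)"
        unfolding Eq' by (simp only: right_diff_distrib)
      then have "?s n * \<bar>expectation (q n) - smoothing_gradient \<delta> f x \<bullet> h\<bar> \<le> ?s n * (?s n * ?C)"
        unfolding abs_mult by (simp del: of_nat_Suc)
      then have "\<bar>expectation (q n) - smoothing_gradient \<delta> f x \<bullet> h\<bar> \<le> ?s n * ?C"
        by (rule mult_left_le_imp_le) simp
      then show ?thesis by simp
    qed
    have lim0: "(\<lambda>n. ?s n * ?C) \<longlonglongrightarrow> 0" using tendsto_mult_left_zero[OF s0] .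
    show "(\<lambda>n. expectation (q n) - smoothing_gradient \<delta> f x \<bullet> h) \<longlonglongrightarrow> 0"
      by (rule Lim_null_comparison[OF always_eventually[OF allI[OF bound]] lim0])
  qed
  have lim2: "(\<lambda>n. expectation (\<lambda>v. max (q n v) M)) \<longlonglongrightarrow> expectation (\<lambda>v. M)"
  proof (rule integral_dominated_convergence[where w="\<lambda>v. L * norm h + \<bar>M\<bar>"])
    show "AE v in ball_uniform. norm (max (q n v) M) \<le> L * norm h + \<bar>M\<bar>" for n
    proof (rule AE_I2)
      fix v :: 'a
      have "\<bar>f (x + ?s n *\<^sub>R h + \<delta> *\<^sub>R v) - f (x + \<delta> *\<^sub>R v)\<bar> \<le> L * norm h * ?s n"
      proof -
        have "norm (x + ?s n *\<^sub>R h + \<delta> *\<^sub>R v - (x + \<delta> *\<^sub>R v)) = norm h * ?s n"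
          by (simp del: of_nat_Suc)
        then show ?thesis
          using lipschitz_bound[OF lip, of "x + ?s n *\<^sub>R h + \<delta> *\<^sub>R v" "x + \<delta> *\<^sub>R v"]
          by (simp only: mult.assoc)
      qed
      then have "\<bar>f (x + ?s n *\<^sub>R h + \<delta> *\<^sub>R v) - f (x + \<delta> *\<^sub>R v)\<bar> / ?s n \<le> L * norm h"
        by (subst pos_divide_le_eq) auto
      then have "\<bar>q n v\<bar> \<le> L * norm h"
        unfolding q_def abs_divide by (simp del: of_nat_Suc)
      then show "norm (max (q n v) M) \<le> L * norm h + \<bar>M\<bar>" unfolding real_norm_def by linarith
    qed
    show "AE v in ball_uniform. (\<lambda>n. max (q n v) M) \<longlonglongrightarrow> M"
      using AE_ball_uniform
    proof eventually_elim
      case (elim v)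
      let ?z = "x + \<delta> *\<^sub>R v"
      have "\<delta> * norm v \<le> \<delta> * 1" using elim d by (intro mult_left_mono) auto
      then have "?z \<in> cball x \<delta>" using d by (simp add: dist_norm)
      moreover obtain \<xi> where "\<xi> \<in> clarke_subdifferential f ?z" "\<xi> \<bullet> h = clarke_real f ?z h"
        using clarke_support[OF lip] by blast
      \<comment> \<open>A bound for all subgradients is a bound for the Clarke derivative, because
        the latter is attained by one of them.\<close>
      ultimately have PM: "clarke_real f ?z h \<le> M" using M by metis
      show ?case
      proof (rule LIMSEQ_I)
        fix e :: real assume e: "0 < e"
        obtain r where r: "r > 0" "\<And>y s. norm (y - ?z) < r \<Longrightarrow> 0 < s \<Longrightarrow> s < r \<Longrightarrow> f (y + s *\<^sub>R h) - f y < s * (M + e)"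
          using clarke_real_lessD[OF lip, of ?z h "M + e"] PM e by auto
        have "eventually (\<lambda>n. ?s n < r) sequentially" using order_tendstoD(2)[OF s0 r(1)] .
        then obtain N where N: "\<And>n. n \<ge> N \<Longrightarrow> ?s n < r" unfolding eventually_sequentially by blast
        have "norm (max (q n v) M - M) < e" if "n \<ge> N" for n
        proof -
          have "f (?z + ?s n *\<^sub>R h) - f ?z < ?s n * (M + e)" using r(1) N[OF that] by (intro r(2)) auto
          then have "f (x + ?s n *\<^sub>R h + \<delta> *\<^sub>R v) - f ?z < (M + e) * ?s n"
            by (simp only: add_ac mult.commute)
          then have "q n v < M + e"
            unfolding q_def by (subst pos_divide_less_eq) auto
          then show ?thesis using e by (simp add: max_def)
        qed
        then show "\<exists>no. \<forall>n\<ge>no. norm (max (q n v) M - M) < e" by blast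
      qed
    qed
  qed simp_all
  have intm: "integrable ball_uniform (\<lambda>v. max (q n v) M)" for n
    using intq by (intro integrable_max) auto
  have "expectation (q n) \<le> expectation (\<lambda>v. max (q n v) M)" for n
    by (rule integral_mono[OF intq intm]) simp
  then have "smoothing_gradient \<delta> f x \<bullet> h \<le> expectation (\<lambda>v. M)"
    by (intro LIMSEQ_le[OF lim1 lim2]) auto
  then show ?thesis using prob_space by simp
qed

section \<open>The Goldstein subdifferential\<close>

lemma goldstein_subdifferential_nonempty:
  fixes f :: "'a::euclidean_space \<Rightarrow> real"
  assumes lip: "L-lipschitz_on UNIV f" and d: "\<delta> > 0"
  shows "goldstein_subdifferential \<delta> f x \<noteq> {}"
proof -
  obtain \<xi> where "\<xi> \<in> clarke_subdifferential f x" using clarke_support[OF lip] by blast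
  then have "\<xi> \<in> (\<Union>z\<in>cball x \<delta>. clarke_subdifferential f z)" using d by auto
  then show ?thesis unfolding goldstein_subdifferential_def by (metis convex_hull_eq_empty empty_iff)
qed

text \<open>The separation theorem is applied to the closure of the convex hull; the distance to a
  set cannot tell it from its closure.\<close>

lemma infdist_goldstein_le:
  fixes f :: "'a::euclidean_space \<Rightarrow> real"
  assumes lip: "L-lipschitz_on UNIV f" and d: "\<delta> > 0"
  shows "infdist 0 (goldstein_subdifferential \<delta> f x) \<le> norm (smoothing_gradient \<delta> f x)"
proof -
  let ?G = "goldstein_subdifferential \<delta> f x" and ?g = "smoothing_gradient \<delta> f x"
  have "?g \<in> closure ?G"
  proof (rule ccontr)
    assume "?g \<notin> closure ?G"
    moreover have "convex (closure ?G)" unfolding goldstein_subdifferential_def by (intro convex_closure convex_convex_hull)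
    ultimately obtain a b where ab: "a \<bullet> ?g < b" "\<And>y. y \<in> closure ?G \<Longrightarrow> a \<bullet> y > b"
      using separating_hyperplane_closed_point[of "closure ?G" ?g] by auto
    have "?g \<bullet> (- a) \<le> - b"
    proof (rule smoothing_gradient_inner_le[OF lip d])
      fix z \<xi> assume "z \<in> cball x \<delta>" "\<xi> \<in> clarke_subdifferential f z"
      then have "\<xi> \<in> ?G" unfolding goldstein_subdifferential_def by (intro hull_inc) auto
      then show "\<xi> \<bullet> (- a) \<le> - b" using ab(2)[of \<xi>] subsetD[OF closure_subset] by (force simp: inner_commute)
    qed
    then show False using ab(1) by (simp add: inner_commute)
  qed
  show ?thesis
  proof (rule field_le_epsilon)
    fix e :: real assume "e > 0"
    then obtain y where y: "y \<in> ?G" "dist y ?g < e" using \<open>?g \<in> closure ?G\<close> unfolding closure_approachable by blast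
    have "infdist 0 ?G \<le> dist 0 y" using y(1) by (rule infdist_le)
    also have "\<dots> \<le> norm ?g + e" using y(2) norm_triangle_sub[of y ?g] by (simp add: dist_norm)
    finally show "infdist 0 ?G \<le> norm ?g + e" .
  qed
qed

text \<open>Lower semicontinuity of the distance. Were it larger than \<open>a\<close> at the limit
  \<open>x'\<close>, the point \<open>w\<close> of the closure nearest to 0 would confine the
  Goldstein subdifferential at \<open>x'\<close> to the half-space
  \<open>w \<bullet> y \<ge> w \<bullet> w\<close>. Each \<open>x n\<close> has a Clarke subgradient
  clearly outside that half-space, and a cluster point of these belongs to the Goldstein
  subdifferential at \<open>x'\<close> by the closed graph, a contradiction.\<close>

lemma closed_infdist_goldstein_le:
  fixes f :: "'a::euclidean_space \<Rightarrow> real"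
  assumes lip: "L-lipschitz_on UNIV f" and d: "\<delta> > 0"
  shows "closed {x. infdist 0 (goldstein_subdifferential \<delta> f x) \<le> a}"
  unfolding closed_sequential_limits
proof (intro allI impI, elim conjE)
  let ?G = "goldstein_subdifferential \<delta> f"
  fix x x' assume x: "\<forall>n. x n \<in> {x. infdist 0 (?G x) \<le> a}" "x \<longlonglongrightarrow> x'"
  show "x' \<in> {x. infdist 0 (?G x) \<le> a}"
  proof (rule ccontr)
    assume "x' \<notin> {x. infdist 0 (?G x) \<le> a}"
    then have big: "infdist 0 (?G x') > a" by simp
    have a0: "a \<ge> 0" using x(1)[rule_format, of 0] infdist_nonneg[of 0 "?G (x 0)"] by simp
    let ?C = "closure (?G x')"
    have C: "convex ?C" "closed ?C" "?C \<noteq> {}"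
      using goldstein_subdifferential_nonempty[OF lip d, of x']
      by (auto simp: goldstein_subdifferential_def intro: convex_closure convex_convex_hull)
    define w where "w = closest_point ?C 0"
    have w: "w \<in> ?C" "\<And>y. y \<in> ?C \<Longrightarrow> w \<bullet> y \<ge> w \<bullet> w"
      using closest_point_in_set[OF C(2,3)] closest_point_dot[OF C(1,2), of _ 0]
      by (auto simp: w_def inner_diff_right)
    have wa: "norm w > a"
    proof -
      have "infdist 0 (?G x') \<le> norm w + e" if e: "e > 0" for e
      proof -
        obtain y where y: "y \<in> ?G x'" "dist y w < e" using w(1) e unfolding closure_approachable by blast
        have "infdist 0 (?G x') \<le> dist 0 y" using y(1) by (rule infdist_le)
        also have "\<dots> \<le> norm w + e" using y(2) norm_triangle_sub[of y w] by (simp add: dist_norm)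
        finally show ?thesis .
      qed
      then have "infdist 0 (?G x') \<le> norm w" by (rule field_le_epsilon)
      then show ?thesis using big by simp
    qed
    \<comment> \<open>A level strictly between \<open>a\<close> and \<open>norm w\<close>: above
      \<open>a\<close> to exclude small distances at \<open>x n\<close>, below \<open>norm w\<close>
      so that a strict gap remains after passing to the limit.\<close>
    define a' where "a' = (a + norm w) / 2"
    have a': "a < a'" "a' < norm w" using wa by (auto simp: a'_def)
    have w0: "norm w > 0" using wa a0 by linarith
    \<comment> \<open>Otherwise all subgradients near \<open>x n\<close>, and with them their convex
      hull, would lie in a half-space at distance \<open>a' > a\<close> from 0.\<close>
    have "\<exists>z \<xi>. z \<in> cball (x n) \<delta> \<and> \<xi> \<in> clarke_subdifferential f z \<and> w \<bullet> \<xi> < a' * norm w" for n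
    proof (rule ccontr)
      assume "\<not> ?thesis"
      then have "(\<Union>z\<in>cball (x n) \<delta>. clarke_subdifferential f z) \<subseteq> {y. w \<bullet> y \<ge> a' * norm w}" by force
      then have "?G (x n) \<subseteq> {y. w \<bullet> y \<ge> a' * norm w}"
        unfolding goldstein_subdifferential_def by (rule hull_minimal) (rule convex_halfspace_ge)
      then have "a' \<le> dist 0 y" if "y \<in> ?G (x n)" for y
      proof -
        have "a' * norm w \<le> w \<bullet> y" using that \<open>?G (x n) \<subseteq> _\<close> by auto
        also have "\<dots> \<le> norm w * norm y" by (rule norm_cauchy_schwarz)
        finally show ?thesis using w0 by (simp add: mult.commute)
      qed
      then have "a' \<le> infdist 0 (?G (x n))"
        using goldstein_subdifferential_nonempty[OF lip d, of "x n"]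
        by (auto simp: infdist_def intro!: cINF_greatest)
      then show False using x(1)[rule_format, of n] a' by simp
    qed
    then obtain z \<xi> where z: "\<And>n. z n \<in> cball (x n) \<delta>" and \<xi>: "\<And>n. \<xi> n \<in> clarke_subdifferential f (z n)"
      "\<And>n. w \<bullet> \<xi> n < a' * norm w" by metis
    have "bounded (range x)" using x(2) by (intro convergent_imp_bounded)
    then obtain b where b: "\<And>n. norm (x n) \<le> b" by (auto simp: bounded_iff)
    have "norm (z n) \<le> b + \<delta>" for n
      using z[of n] b[of n] norm_triangle_sub[of "z n" "x n"] by (auto simp: dist_norm norm_minus_commute)
    then have "(z n, \<xi> n) \<in> cball 0 (b + \<delta>) \<times> cball 0 L" for n
      using clarke_subdifferential_norm_le[OF lip \<xi>(1)] by simp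
    moreover have cpt: "compact (cball (0::'a) (b + \<delta>) \<times> cball (0::'a) L)" by (intro compact_Times compact_cball)
    ultimately obtain l r where r: "strict_mono (r :: nat \<Rightarrow> nat)" "((\<lambda>n. (z n, \<xi> n)) \<circ> r) \<longlonglongrightarrow> l"
      using seq_compactE[OF compact_imp_seq_compact[OF cpt], of "\<lambda>n. (z n, \<xi> n)"] by blast
    have lz: "(\<lambda>n. z (r n)) \<longlonglongrightarrow> fst l" and l\<xi>: "(\<lambda>n. \<xi> (r n)) \<longlonglongrightarrow> snd l"
      using tendsto_fst[OF r(2)] tendsto_snd[OF r(2)] by (simp_all add: o_def)
    have mem: "snd l \<in> clarke_subdifferential f (fst l)"
      by (rule clarke_subdifferential_closed_graph[OF lip _ l\<xi> lz]) (rule \<xi>(1))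
    have lx: "(\<lambda>n. x (r n)) \<longlonglongrightarrow> x'" using LIMSEQ_subseq_LIMSEQ[OF x(2) r(1)] by (simp add: o_def)
    have "dist x' (fst l) \<le> \<delta>"
      by (rule LIMSEQ_le_const2[OF tendsto_dist[OF lx lz]]) (use z in auto)
    then have "snd l \<in> ?G x'" using mem unfolding goldstein_subdifferential_def by (intro hull_inc) auto
    then have "w \<bullet> w \<le> w \<bullet> snd l" using w(2) closure_subset by blast
    also have "w \<bullet> snd l \<le> a' * norm w"
      by (rule LIMSEQ_le_const2[OF tendsto_inner[OF tendsto_const l\<xi>]]) (use \<xi>(2) in \<open>auto intro: less_imp_le\<close>)
    finally have "norm w * norm w \<le> a' * norm w" by (simp add: power2_norm_eq_inner[symmetric] power2_eq_square)
    then show False using a' w0 by simp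
  qed
qed

lemma infdist_goldstein_measurable:
  fixes f :: "'a::euclidean_space \<Rightarrow> real"
  assumes lip: "L-lipschitz_on UNIV f" and d: "\<delta> > 0"
  shows "(\<lambda>x. infdist 0 (goldstein_subdifferential \<delta> f x)) \<in> borel_measurable borel"
  by (rule borel_measurable_iff_le[THEN iffD2]) (use closed_infdist_goldstein_le[OF assms] in simp)

section \<open>Unbiasedness of the roulette estimator\<close>

lemma subalgebra_vimage:
  assumes "X \<in> M \<rightarrow>\<^sub>M N"
  shows "subalgebra M (vimage_algebra (space M) X N)"
  using assms unfolding subalgebra_def measurable_iff_sets by simp

lemma space_join_algebra[simp]: "space F = space G \<Longrightarrow> space (join_algebra F G) = space F"
  unfolding join_algebra_def
  by (rule space_measure_of) (metis Un_least sets.space_closed)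

lemma sets_join_algebra:
  "space F = space G \<Longrightarrow> sets (join_algebra F G) = sigma_sets (space F) (sets F \<union> sets G)"
  unfolding join_algebra_def
  by (rule sets_measure_of) (metis Un_least sets.space_closed)

lemma subalgebra_join1: "space F = space G \<Longrightarrow> subalgebra (join_algebra F G) F"
  unfolding subalgebra_def by (auto simp: sets_join_algebra)

lemma subalgebra_join2: "space F = space G \<Longrightarrow> subalgebra (join_algebra F G) G"
  unfolding subalgebra_def by (auto simp: sets_join_algebra)

lemma subalgebra_join:
  assumes "subalgebra M F" "subalgebra M G"
  shows "subalgebra M (join_algebra F G)"
proof -
  have sp: "space F = space M" "space G = space M" using assms by (auto simp: subalgebra_def)
  have "sigma_sets (space M) (sets F \<union> sets G) \<subseteq> sets M"
    using assms by (intro sets.sigma_sets_subset) (auto simp: subalgebra_def)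
  then show ?thesis unfolding subalgebra_def using sp by (simp add: sets_join_algebra)
qed

text \<open>The run postulates independence of sigma-algebras; product formulas for expectations
  want it for random variables. The generated sigma-algebras are contained in the given
  ones.\<close>

lemma (in prob_space) indep_var_subalgebra:
  assumes ind: "indep_set (sets F) (sets G)" and sub: "subalgebra M F" "subalgebra M G"
    and X: "X \<in> F \<rightarrow>\<^sub>M S" and Z: "Z \<in> G \<rightarrow>\<^sub>M N"
  shows "indep_var S X N Z"
  unfolding indep_var_eq
proof (intro conjI measurable_from_subalg[OF sub(1) X] measurable_from_subalg[OF sub(2) Z])
  have 1: "sigma_sets (space M) {X -` A \<inter> space M |A. A \<in> sets S} \<subseteq> sets F"
    using sub(1) measurable_sets[OF X] sets.sigma_sets_subset[of "{X -` A \<inter> space M |A. A \<in> sets S}" F]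
    by (auto simp: subalgebra_def)
  have 2: "sigma_sets (space M) {Z -` A \<inter> space M |A. A \<in> sets N} \<subseteq> sets G"
    using sub(2) measurable_sets[OF Z] sets.sigma_sets_subset[of "{Z -` A \<inter> space M |A. A \<in> sets N}" G]
    by (auto simp: subalgebra_def)
  show "indep_set (sigma_sets (space M) {X -` A \<inter> space M |A. A \<in> sets S})
     (sigma_sets (space M) {Z -` A \<inter> space M |A. A \<in> sets N})"
    using ind 1 2 unfolding indep_sets2_eq by blast
qed

section \<open>Measurability of the run with respect to its history\<close>

context comparison_sgd
begin

abbreviation "H t \<equiv> sgd_history P u K Y t"
abbreviation "U t \<equiv> vimage_algebra (space P) (u t) borel"
abbreviation "HU t \<equiv> join_algebra (H t) (U t)"
abbreviation "HUK t \<equiv> join_algebra (HU t) (vimage_algebra (space P) (K t) (count_space UNIV))"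

lemma sgd_history_generators:
  "(\<Union>s<t. sets (vimage_algebra (space P) (u s) borel) \<union>
      sets (vimage_algebra (space P) (K s) (count_space UNIV)) \<union>
      (\<Union>k j. sets (vimage_algebra (space P) (Y s k j) (count_space UNIV)))) \<subseteq> Pow (space P)"
  by (intro UN_least Un_least) (metis sets.space_closed space_vimage_algebra)+

lemma space_H[simp]: "space (H t) = space P"
  unfolding sgd_history_def by (rule space_measure_of[OF sgd_history_generators])

lemma sets_H: "sets (H t) = sigma_sets (space P) (\<Union>s<t. sets (vimage_algebra (space P) (u s) borel) \<union>
      sets (vimage_algebra (space P) (K s) (count_space UNIV)) \<union>
      (\<Union>k j. sets (vimage_algebra (space P) (Y s k j) (count_space UNIV))))"
  unfolding sgd_history_def by (rule sets_measure_of[OF sgd_history_generators])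

lemma H_generators:
  assumes "s < t"
  shows "u s \<in> H t \<rightarrow>\<^sub>M borel" "K s \<in> H t \<rightarrow>\<^sub>M count_space UNIV" "Y s k j \<in> H t \<rightarrow>\<^sub>M count_space UNIV"
  unfolding measurable_iff_sets space_H sets_H using assms by (auto intro!: sigma_sets.Basic)

lemma subalgebra_H: "t \<le> T \<Longrightarrow> subalgebra P (H t)"
  unfolding subalgebra_def sets_H space_H
  using u_measurable K_measurable Y_measurable unfolding measurable_iff_sets
  by (intro conjI refl sets.sigma_sets_subset UN_least Un_least) auto

lemma subalgebra_H_mono: "s \<le> t \<Longrightarrow> subalgebra (H t) (H s)"
  unfolding subalgebra_def sets_H space_H by (intro conjI refl sigma_sets_mono') force

lemma subalgebra_U: "t < T \<Longrightarrow> subalgebra P (U t)"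
  by (intro subalgebra_vimage u_measurable)

lemma subalgebra_HU: "t < T \<Longrightarrow> subalgebra P (HU t)"
  by (intro subalgebra_join subalgebra_H subalgebra_U) auto

lemma subalgebra_K: "t < T \<Longrightarrow> subalgebra P (vimage_algebra (space P) (K t) (count_space UNIV))"
  by (intro subalgebra_vimage K_measurable)

lemma subalgebra_HUK: "t < T \<Longrightarrow> subalgebra P (HUK t)"
  by (intro subalgebra_join subalgebra_HU subalgebra_K)

text \<open>The number of summands is random. Splitting over the countably many values of
  \<open>K s\<close> leaves finite sums of measurable terms.\<close>

lemma D_measurable_H:
  assumes "s < t" "t \<le> T"
  shows "D s \<in> borel_measurable (H t)"
proof -
  note [measurable] = H_generators[OF assms(1)]
  have "(\<lambda>\<omega>. gap_estimate \<tau> c m \<rho> (K s \<omega>) (\<lambda>k j. Y s k j \<omega>)) \<in> borel_measurable (H t)"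
  proof (rule measurable_compose_countable[where g="K s" and f="\<lambda>n \<omega>. gap_estimate \<tau> c m \<rho> n (\<lambda>k j. Y s k j \<omega>)"])
    show "(\<lambda>\<omega>. gap_estimate \<tau> c m \<rho> n (\<lambda>k j. Y s k j \<omega>)) \<in> borel_measurable (H t)" for n
      unfolding gap_estimate_def by measurable
  qed measurable
  then show ?thesis
    using assms by (subst measurable_cong[where g="\<lambda>\<omega>. gap_estimate \<tau> c m \<rho> (K s \<omega>) (\<lambda>k j. Y s k j \<omega>)"]) (auto simp: gap)
qed

text \<open>The iterate \<open>x t\<close> is a function of directions and gap estimates of strictly
  earlier steps. This makes it independent of \<open>u t\<close>.\<close>

lemma x_measurable_H: "t \<le> T \<Longrightarrow> x t \<in> borel_measurable (H t)"
proof (induction t)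
  case 0
  then show ?case by (subst measurable_cong[where g="\<lambda>_. x0"]) (auto simp: start)
next
  case (Suc t)
  have [measurable]: "x t \<in> borel_measurable (H (Suc t))"
    using Suc by (intro measurable_from_subalg[OF subalgebra_H_mono[of t "Suc t"]]) auto
  have [measurable]: "u t \<in> H (Suc t) \<rightarrow>\<^sub>M borel" by (rule H_generators) simp
  have [measurable]: "D t \<in> borel_measurable (H (Suc t))" using Suc by (intro D_measurable_H) auto
  show ?case
    using Suc by (subst measurable_cong[where g="\<lambda>\<omega>. x t \<omega> - \<eta> *\<^sub>R ((real DIM('a) / (2 * \<delta>) * D t \<omega>) *\<^sub>R u t \<omega>)"])
      (auto simp: step)
qed

lemma x_measurable: "t \<le> T \<Longrightarrow> x t \<in> borel_measurable P"
  using measurable_from_subalg[OF subalgebra_H x_measurable_H] by simp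

lemma D_measurable: "t < T \<Longrightarrow> D t \<in> borel_measurable P"
  using measurable_from_subalg[OF subalgebra_H D_measurable_H[of t "Suc t"]] by simp

lemma x_measurable_HU: "t < T \<Longrightarrow> x t \<in> borel_measurable (HU t)"
  by (rule measurable_from_subalg[OF subalgebra_join1 x_measurable_H]) auto

lemma u_measurable_U: "u t \<in> borel_measurable (U t)"
  by (rule measurable_vimage_algebra1) auto

lemma u_measurable_HU: "t < T \<Longrightarrow> u t \<in> borel_measurable (HU t)"
  by (rule measurable_from_subalg[OF subalgebra_join2 u_measurable_U]) auto

lemma AE_u:
  assumes t: "t < T"
  shows "AE \<omega> in P. norm (u t \<omega>) = 1"
  using AE_sphere_uniform[where 'a='a] unfolding u_law[OF t, symmetric] by (rule AE_distrD[OF u_measurable[OF t]])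

end

text \<open>The expansion sums differences p^m - (1 - p)^m, whereas absolute moments of the
  estimator involve the sums of these powers. For p > 1/2 and m \<ge> 1 one factor suffices to
  compare them: p^m - (1 - p)^m \<ge> p^m - (1 - p) p^(m - 1) = (2 p - 1) p^(m - 1) \<ge> (2 p - 1)
  p^m.\<close>

lemma link_power_summable:
  assumes link: "symmetric_link \<sigma>" and expansion: "link_expansion \<sigma> c m a" and a: "a > 0"
  shows "summable (\<lambda>k. \<bar>c (m (Suc k))\<bar> * \<sigma> a ^ m (Suc k))"
proof -
  let ?p = "\<sigma> a"
  have mono: "strict_mono \<sigma>" and p01: "0 < ?p" "?p < 1" and sym: "\<sigma> (- t) = 1 - \<sigma> t" for t
    using link by (auto simp: symmetric_link_def)
  have gap: "2 * ?p - 1 > 0"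
    using strict_monoD[OF mono, of "- a" a] a sym[of a] by simp
  have m1: "m (Suc k) \<ge> 1" for k using expansion by (simp add: link_expansion_def)
  have "summable (\<lambda>k. \<bar>c (m (Suc k)) * (?p ^ m (Suc k) - (1 - ?p) ^ m (Suc k))\<bar>)"
    using expansion sym[of a] gap by (auto simp: link_expansion_def)
  then have sm: "summable (\<lambda>k. \<bar>c (m (Suc k)) * (?p ^ m (Suc k) - (1 - ?p) ^ m (Suc k))\<bar> / (2 * ?p - 1))"
    by (rule summable_divide)
  show ?thesis
  proof (rule summable_comparison_test[OF _ sm], intro exI allI impI)
    fix k
    obtain n where n: "m (Suc k) = Suc n" using m1[of k] by (cases "m (Suc k)") auto
    have "(1 - ?p) * (1 - ?p) ^ n \<le> (1 - ?p) * ?p ^ n"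
      using p01 gap by (intro mult_left_mono power_mono) auto
    moreover have "(2 * ?p - 1) * (?p * ?p ^ n) \<le> (2 * ?p - 1) * (1 * ?p ^ n)"
      using p01 gap by (intro mult_left_mono mult_right_mono) auto
    ultimately have "(2 * ?p - 1) * ?p ^ Suc n \<le> ?p ^ Suc n - (1 - ?p) ^ Suc n"
      by (simp add: algebra_simps)
    then have "\<bar>c (m (Suc k))\<bar> * ((2 * ?p - 1) * ?p ^ Suc n) \<le> \<bar>c (m (Suc k))\<bar> * \<bar>?p ^ Suc n - (1 - ?p) ^ Suc n\<bar>"
      by (intro mult_left_mono) auto
    then show "norm (\<bar>c (m (Suc k))\<bar> * ?p ^ m (Suc k))
        \<le> \<bar>c (m (Suc k)) * (?p ^ m (Suc k) - (1 - ?p) ^ m (Suc k))\<bar> / (2 * ?p - 1)"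
      unfolding n using gap p01 by (simp only: pos_le_divide_eq abs_mult) (simp add: mult_ac abs_mult)
  qed
qed

text \<open>Rewriting the sum of random length as a series over a fixed index set, with a factor
  that cuts it off, prepares the interchange with the expectation. The shift by \<open>Suc\<close>
  is the one of \<open>link_expansion\<close>.\<close>

lemma gap_estimate_series:
  "gap_estimate \<tau> c m \<rho> n y =
    (\<Sum>k. \<tau> * (c (m (Suc k)) / roulette_tail \<rho> (Suc k)) * of_bool (Suc k \<le> n) *
      (of_bool (\<forall>j<m (Suc k). y (Suc k) j) - of_bool (\<forall>j<m (Suc k). \<not> y (Suc k) j)))"
proof -
  have "(\<Sum>k. \<tau> * (c (m (Suc k)) / roulette_tail \<rho> (Suc k)) * of_bool (Suc k \<le> n) *
      (of_bool (\<forall>j<m (Suc k). y (Suc k) j) - of_bool (\<forall>j<m (Suc k). \<not> y (Suc k) j))) =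
    (\<Sum>k<n. \<tau> * (c (m (Suc k)) / roulette_tail \<rho> (Suc k)) * of_bool (Suc k \<le> n) *
      (of_bool (\<forall>j<m (Suc k). y (Suc k) j) - of_bool (\<forall>j<m (Suc k). \<not> y (Suc k) j)))"
    by (rule suminf_finite) auto
  also have "\<dots> = (\<Sum>k<n. \<tau> * (c (m (Suc k)) / roulette_tail \<rho> (Suc k) *
      (of_bool (\<forall>j<m (Suc k). y (Suc k) j) - of_bool (\<forall>j<m (Suc k). \<not> y (Suc k) j))))"
    by (intro sum.cong refl) simp
  also have "\<dots> = gap_estimate \<tau> c m \<rho> n y"
    unfolding gap_estimate_def sum_distrib_left[symmetric] by (simp add: sum.atLeast1_atMost_eq)
  finally show ?thesis by simp
qed

section \<open>Expectations of single terms of the estimator\<close>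

context comparison_sgd
begin

definition "pr t \<omega> = comparison_prob \<sigma> \<tau> f (x t \<omega> - \<delta> *\<^sub>R u t \<omega>) (x t \<omega> + \<delta> *\<^sub>R u t \<omega>)"

text \<open>With \<open>b = True\<close> this is the indicator A of the block, with
  \<open>b = False\<close> the indicator B.\<close>

definition "blk t k b \<omega> = (of_bool (\<forall>j<m k. Y t k j \<omega> = b) :: real)"

lemma blk_measurable: "t < T \<Longrightarrow> blk t k b \<in> borel_measurable P"
proof -
  assume "t < T"
  note [measurable] = Y_measurable[OF this]
  show ?thesis unfolding blk_def[abs_def] by measurable
qed

lemma pr_measurable:
  assumes t: "t < T" and [measurable]: "f \<in> borel_measurable borel" and link: "symmetric_link \<sigma>"
  shows "pr t \<in> borel_measurable (HU t)"
proof -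
  have "mono \<sigma>" using link by (auto simp: symmetric_link_def intro: strict_mono_mono)
  then have [measurable]: "\<sigma> \<in> borel_measurable borel" by (rule borel_measurable_mono)
  note [measurable] = x_measurable_HU[OF t] u_measurable_HU[OF t]
  show ?thesis unfolding pr_def[abs_def] comparison_prob_def by measurable
qed

text \<open>\<open>W\<close> may depend on the past, the direction and the roulette variable, so the
  block indicator can be replaced by its conditional probability; the \<open>m k\<close> equal
  factors multiply to a power.\<close>

lemma expectation_blk:
  assumes t: "t < T" and f: "f \<in> borel_measurable borel" and link: "symmetric_link \<sigma>"
    and W: "W \<in> borel_measurable (HUK t)" and int: "integrable P W"
  shows "expectation (\<lambda>\<omega>. W \<omega> * blk t k b \<omega>) = expectation (\<lambda>\<omega>. W \<omega> * (if b then pr t \<omega> else 1 - pr t \<omega>) ^ m k)"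
proof -
  let ?J = "{k} \<times> {..<m k}"
  let ?I = "{\<omega> \<in> space P. \<forall>(k', j)\<in>?J. Y t k' j \<omega> = b}"
  interpret S: sigma_finite_subalgebra P "HUK t"
    by (rule finite_measure_subalgebra_is_sigma_finite) (intro_locales, unfold finite_measure_subalgebra_axioms_def, rule subalgebra_HUK[OF t])
  note [measurable] = Y_measurable[OF t] blk_measurable[OF t]
  have eq: "blk t k b \<omega> = indicator ?I \<omega>" if "\<omega> \<in> space P" for \<omega>
    using that by (auto simp: blk_def indicator_def)
  have [measurable]: "?I \<in> sets P" by measurable
  have Wm: "W \<in> borel_measurable P" by (rule measurable_from_subalg[OF subalgebra_HUK[OF t] W])
  have "expectation (\<lambda>\<omega>. W \<omega> * blk t k b \<omega>) = expectation (\<lambda>\<omega>. W \<omega> * indicator ?I \<omega>)"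
    by (intro Bochner_Integration.integral_cong) (auto simp: eq)
  also have "\<dots> = expectation (\<lambda>\<omega>. W \<omega> * real_cond_exp P (HUK t) (indicator ?I) \<omega>)"
    by (rule S.real_cond_exp_intg(2)[symmetric]) (use W int in \<open>auto intro!: integrable_real_mult_indicator\<close>)
  also have "\<dots> = expectation (\<lambda>\<omega>. W \<omega> * (if b then pr t \<omega> else 1 - pr t \<omega>) ^ m k)"
  proof (rule integral_cong_AE)
    have "AE \<omega> in P. real_cond_exp P (HUK t) (indicator ?I) \<omega> =
        (\<Prod>(k', j)\<in>?J. let p = pr t \<omega> in if b then p else 1 - p)"
      using Y_law[OF t, of ?J "\<lambda>_ _. b"] by (simp add: pr_def)
    then show AE: "AE \<omega> in P. W \<omega> * real_cond_exp P (HUK t) (indicator ?I) \<omega> =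
        W \<omega> * (if b then pr t \<omega> else 1 - pr t \<omega>) ^ m k"
      by eventually_elim (simp add: Let_def)
    have [measurable]: "pr t \<in> borel_measurable P"
      by (rule measurable_from_subalg[OF subalgebra_HU[OF t] pr_measurable[OF t f link]])
    show "(\<lambda>\<omega>. W \<omega> * (if b then pr t \<omega> else 1 - pr t \<omega>) ^ m k) \<in> borel_measurable P"
      using Wm by measurable
    show "(\<lambda>\<omega>. W \<omega> * real_cond_exp P (HUK t) (indicator ?I) \<omega>) \<in> borel_measurable P"
      by (intro borel_measurable_times Wm borel_measurable_cond_exp2)
  qed
  finally show ?thesis .
qed

lemma prob_K_ge:
  assumes "t < T"
  shows "expectation (\<lambda>\<omega>. of_bool (k \<le> K t \<omega>)) = roulette_tail \<rho> k"
proof -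
  note [measurable] = K_measurable[OF assms]
  have "expectation (\<lambda>\<omega>. of_bool (k \<le> K t \<omega>)) = (\<integral>n. (of_bool (k \<le> n) :: real) \<partial>distr P (count_space UNIV) (K t))"
    using integral_distr[OF K_measurable[OF assms], of "\<lambda>n. of_bool (k \<le> n) :: real"] by simp
  also have "\<dots> = measure_pmf.expectation \<rho> (indicator {k..})"
    unfolding K_law[OF assms] by (intro Bochner_Integration.integral_cong) (auto simp: indicator_def)
  finally show ?thesis by (simp add: roulette_tail_def)
qed

lemma expectation_K_indep:
  assumes t: "t < T" and W: "W \<in> borel_measurable (HU t)" "integrable P W"
  shows "expectation (\<lambda>\<omega>. W \<omega> * of_bool (k \<le> K t \<omega>)) = expectation W * roulette_tail \<rho> k"
proof -
  let ?UK = "vimage_algebra (space P) (K t) (count_space UNIV)"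
  have "K t \<in> ?UK \<rightarrow>\<^sub>M count_space UNIV" by (rule measurable_vimage_algebra1) auto
  then have kb: "(\<lambda>\<omega>. of_bool (k \<le> K t \<omega>) :: real) \<in> borel_measurable ?UK" by measurable
  note [measurable] = K_measurable[OF t]
  have "integrable P (\<lambda>\<omega>. of_bool (k \<le> K t \<omega>) :: real)"
    by (rule integrable_const_bound[where B=1]) auto
  then show ?thesis
    using indep_var_lebesgue_integral[OF indep_var_subalgebra[OF K_indep[OF t] subalgebra_HU[OF t] subalgebra_K[OF t] W(1) kb] W(2)]
    by (simp add: prob_K_ge[OF t])
qed

text \<open>Two layers of averaging: the outcomes, given everything including \<open>K t\<close>,
  and then \<open>K t\<close>, which is independent of the past and of \<open>u t\<close>. The tail
  probability that appears cancels the weight of the estimator.\<close>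

lemma expectation_roulette_blk:
  assumes t: "t < T" and f: "f \<in> borel_measurable borel" and link: "symmetric_link \<sigma>"
    and Z: "Z \<in> borel_measurable (HU t)" and int: "integrable P Z"
  shows "expectation (\<lambda>\<omega>. Z \<omega> * of_bool (k \<le> K t \<omega>) * blk t k b \<omega>) =
      expectation (\<lambda>\<omega>. Z \<omega> * (if b then pr t \<omega> else 1 - pr t \<omega>) ^ m k) * roulette_tail \<rho> k"
    and "integrable P (\<lambda>\<omega>. Z \<omega> * of_bool (k \<le> K t \<omega>) * blk t k b \<omega>)"
    and "integrable P (\<lambda>\<omega>. Z \<omega> * (if b then pr t \<omega> else 1 - pr t \<omega>) ^ m k)"
proof -
  let ?p = "\<lambda>\<omega>. if b then pr t \<omega> else 1 - pr t \<omega>"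
  have spK: "K t \<in> HUK t \<rightarrow>\<^sub>M count_space UNIV"
    by (rule measurable_from_subalg[OF subalgebra_join2 measurable_vimage_algebra1]) auto
  have ZHUK: "Z \<in> borel_measurable (HUK t)"
    by (rule measurable_from_subalg[OF subalgebra_join1 Z]) simp
  have ZP[measurable]: "Z \<in> borel_measurable P" by (rule measurable_from_subalg[OF subalgebra_HU[OF t] Z])
  note pm = pr_measurable[OF t f link]
  have [measurable]: "pr t \<in> borel_measurable P" by (rule measurable_from_subalg[OF subalgebra_HU[OF t] pm])
  note [measurable] = K_measurable[OF t] blk_measurable[OF t]
  have p01: "\<bar>(?p \<omega>) ^ n\<bar> \<le> 1" for \<omega> n
  proof -
    have "0 < pr t \<omega>" "pr t \<omega> < 1" using link by (auto simp: pr_def comparison_prob_def symmetric_link_def)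
    then show ?thesis by (auto simp: abs_le_iff intro!: power_le_one order_trans[OF _ zero_le_power])
  qed
  have iK: "integrable P (\<lambda>\<omega>. Z \<omega> * of_bool (k \<le> K t \<omega>))"
    by (rule Bochner_Integration.integrable_bound[OF int]) auto
  show "integrable P (\<lambda>\<omega>. Z \<omega> * of_bool (k \<le> K t \<omega>) * blk t k b \<omega>)"
  proof (rule Bochner_Integration.integrable_bound[OF int])
    show "(\<lambda>\<omega>. Z \<omega> * of_bool (k \<le> K t \<omega>) * blk t k b \<omega>) \<in> borel_measurable P" by measurable
    show "AE \<omega> in P. norm (Z \<omega> * of_bool (k \<le> K t \<omega>) * blk t k b \<omega>) \<le> norm (Z \<omega>)"
      by (rule AE_I2) (simp add: blk_def of_bool_def)
  qed
  show ip: "integrable P (\<lambda>\<omega>. Z \<omega> * ?p \<omega> ^ m k)"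
  proof (rule Bochner_Integration.integrable_bound[OF int])
    show "(\<lambda>\<omega>. Z \<omega> * ?p \<omega> ^ m k) \<in> borel_measurable P" by measurable
    have "norm (Z \<omega> * ?p \<omega> ^ m k) \<le> norm (Z \<omega>)" for \<omega>
      using mult_left_mono[OF p01[of \<omega> "m k"], of "\<bar>Z \<omega>\<bar>"] by (simp only: real_norm_def abs_mult mult_1_right abs_ge_zero)
    then show "AE \<omega> in P. norm (Z \<omega> * ?p \<omega> ^ m k) \<le> norm (Z \<omega>)" by simp
  qed
  have "expectation (\<lambda>\<omega>. Z \<omega> * of_bool (k \<le> K t \<omega>) * blk t k b \<omega>) =
      expectation (\<lambda>\<omega>. Z \<omega> * of_bool (k \<le> K t \<omega>) * ?p \<omega> ^ m k)"
  proof (rule expectation_blk[OF t f link _ iK])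
    show "(\<lambda>\<omega>. Z \<omega> * of_bool (k \<le> K t \<omega>)) \<in> borel_measurable (HUK t)" using spK ZHUK by measurable
  qed
  also have "\<dots> = expectation (\<lambda>\<omega>. (Z \<omega> * ?p \<omega> ^ m k) * of_bool (k \<le> K t \<omega>))"
    by (simp only: mult_ac)
  also have "\<dots> = expectation (\<lambda>\<omega>. Z \<omega> * ?p \<omega> ^ m k) * roulette_tail \<rho> k"
  proof (rule expectation_K_indep[OF t _ ip])
    show "(\<lambda>\<omega>. Z \<omega> * ?p \<omega> ^ m k) \<in> borel_measurable (HU t)" using pm Z by measurable
  qed
  finally show "expectation (\<lambda>\<omega>. Z \<omega> * of_bool (k \<le> K t \<omega>) * blk t k b \<omega>) =
      expectation (\<lambda>\<omega>. Z \<omega> * ?p \<omega> ^ m k) * roulette_tail \<rho> k" .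
qed

end

text \<open>The standing hypotheses, with \<open>2 * L * \<delta>\<close> written out for the bound
  B on the gaps. \<open>S\<close> bounds the second moment of the stochastic gradient.\<close>

locale lipschitz_comparison_sgd = comparison_sgd P f \<sigma> \<tau> c m \<rho> \<delta> \<eta> x0 T u K Y D x
  for P :: "'w measure" and f :: "'a::euclidean_space \<Rightarrow> real" and \<sigma> \<tau> c m \<rho> \<delta> \<eta> x0 T u K Y D x +
  fixes L C L\<^sub>\<delta> S :: real
  assumes L_pos: "0 < L" and lip: "L-lipschitz_on UNIV f" and delta_pos: "0 < \<delta>" and tau_pos: "0 < \<tau>"
    and link: "symmetric_link \<sigma>" and expansion: "link_expansion \<sigma> c m (2 * L * \<delta> / \<tau>)"
    and roulette: "valid_roulette c m \<rho>"
    and C_nonneg: "0 \<le> C"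
    and L_delta: "L\<^sub>\<delta> = L * sqrt (real DIM('a)) / \<delta>"
    and S: "S = (real DIM('a))\<^sup>2 / (4 * \<delta>\<^sup>2) * C * (2 * L * \<delta>)\<^sup>2"
    and second_moment: "\<And>t. t < T \<Longrightarrow>
      AE \<omega> in P.
        nn_cond_exp P (vimage_algebra (space P) (\<lambda>\<omega>. (x t \<omega>, u t \<omega>)) (borel \<Otimes>\<^sub>M borel))
          (\<lambda>\<omega>. ennreal ((D t \<omega>)\<^sup>2)) \<omega> \<le> ennreal (C * (2 * L * \<delta>)\<^sup>2)"
begin

lemma f_measurable[measurable]: "f \<in> borel_measurable borel"
  by (rule lipschitz_measurable[OF lip])

abbreviation "gap t \<omega> \<equiv> f (x t \<omega> + \<delta> *\<^sub>R u t \<omega>) - f (x t \<omega> - \<delta> *\<^sub>R u t \<omega>)"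
abbreviation "p_max \<equiv> \<sigma> (2 * L * \<delta> / \<tau>)"

lemma AE_gap_bound:
  assumes t: "t < T"
  shows "AE \<omega> in P. \<bar>gap t \<omega>\<bar> \<le> 2 * L * \<delta>"
  using AE_u[OF t]
proof eventually_elim
  case (elim \<omega>)
  have "x t \<omega> + \<delta> *\<^sub>R u t \<omega> - (x t \<omega> - \<delta> *\<^sub>R u t \<omega>) = (2 * \<delta>) *\<^sub>R u t \<omega>"
    by (simp only: scaleR_2 flip: scaleR_scaleR) (simp add: algebra_simps)
  then show ?case
    using lipschitz_bound[OF lip, of "x t \<omega> + \<delta> *\<^sub>R u t \<omega>" "x t \<omega> - \<delta> *\<^sub>R u t \<omega>"] elim delta_pos by simp
qed

lemma pr_eq: "pr t \<omega> = \<sigma> (gap t \<omega> / \<tau>)"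
  by (simp add: pr_def comparison_prob_def)

text \<open>By the symmetry of the link the two end points of the interval add up to 1, so
  \<open>pr t \<omega>\<close> and its complement are both at most \<open>p_max\<close>. The
  summability at \<open>p_max\<close> thus controls both kinds of blocks.\<close>

lemma AE_pr:
  assumes t: "t < T"
  shows "AE \<omega> in P. pr t \<omega> \<in> {\<sigma> (- (2 * L * \<delta> / \<tau>))..p_max} \<and> 0 \<le> pr t \<omega> \<and> pr t \<omega> \<le> p_max \<and> 0 \<le> 1 - pr t \<omega> \<and> 1 - pr t \<omega> \<le> p_max"
  using AE_gap_bound[OF t]
proof eventually_elim
  case (elim \<omega>)
  have mono: "strict_mono \<sigma>" and sym: "\<sigma> (- s) = 1 - \<sigma> s" and p: "0 < \<sigma> s" "\<sigma> s < 1" for s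
    using link by (auto simp: symmetric_link_def)
  have "gap t \<omega> / \<tau> \<le> 2 * L * \<delta> / \<tau>" "- (2 * L * \<delta> / \<tau>) \<le> gap t \<omega> / \<tau>"
    using elim tau_pos divide_right_mono[of "gap t \<omega>" "2 * L * \<delta>" \<tau>] divide_right_mono[of "- (2 * L * \<delta>)" "gap t \<omega>" \<tau>]
    by (simp_all only: abs_le_iff minus_divide_left) linarith+
  then have "\<sigma> (gap t \<omega> / \<tau>) \<le> p_max" "\<sigma> (- (2 * L * \<delta> / \<tau>)) \<le> \<sigma> (gap t \<omega> / \<tau>)"
    using strict_mono_less_eq[OF mono] by auto
  then show ?case using p[of "gap t \<omega> / \<tau>"] sym[of "2 * L * \<delta> / \<tau>"] unfolding pr_eq by auto
qed

text \<open>Testing against \<open>Z\<close> expresses the conditional expectation given the past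
  and the direction. \<open>F k\<close> is the k-th term of the estimator and \<open>A k\<close> the
  k-th term of the expansion, both times \<open>Z\<close>; they have equal means. Sum and
  expectation are interchanged once for each, with the same summable majorant, a multiple of
  \<open>\<bar>c (m (Suc k))\<bar> * p_max ^ m (Suc k)\<close>.\<close>

lemma unbiased:
  assumes t: "t < T" and Z: "Z \<in> borel_measurable (HU t)" and bound: "AE \<omega> in P. \<bar>Z \<omega>\<bar> \<le> M"
  shows "expectation (\<lambda>\<omega>. Z \<omega> * D t \<omega>) = expectation (\<lambda>\<omega>. Z \<omega> * gap t \<omega>)"
proof -
  note [measurable] = K_measurable[OF t] blk_measurable[OF t]
  have pm[measurable]: "pr t \<in> borel_measurable P"
    by (rule measurable_from_subalg[OF subalgebra_HU[OF t] pr_measurable[OF t f_measurable link]])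
  have ZP[measurable]: "Z \<in> borel_measurable P" by (rule measurable_from_subalg[OF subalgebra_HU[OF t] Z])
  have int: "integrable P Z" by (rule integrable_const_bound[where B=M]) (use bound in auto)
  have inta: "integrable P (\<lambda>\<omega>. \<bar>Z \<omega>\<bar>)" using int by simp
  have Za: "(\<lambda>\<omega>. \<bar>Z \<omega>\<bar>) \<in> borel_measurable (HU t)" using Z by measurable
  have M0: "M \<ge> 0"
    using bound AE_False by (smt (verit, best) AE_E2 abs_ge_zero eventually_mono)
  define w where "w k = \<tau> * (c (m (Suc k)) / roulette_tail \<rho> (Suc k))" for k
  define q where "q k = roulette_tail \<rho> (Suc k)" for k
  have q0: "q k \<ge> 0" for k by (simp add: q_def roulette_tail_def)
  \<comment> \<open>Where the coefficient is nonzero, \<open>valid_roulette\<close> makes the tail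
    positive and the division genuine; where it is 0, both sides vanish whatever the quotient
    is.\<close>
  have wq: "w k * q k = \<tau> * c (m (Suc k))" for k
    using roulette by (cases "c (m (Suc k)) = 0") (auto simp: w_def q_def valid_roulette_def)
  have sum: "summable (\<lambda>k. \<bar>c (m (Suc k))\<bar> * p_max ^ m (Suc k))"
    using L_pos delta_pos tau_pos by (intro link_power_summable[OF link expansion]) simp
  define F where "F k \<omega> = Z \<omega> * (w k * of_bool (Suc k \<le> K t \<omega>) * (blk t (Suc k) True \<omega> - blk t (Suc k) False \<omega>))" for k \<omega>
  define A where "A k \<omega> = Z \<omega> * (\<tau> * (c (m (Suc k)) * (pr t \<omega> ^ m (Suc k) - (1 - pr t \<omega>) ^ m (Suc k))))" for k \<omega>
  note rb = expectation_roulette_blk[OF t f_measurable link Z int]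
  note rba = expectation_roulette_blk[OF t f_measurable link Za inta]
  have F_eq: "F k = (\<lambda>\<omega>. w k * (Z \<omega> * of_bool (Suc k \<le> K t \<omega>) * blk t (Suc k) True \<omega>) -
      w k * (Z \<omega> * of_bool (Suc k \<le> K t \<omega>) * blk t (Suc k) False \<omega>))" for k
    unfolding F_def by (simp add: algebra_simps)
  have A_eq: "A k = (\<lambda>\<omega>. (\<tau> * c (m (Suc k))) * (Z \<omega> * (if True then pr t \<omega> else 1 - pr t \<omega>) ^ m (Suc k)) -
      (\<tau> * c (m (Suc k))) * (Z \<omega> * (if False then pr t \<omega> else 1 - pr t \<omega>) ^ m (Suc k)))" for k
    unfolding A_def by (simp add: algebra_simps)
  have Fint: "integrable P (F k)" for k
    unfolding F_eq by (intro Bochner_Integration.integrable_diff integrable_mult_right rb)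
  have Aint: "integrable P (A k)" for k
    unfolding A_eq by (intro Bochner_Integration.integrable_diff integrable_mult_right rb)
  have EF: "expectation (F k) = expectation (A k)" for k
  proof -
    have "expectation (F k) = w k * expectation (\<lambda>\<omega>. Z \<omega> * of_bool (Suc k \<le> K t \<omega>) * blk t (Suc k) True \<omega>)
        - w k * expectation (\<lambda>\<omega>. Z \<omega> * of_bool (Suc k \<le> K t \<omega>) * blk t (Suc k) False \<omega>)"
      unfolding F_eq by (subst Bochner_Integration.integral_diff) (intro integrable_mult_right rb | simp only: integral_mult_right_zero)+
    also have "\<dots> = w k * q k * expectation (\<lambda>\<omega>. Z \<omega> * (if True then pr t \<omega> else 1 - pr t \<omega>) ^ m (Suc k))
        - w k * q k * expectation (\<lambda>\<omega>. Z \<omega> * (if False then pr t \<omega> else 1 - pr t \<omega>) ^ m (Suc k))"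
      unfolding rb(1) q_def by (simp only: mult_ac)
    also have "\<dots> = expectation (A k)"
      unfolding A_eq wq by (subst Bochner_Integration.integral_diff) (intro integrable_mult_right rb | simp only: integral_mult_right_zero)+
    finally show ?thesis .
  qed
  have pw: "AE \<omega> in P. \<bar>Z \<omega>\<bar> * pr t \<omega> ^ n \<le> M * p_max ^ n \<and> \<bar>Z \<omega>\<bar> * (1 - pr t \<omega>) ^ n \<le> M * p_max ^ n" for n
    using AE_pr[OF t] bound by eventually_elim (auto intro!: mult_mono power_mono M0)
  have Epw: "expectation (\<lambda>\<omega>. \<bar>Z \<omega>\<bar> * (if b then pr t \<omega> else 1 - pr t \<omega>) ^ m k) \<le> M * p_max ^ m k" for b k
  proof -
    have "expectation (\<lambda>\<omega>. \<bar>Z \<omega>\<bar> * (if b then pr t \<omega> else 1 - pr t \<omega>) ^ m k) \<le> expectation (\<lambda>\<omega>. M * p_max ^ m k)"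
      by (rule integral_mono_AE[OF rba(3)]) (use pw[of "m k"] in \<open>auto elim: eventually_mono\<close>)
    then show ?thesis using prob_space by simp
  qed
  have normF: "expectation (\<lambda>\<omega>. norm (F k \<omega>)) \<le> 2 * \<tau> * M * (\<bar>c (m (Suc k))\<bar> * p_max ^ m (Suc k))" for k
  proof -
    let ?E = "\<lambda>b \<omega>. \<bar>Z \<omega>\<bar> * of_bool (Suc k \<le> K t \<omega>) * blk t (Suc k) b \<omega>"
    have "expectation (\<lambda>\<omega>. norm (F k \<omega>)) \<le> expectation (\<lambda>\<omega>. \<bar>w k\<bar> * ?E True \<omega> + \<bar>w k\<bar> * ?E False \<omega>)"
    proof (rule integral_mono)
      show "integrable P (\<lambda>\<omega>. norm (F k \<omega>))" using Fint by simp
      show "integrable P (\<lambda>\<omega>. \<bar>w k\<bar> * ?E True \<omega> + \<bar>w k\<bar> * ?E False \<omega>)"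
        by (intro Bochner_Integration.integrable_add integrable_mult_right rba)
      show "norm (F k \<omega>) \<le> \<bar>w k\<bar> * ?E True \<omega> + \<bar>w k\<bar> * ?E False \<omega>" for \<omega>
        by (auto simp: F_def blk_def abs_mult)
    qed
    also have "\<dots> = \<bar>w k\<bar> * expectation (?E True) + \<bar>w k\<bar> * expectation (?E False)"
      by (subst Bochner_Integration.integral_add) (intro integrable_mult_right rba | simp)+
    also have "\<dots> \<le> \<bar>w k\<bar> * ((M * p_max ^ m (Suc k)) * q k) + \<bar>w k\<bar> * ((M * p_max ^ m (Suc k)) * q k)"
      unfolding rba(1) q_def[symmetric] by (intro add_mono mult_left_mono mult_right_mono Epw q0) auto
    also have "\<dots> = 2 * (M * p_max ^ m (Suc k)) * \<bar>w k * q k\<bar>" using q0[of k] by (simp add: abs_mult)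
    also have "\<dots> = 2 * \<tau> * M * (\<bar>c (m (Suc k))\<bar> * p_max ^ m (Suc k))"
      unfolding wq using tau_pos by (simp add: abs_mult)
    finally show ?thesis .
  qed
  have AA: "AE \<omega> in P. \<forall>k. norm (A k \<omega>) \<le> 2 * \<tau> * M * (\<bar>c (m (Suc k))\<bar> * p_max ^ m (Suc k))"
    unfolding AE_all_countable
  proof
    fix k
    show "AE \<omega> in P. norm (A k \<omega>) \<le> 2 * \<tau> * M * (\<bar>c (m (Suc k))\<bar> * p_max ^ m (Suc k))"
      using pw[of "m (Suc k)"] AE_pr[OF t]
    proof eventually_elim
      case (elim \<omega>)
      let ?n = "m (Suc k)"
      have "\<bar>pr t \<omega> ^ ?n - (1 - pr t \<omega>) ^ ?n\<bar> \<le> \<bar>pr t \<omega> ^ ?n\<bar> + \<bar>(1 - pr t \<omega>) ^ ?n\<bar>" by (rule abs_triangle_ineq4)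
      also have "\<dots> = pr t \<omega> ^ ?n + (1 - pr t \<omega>) ^ ?n" using elim by simp
      finally have "\<bar>Z \<omega>\<bar> * \<bar>pr t \<omega> ^ ?n - (1 - pr t \<omega>) ^ ?n\<bar> \<le> \<bar>Z \<omega>\<bar> * (pr t \<omega> ^ ?n + (1 - pr t \<omega>) ^ ?n)"
        by (rule mult_left_mono) simp
      also have "\<dots> \<le> 2 * (M * p_max ^ ?n)" using elim by (simp add: distrib_left)
      finally have "(\<tau> * \<bar>c ?n\<bar>) * (\<bar>Z \<omega>\<bar> * \<bar>pr t \<omega> ^ ?n - (1 - pr t \<omega>) ^ ?n\<bar>) \<le> (\<tau> * \<bar>c ?n\<bar>) * (2 * (M * p_max ^ ?n))"
        using tau_pos by (intro mult_left_mono) auto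
      then show ?case using tau_pos by (simp add: A_def abs_mult mult_ac)
    qed
  qed
  have sumB: "summable (\<lambda>k. 2 * \<tau> * M * (\<bar>c (m (Suc k))\<bar> * p_max ^ m (Suc k)))"
    using sum by (rule summable_mult)
  have normA: "expectation (\<lambda>\<omega>. norm (A k \<omega>)) \<le> 2 * \<tau> * M * (\<bar>c (m (Suc k))\<bar> * p_max ^ m (Suc k))" for k
  proof -
    have "expectation (\<lambda>\<omega>. norm (A k \<omega>)) \<le> expectation (\<lambda>\<omega>. 2 * \<tau> * M * (\<bar>c (m (Suc k))\<bar> * p_max ^ m (Suc k)))"
      by (rule integral_mono_AE) (use Aint AA in \<open>auto elim: eventually_mono\<close>)
    then show ?thesis using prob_space by simp
  qed
  have "expectation (\<lambda>\<omega>. Z \<omega> * D t \<omega>) = expectation (\<lambda>\<omega>. \<Sum>k. F k \<omega>)"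
  proof (rule Bochner_Integration.integral_cong[OF refl])
    fix \<omega> assume "\<omega> \<in> space P"
    then show "Z \<omega> * D t \<omega> = (\<Sum>k. F k \<omega>)"
    proof -
      \<comment> \<open>For fixed \<open>\<omega>\<close> only the terms with
        \<open>k < K t \<omega>\<close> can be nonzero.\<close>
      have "summable (\<lambda>k. w k * of_bool (Suc k \<le> K t \<omega>) * (blk t (Suc k) True \<omega> - blk t (Suc k) False \<omega>))"
        by (rule summable_finite[of "{..<K t \<omega>}"]) auto
      moreover have "D t \<omega> = (\<Sum>k. w k * of_bool (Suc k \<le> K t \<omega>) * (blk t (Suc k) True \<omega> - blk t (Suc k) False \<omega>))"
        unfolding gap[OF t \<open>\<omega> \<in> space P\<close>] gap_estimate_series w_def blk_def by simp
      ultimately show ?thesis unfolding F_def by (simp only: suminf_mult)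
    qed
  qed
  also have "\<dots> = (\<Sum>k. expectation (F k))"
  proof (rule integral_suminf[OF Fint])
    have "summable (\<lambda>k. norm (F k \<omega>))" for \<omega>
      by (rule summable_finite[of "{..<K t \<omega>}"]) (auto simp: F_def)
    then show "AE \<omega> in P. summable (\<lambda>k. norm (F k \<omega>))" by simp
    show "summable (\<lambda>k. expectation (\<lambda>\<omega>. norm (F k \<omega>)))"
      by (rule summable_comparison_test[OF _ sumB]) (use normF in \<open>auto intro!: exI[of _ 0]\<close>)
  qed
  also have "\<dots> = (\<Sum>k. expectation (A k))" unfolding EF ..
  also have "\<dots> = expectation (\<lambda>\<omega>. \<Sum>k. A k \<omega>)"
  proof (rule integral_suminf[OF Aint, symmetric])
    show "AE \<omega> in P. summable (\<lambda>k. norm (A k \<omega>))"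
      using AA by eventually_elim (rule summable_comparison_test[OF _ sumB], auto)
    show "summable (\<lambda>k. expectation (\<lambda>\<omega>. norm (A k \<omega>)))"
      by (rule summable_comparison_test[OF _ sumB]) (use normA in \<open>auto intro!: exI[of _ 0]\<close>)
  qed
  also have "\<dots> = expectation (\<lambda>\<omega>. Z \<omega> * gap t \<omega>)"
  proof (rule integral_cong_AE)
    show "(\<lambda>\<omega>. \<Sum>k. A k \<omega>) \<in> borel_measurable P"
      unfolding A_def by measurable
    note [measurable] = x_measurable[OF less_imp_le[OF t]] u_measurable[OF t]
    show "(\<lambda>\<omega>. Z \<omega> * gap t \<omega>) \<in> borel_measurable P" by measurable
    show "AE \<omega> in P. (\<Sum>k. A k \<omega>) = Z \<omega> * gap t \<omega>"
      using AE_pr[OF t]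
    proof eventually_elim
      case (elim \<omega>)
      let ?s = "\<lambda>k. c (m (Suc k)) * (pr t \<omega> ^ m (Suc k) - (1 - pr t \<omega>) ^ m (Suc k))"
      have sm: "summable ?s"
        by (rule summable_rabs_cancel) (use expansion elim in \<open>simp add: link_expansion_def\<close>)
      \<comment> \<open>The expansion holds on the range of the link only, and
        \<open>pr t \<omega>\<close> is a value of the link by construction.\<close>
      have "inv \<sigma> (pr t \<omega>) = (\<Sum>k. ?s k)"
        using expansion elim by (simp add: link_expansion_def pr_eq)
      moreover have "inv \<sigma> (pr t \<omega>) = gap t \<omega> / \<tau>"
        unfolding pr_eq using link by (intro inv_f_f) (auto simp: symmetric_link_def strict_mono_imp_inj_on)
      ultimately have s: "(\<Sum>k. ?s k) = gap t \<omega> / \<tau>" by (rule trans[OF sym])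
      have "\<tau> * (\<Sum>k. ?s k) = gap t \<omega>" unfolding s using tau_pos by simp
      then show ?case unfolding A_def using sm by (simp add: suminf_mult summable_mult)
    qed
  qed
  finally show ?thesis .
qed

end

section \<open>Descent\<close>

lemma smoothing_gradient_continuous:
  fixes f :: "'a::euclidean_space \<Rightarrow> real"
  assumes lip: "L-lipschitz_on UNIV f" and d: "\<delta> > 0"
  shows "continuous_on UNIV (smoothing_gradient \<delta> f)"
proof (rule lipschitz_on_continuous_on)
  show "(L * sqrt (real DIM('a)) / \<delta>)-lipschitz_on UNIV (smoothing_gradient \<delta> f)"
    using smoothing_gradient_lipschitz[OF lip d] lipschitz_on_nonneg[OF lip] d
    by (intro lipschitz_onI) (auto simp: dist_norm)
qed

lemma smoothing_gradient_measurable: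
  fixes f :: "'a::euclidean_space \<Rightarrow> real"
  assumes "L-lipschitz_on UNIV f" "\<delta> > 0"
  shows "smoothing_gradient \<delta> f \<in> borel_measurable borel"
  by (rule borel_measurable_continuous_onI[OF smoothing_gradient_continuous[OF assms]])

text \<open>An exact gradient step from \<open>x\<close> lowers the smoothing by a multiple of the
  squared gradient norm and cannot go below \<open>b\<close>.\<close>

lemma smoothing_gradient_norm_le_gap:
  fixes f :: "'a::euclidean_space \<Rightarrow> real"
  assumes lip: "L-lipschitz_on UNIV f" and L: "L > 0" and d: "\<delta> > 0" and b: "\<And>y. b \<le> ball_smoothing \<delta> f y"
  shows "(norm (smoothing_gradient \<delta> f x))\<^sup>2 \<le> 4 * (L * sqrt (real DIM('a)) / \<delta>) * (ball_smoothing \<delta> f x - b)"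
proof -
  let ?g = "smoothing_gradient \<delta> f x" and ?K = "L * sqrt (real DIM('a)) / \<delta>"
  have K: "?K > 0" using L d by simp
  \<comment> \<open>The maximizer of s - K s^2, the guaranteed decrease per squared gradient norm;
    its value 1 / (4 K) explains the factor 4.\<close>
  define s where "s = 1 / (2 * ?K)"
  have half: "1 / (2 * k) > 0" "k * (1 / (2 * k)) = 1 / 2" if "k > 0" for k :: real
    using that by auto
  have s: "s > 0" "?K * s = 1 / 2"
    unfolding s_def by (rule half[OF K])+
  have "\<bar>ball_smoothing \<delta> f (x + (- s) *\<^sub>R ?g) - ball_smoothing \<delta> f x - ?g \<bullet> ((- s) *\<^sub>R ?g)\<bar> \<le> ?K * (norm ((- s) *\<^sub>R ?g))\<^sup>2"
    by (rule ball_smoothing_smooth[OF lip d])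
  also have "\<dots> = (?K * s) * s * (norm ?g)\<^sup>2" using s by (simp add: power_mult_distrib power2_eq_square)
  also have "\<dots> = s / 2 * (norm ?g)\<^sup>2" unfolding s(2) by simp
  finally have "\<bar>ball_smoothing \<delta> f (x + (- s) *\<^sub>R ?g) - ball_smoothing \<delta> f x + s * (norm ?g)\<^sup>2\<bar> \<le> s / 2 * (norm ?g)\<^sup>2"
    by (simp add: power2_norm_eq_inner)
  then have "s / 2 * (norm ?g)\<^sup>2 \<le> ball_smoothing \<delta> f x - b"
    using b[of "x + (- s) *\<^sub>R ?g"] by linarith
  then have "(4 * ?K) * (s / 2 * (norm ?g)\<^sup>2) \<le> (4 * ?K) * (ball_smoothing \<delta> f x - b)"
    using K by (intro mult_left_mono) auto
  moreover have "(4 * ?K) * (s / 2 * (norm ?g)\<^sup>2) = (?K * s) * 2 * (norm ?g)\<^sup>2" by (simp add: mult_ac)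
  ultimately show ?thesis unfolding s(2) by simp
qed

section \<open>Moments of the stochastic gradient and one-step descent\<close>

context lipschitz_comparison_sgd
begin

abbreviation "F \<equiv> ball_smoothing \<delta> f"
abbreviation "G \<equiv> smoothing_gradient \<delta> f"
abbreviation "g t \<equiv> expectation (\<lambda>\<omega>. (norm (G (x t \<omega>)))\<^sup>2)"

lemma G_measurable[measurable]: "G \<in> borel_measurable borel"
  by (rule smoothing_gradient_measurable[OF lip delta_pos])

lemma L_delta_pos: "0 < L\<^sub>\<delta>"
  using L_pos delta_pos by (simp add: L_delta)

lemma norm_G_le: "norm (G y) \<le> real DIM('a) * L"
  by (rule smoothing_gradient_norm_le[OF lip delta_pos])

lemma F_measurable[measurable]: "F \<in> borel_measurable borel"
  by (rule lipschitz_measurable[OF ball_smoothing_lipschitz[OF lip]])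

text \<open>The conditional bound is stated for nonnegative extended reals, which presupposes no
  integrability. Integrating it removes the conditioning and yields integrability of the
  square.\<close>

lemma D_second_moment:
  assumes t: "t < T"
  shows "integrable P (\<lambda>\<omega>. (D t \<omega>)\<^sup>2)" "expectation (\<lambda>\<omega>. (D t \<omega>)\<^sup>2) \<le> C * (2 * L * \<delta>)\<^sup>2"
proof -
  let ?F = "vimage_algebra (space P) (\<lambda>\<omega>. (x t \<omega>, u t \<omega>)) (borel \<Otimes>\<^sub>M borel)"
  note [measurable] = x_measurable[OF less_imp_le[OF t]] u_measurable[OF t] D_measurable[OF t]
  have "subalgebra P ?F" by (rule subalgebra_vimage) measurable
  then interpret S: sigma_finite_subalgebra P ?F
    by (intro finite_measure_subalgebra_is_sigma_finite) (intro_locales, unfold finite_measure_subalgebra_axioms_def)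
  have "(\<integral>\<^sup>+\<omega>. ennreal ((D t \<omega>)\<^sup>2) \<partial>P) = (\<integral>\<^sup>+\<omega>. 1 * nn_cond_exp P ?F (\<lambda>\<omega>. ennreal ((D t \<omega>)\<^sup>2)) \<omega> \<partial>P)"
    by (subst S.nn_cond_exp_intg) simp_all
  also have "\<dots> \<le> (\<integral>\<^sup>+\<omega>. ennreal (C * (2 * L * \<delta>)\<^sup>2) \<partial>P)"
    using second_moment[OF t] by (intro nn_integral_mono_AE) simp
  also have "\<dots> = ennreal (C * (2 * L * \<delta>)\<^sup>2)" by (simp add: emeasure_space_1)
  finally have le: "(\<integral>\<^sup>+\<omega>. ennreal ((D t \<omega>)\<^sup>2) \<partial>P) \<le> ennreal (C * (2 * L * \<delta>)\<^sup>2)" .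
  show int: "integrable P (\<lambda>\<omega>. (D t \<omega>)\<^sup>2)"
    by (rule integrableI_nonneg) (use le in \<open>auto simp: le_less_trans[OF _ ennreal_less_top]\<close>)
  show "expectation (\<lambda>\<omega>. (D t \<omega>)\<^sup>2) \<le> C * (2 * L * \<delta>)\<^sup>2"
    using le C_nonneg by (subst (asm) nn_integral_eq_integral[OF int]) auto
qed

lemma D_integrable: "t < T \<Longrightarrow> integrable P (D t)"
  by (rule square_integrable_imp_integrable[OF D_measurable D_second_moment(1)])

lemma G_integrable: "t \<le> T \<Longrightarrow> integrable P (\<lambda>\<omega>. (norm (G (x t \<omega>)))\<^sup>2)"
proof -
  assume t: "t \<le> T"
  note [measurable] = x_measurable[OF t]
  have "(norm (G y))\<^sup>2 \<le> (real DIM('a) * L)\<^sup>2" for y using norm_G_le by (intro power_mono) auto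
  then show ?thesis by (intro integrable_const_bound[where B="(real DIM('a) * L)\<^sup>2"]) auto
qed

lemma indep_x_u:
  assumes t: "t < T"
  shows "indep_var borel (x t) borel (u t)"
  using t by (intro indep_var_subalgebra[OF u_indep subalgebra_H subalgebra_U x_measurable_H u_measurable_U]) auto

text \<open>As \<open>x t\<close> and \<open>u t\<close> are independent, Fubini allows freezing
  \<open>x t\<close> at a point \<open>y\<close>; the inner integral over the sphere is the central
  difference formula in the direction \<open>G y\<close>.\<close>

lemma expectation_gap:
  assumes t: "t < T"
  shows "expectation (\<lambda>\<omega>. (u t \<omega> \<bullet> G (x t \<omega>)) * gap t \<omega>) = 2 * \<delta> / real DIM('a) * g t"
proof -
  note xm[measurable] = x_measurable[OF less_imp_le[OF t]] and um[measurable] = u_measurable[OF t]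
  let ?\<phi> = "\<lambda>(y, v). (v \<bullet> G y) * (f (y + \<delta> *\<^sub>R v) - f (y - \<delta> *\<^sub>R v))"
  let ?\<mu> = "distr P borel (x t)"
  have phi[measurable]: "?\<phi> \<in> borel_measurable (borel \<Otimes>\<^sub>M borel)" by measurable
  interpret X: prob_space ?\<mu> by (rule prob_space_distr) measurable
  interpret V: prob_space "sphere_uniform :: 'a measure" by (rule prob_space_sphere_uniform)
  interpret XV: pair_sigma_finite ?\<mu> "sphere_uniform :: 'a measure" ..
  have eq: "?\<mu> \<Otimes>\<^sub>M sphere_uniform = distr P (borel \<Otimes>\<^sub>M borel) (\<lambda>\<omega>. (x t \<omega>, u t \<omega>))"
    using indep_x_u[OF t] unfolding indep_var_distribution_eq u_law[OF t] by simp
  have int: "integrable P (\<lambda>\<omega>. ?\<phi> (x t \<omega>, u t \<omega>))"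
  proof (rule integrable_const_bound[where B="(real DIM('a) * L) * (2 * L * \<delta>)"])
    show "AE \<omega> in P. norm (?\<phi> (x t \<omega>, u t \<omega>)) \<le> (real DIM('a) * L) * (2 * L * \<delta>)"
      using AE_gap_bound[OF t] AE_u[OF t]
    proof eventually_elim
      case (elim \<omega>)
      have "\<bar>u t \<omega> \<bullet> G (x t \<omega>)\<bar> \<le> real DIM('a) * L"
        using Cauchy_Schwarz_ineq2[of "u t \<omega>" "G (x t \<omega>)"] elim norm_G_le[of "x t \<omega>"] by simp
      then show ?case using elim L_pos by (simp only: prod.case real_norm_def abs_mult) (intro mult_mono, auto)
    qed
  qed measurable
  have "expectation (\<lambda>\<omega>. (u t \<omega> \<bullet> G (x t \<omega>)) * gap t \<omega>) = integral\<^sup>L (?\<mu> \<Otimes>\<^sub>M sphere_uniform) ?\<phi>"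
    unfolding eq by (subst integral_distr) auto
  also have "\<dots> = (\<integral>y. (\<integral>v. ?\<phi> (y, v) \<partial>sphere_uniform) \<partial>?\<mu>)"
  proof (rule XV.integral_fst'[symmetric])
    show "integrable (?\<mu> \<Otimes>\<^sub>M sphere_uniform) ?\<phi>"
      unfolding eq using int by (subst integrable_distr_eq) auto
  qed
  also have "\<dots> = (\<integral>y. 2 * \<delta> / real DIM('a) * (norm (G y))\<^sup>2 \<partial>?\<mu>)"
    by (simp add: smoothing_gradient_symmetric(1)[OF lip delta_pos] power2_norm_eq_inner)
  also have "\<dots> = 2 * \<delta> / real DIM('a) * g t"
    by (subst integral_distr) (auto simp: integral_mult_right_zero)
  finally show ?thesis .
qed

text \<open>Unbiasedness of the stochastic gradient, paired with the true gradient: the test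
  function is \<open>u t \<omega> \<bullet> G (x t \<omega>)\<close>, and the factor d / (2
  \<delta>) undoes the one of the central difference formula.\<close>

lemma expectation_gradient_step:
  assumes t: "t < T"
  shows "expectation (\<lambda>\<omega>. (real DIM('a) / (2 * \<delta>) * D t \<omega>) * (u t \<omega> \<bullet> G (x t \<omega>))) = g t"
    and "integrable P (\<lambda>\<omega>. (real DIM('a) / (2 * \<delta>) * D t \<omega>) * (u t \<omega> \<bullet> G (x t \<omega>)))"
proof -
  note [measurable] = x_measurable[OF less_imp_le[OF t]] u_measurable[OF t] D_measurable[OF t]
  have Zb: "AE \<omega> in P. \<bar>u t \<omega> \<bullet> G (x t \<omega>)\<bar> \<le> real DIM('a) * L"
    using AE_u[OF t]
  proof eventually_elim
    case (elim \<omega>)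
    then show ?case using Cauchy_Schwarz_ineq2[of "u t \<omega>" "G (x t \<omega>)"] norm_G_le[of "x t \<omega>"] by simp
  qed
  have Zm: "(\<lambda>\<omega>. u t \<omega> \<bullet> G (x t \<omega>)) \<in> borel_measurable (HU t)"
    using u_measurable_HU[OF t] x_measurable_HU[OF t] by measurable
  have "expectation (\<lambda>\<omega>. (real DIM('a) / (2 * \<delta>) * D t \<omega>) * (u t \<omega> \<bullet> G (x t \<omega>))) =
      real DIM('a) / (2 * \<delta>) * expectation (\<lambda>\<omega>. (u t \<omega> \<bullet> G (x t \<omega>)) * D t \<omega>)"
    by (simp add: mult_ac flip: integral_mult_right_zero)
  also have "\<dots> = g t"
    unfolding unbiased[OF t Zm Zb] expectation_gap[OF t] using delta_pos by simp
  finally show "expectation (\<lambda>\<omega>. (real DIM('a) / (2 * \<delta>) * D t \<omega>) * (u t \<omega> \<bullet> G (x t \<omega>))) = g t" .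
  show "integrable P (\<lambda>\<omega>. (real DIM('a) / (2 * \<delta>) * D t \<omega>) * (u t \<omega> \<bullet> G (x t \<omega>)))"
  proof (rule Bochner_Integration.integrable_bound)
    show "integrable P (\<lambda>\<omega>. (real DIM('a) / (2 * \<delta>) * (real DIM('a) * L)) * \<bar>D t \<omega>\<bar>)"
      using D_integrable[OF t] by simp
    show "AE \<omega> in P. norm ((real DIM('a) / (2 * \<delta>) * D t \<omega>) * (u t \<omega> \<bullet> G (x t \<omega>))) \<le> norm ((real DIM('a) / (2 * \<delta>) * (real DIM('a) * L)) * \<bar>D t \<omega>\<bar>)"
      using Zb
    proof eventually_elim
      case (elim \<omega>)
      have "(real DIM('a) / (2 * \<delta>) * \<bar>D t \<omega>\<bar>) * \<bar>u t \<omega> \<bullet> G (x t \<omega>)\<bar> \<le> (real DIM('a) / (2 * \<delta>) * \<bar>D t \<omega>\<bar>) * (real DIM('a) * L)"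
        using elim delta_pos by (intro mult_left_mono) auto
      then show ?case using delta_pos L_pos by (simp add: abs_mult mult_ac)
    qed
  qed measurable
qed

lemma expectation_step_square:
  assumes t: "t < T"
  shows "integrable P (\<lambda>\<omega>. (real DIM('a) / (2 * \<delta>) * D t \<omega>)\<^sup>2)" "expectation (\<lambda>\<omega>. (real DIM('a) / (2 * \<delta>) * D t \<omega>)\<^sup>2) \<le> S"
proof -
  have eq: "(real DIM('a) / (2 * \<delta>) * D t \<omega>)\<^sup>2 = (real DIM('a))\<^sup>2 / (4 * \<delta>\<^sup>2) * (D t \<omega>)\<^sup>2" for \<omega>
    by (simp add: power_mult_distrib power_divide)
  show "integrable P (\<lambda>\<omega>. (real DIM('a) / (2 * \<delta>) * D t \<omega>)\<^sup>2)"
    unfolding eq using D_second_moment(1)[OF t] by (rule integrable_mult_right)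
  have "(real DIM('a))\<^sup>2 / (4 * \<delta>\<^sup>2) * expectation (\<lambda>\<omega>. (D t \<omega>)\<^sup>2) \<le> (real DIM('a))\<^sup>2 / (4 * \<delta>\<^sup>2) * (C * (2 * L * \<delta>)\<^sup>2)"
    using D_second_moment(2)[OF t] by (intro mult_left_mono) auto
  then show "expectation (\<lambda>\<omega>. (real DIM('a) / (2 * \<delta>) * D t \<omega>)\<^sup>2) \<le> S"
    unfolding eq integral_mult_right_zero S by (simp only: mult.assoc)
qed

text \<open>Since the pairing of the stochastic with the true gradient has mean \<open>g t\<close>,
  the inequality a b \<le> a^2 / 2 + b^2 / 2 bounds \<open>g t\<close> by half of \<open>S\<close>
  plus half of itself.\<close>

lemma g_le_S:
  assumes t: "t < T"
  shows "g t \<le> S"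
proof -
  let ?a = "\<lambda>\<omega>. real DIM('a) / (2 * \<delta>) * D t \<omega>"
  have "g t \<le> expectation (\<lambda>\<omega>. 1 / 2 * (?a \<omega>)\<^sup>2 + 1 / 2 * (norm (G (x t \<omega>)))\<^sup>2)"
    unfolding expectation_gradient_step(1)[OF t, symmetric]
  proof (rule integral_mono_AE[OF expectation_gradient_step(2)[OF t]])
    show "integrable P (\<lambda>\<omega>. 1 / 2 * (?a \<omega>)\<^sup>2 + 1 / 2 * (norm (G (x t \<omega>)))\<^sup>2)"
      using t by (intro Bochner_Integration.integrable_add integrable_mult_right expectation_step_square G_integrable) auto
    show "AE \<omega> in P. ?a \<omega> * (u t \<omega> \<bullet> G (x t \<omega>)) \<le> 1 / 2 * (?a \<omega>)\<^sup>2 + 1 / 2 * (norm (G (x t \<omega>)))\<^sup>2"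
      using AE_u[OF t]
    proof eventually_elim
      case (elim \<omega>)
      have "?a \<omega> * (u t \<omega> \<bullet> G (x t \<omega>)) \<le> \<bar>?a \<omega>\<bar> * \<bar>u t \<omega> \<bullet> G (x t \<omega>)\<bar>"
        unfolding abs_mult[symmetric] by (rule abs_ge_self)
      also have "\<dots> \<le> \<bar>?a \<omega>\<bar> * norm (G (x t \<omega>))"
        using Cauchy_Schwarz_ineq2[of "u t \<omega>" "G (x t \<omega>)"] elim by (intro mult_left_mono) auto
      also have "\<dots> \<le> 1 / 2 * (?a \<omega>)\<^sup>2 + 1 / 2 * (norm (G (x t \<omega>)))\<^sup>2"
        using zero_le_power2[of "\<bar>?a \<omega>\<bar> - norm (G (x t \<omega>))"] unfolding power2_diff power2_abs by linarith
      finally show ?case .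
    qed
  qed
  also have "\<dots> = 1 / 2 * expectation (\<lambda>\<omega>. (?a \<omega>)\<^sup>2) + 1 / 2 * g t"
    using t by (subst Bochner_Integration.integral_add)
      (auto intro!: integrable_mult_right expectation_step_square G_integrable simp del: times_divide_eq_left)
  finally show ?thesis using expectation_step_square(2)[OF t] by linarith
qed

text \<open>The first estimate is the smoothness inequality along the step. The second one, from the
  Lipschitz continuity of the smoothing, propagates integrability from one iterate to the
  next.\<close>

lemma F_step:
  assumes t: "t < T"
  shows "AE \<omega> in P. F (x (Suc t) \<omega>) \<le> F (x t \<omega>) - \<eta> * ((real DIM('a) / (2 * \<delta>) * D t \<omega>) * (u t \<omega> \<bullet> G (x t \<omega>)))
      + L\<^sub>\<delta> * \<eta>\<^sup>2 * (real DIM('a) / (2 * \<delta>) * D t \<omega>)\<^sup>2"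
    and "AE \<omega> in P. \<bar>F (x (Suc t) \<omega>) - F (x t \<omega>)\<bar> \<le> L * \<bar>\<eta>\<bar> * (real DIM('a) / (2 * \<delta>)) * \<bar>D t \<omega>\<bar>"
proof -
  define h where "h \<omega> = - (\<eta> *\<^sub>R ((real DIM('a) / (2 * \<delta>) * D t \<omega>) *\<^sub>R u t \<omega>))" for \<omega>
  have xs: "x (Suc t) \<omega> = x t \<omega> + h \<omega>" if "\<omega> \<in> space P" for \<omega>
    using step[OF t that] by (simp add: h_def)
  have nh: "norm (h \<omega>) = \<bar>\<eta>\<bar> * ((real DIM('a) / (2 * \<delta>)) * \<bar>D t \<omega>\<bar>)" if "norm (u t \<omega>) = 1" for \<omega>
    using that delta_pos by (simp add: h_def abs_mult)
  show "AE \<omega> in P. F (x (Suc t) \<omega>) \<le> F (x t \<omega>) - \<eta> * ((real DIM('a) / (2 * \<delta>) * D t \<omega>) * (u t \<omega> \<bullet> G (x t \<omega>)))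
      + L\<^sub>\<delta> * \<eta>\<^sup>2 * (real DIM('a) / (2 * \<delta>) * D t \<omega>)\<^sup>2"
    using AE_u[OF t] AE_space
  proof eventually_elim
    case (elim \<omega>)
    have "(norm (h \<omega>))\<^sup>2 = \<eta>\<^sup>2 * (real DIM('a) / (2 * \<delta>) * D t \<omega>)\<^sup>2"
      unfolding nh[OF elim(1)] by (simp add: power_mult_distrib power_divide)
    moreover have "G (x t \<omega>) \<bullet> h \<omega> = - (\<eta> * ((real DIM('a) / (2 * \<delta>) * D t \<omega>) * (u t \<omega> \<bullet> G (x t \<omega>))))"
      by (simp add: h_def inner_commute)
    moreover have "F (x t \<omega> + h \<omega>) - F (x t \<omega>) - G (x t \<omega>) \<bullet> h \<omega> \<le> L\<^sub>\<delta> * (norm (h \<omega>))\<^sup>2"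
      unfolding L_delta by (rule order_trans[OF abs_ge_self ball_smoothing_smooth[OF lip delta_pos]])
    ultimately show ?case unfolding xs[OF elim(2)] by (simp only: mult.assoc)
  qed
  show "AE \<omega> in P. \<bar>F (x (Suc t) \<omega>) - F (x t \<omega>)\<bar> \<le> L * \<bar>\<eta>\<bar> * (real DIM('a) / (2 * \<delta>)) * \<bar>D t \<omega>\<bar>"
    using AE_u[OF t] AE_space
  proof eventually_elim
    case (elim \<omega>)
    show ?case
      using lipschitz_bound[OF ball_smoothing_lipschitz[OF lip], of \<delta> "x t \<omega> + h \<omega>" "x t \<omega>"]
      unfolding xs[OF elim(2)] by (simp only: add_diff_cancel_left' nh[OF elim(1)] mult.assoc)
  qed
qed

lemma F_integrable: "t \<le> T \<Longrightarrow> integrable P (\<lambda>\<omega>. F (x t \<omega>))"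
proof (induction t)
  case 0
  have "integrable P (\<lambda>\<omega>. F (x 0 \<omega>)) \<longleftrightarrow> integrable P (\<lambda>\<omega>. F x0)"
    by (rule Bochner_Integration.integrable_cong) (auto simp: start)
  then show ?case by simp
next
  case (Suc t)
  then have t: "t < T" by simp
  note [measurable] = x_measurable[OF Suc.prems]
  show ?case
  proof (rule Bochner_Integration.integrable_bound)
    show "integrable P (\<lambda>\<omega>. \<bar>F (x t \<omega>)\<bar> + L * \<bar>\<eta>\<bar> * (real DIM('a) / (2 * \<delta>)) * \<bar>D t \<omega>\<bar>)"
      using Suc t D_integrable[OF t] by simp
    show "AE \<omega> in P. norm (F (x (Suc t) \<omega>)) \<le> norm (\<bar>F (x t \<omega>)\<bar> + L * \<bar>\<eta>\<bar> * (real DIM('a) / (2 * \<delta>)) * \<bar>D t \<omega>\<bar>)"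
      using F_step(2)[OF t] by eventually_elim (unfold real_norm_def, linarith)
  qed measurable
qed

lemma descent:
  assumes t: "t < T"
  shows "expectation (\<lambda>\<omega>. F (x (Suc t) \<omega>)) \<le> expectation (\<lambda>\<omega>. F (x t \<omega>)) - \<eta> * g t + L\<^sub>\<delta> * \<eta>\<^sup>2 * S"
proof -
  let ?a = "\<lambda>\<omega>. real DIM('a) / (2 * \<delta>) * D t \<omega>"
  let ?b = "\<lambda>\<omega>. ?a \<omega> * (u t \<omega> \<bullet> G (x t \<omega>))"
  have i1: "integrable P (\<lambda>\<omega>. F (x t \<omega>))" using F_integrable t by simp
  have i2: "integrable P (\<lambda>\<omega>. \<eta> * ?b \<omega>)" by (rule integrable_mult_right[OF expectation_gradient_step(2)[OF t]])
  have i3: "integrable P (\<lambda>\<omega>. L\<^sub>\<delta> * \<eta>\<^sup>2 * (?a \<omega>)\<^sup>2)" by (rule integrable_mult_right[OF expectation_step_square(1)[OF t]])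
  have i12: "integrable P (\<lambda>\<omega>. F (x t \<omega>) - \<eta> * ?b \<omega>)" by (rule Bochner_Integration.integrable_diff[OF i1 i2])
  have "expectation (\<lambda>\<omega>. F (x (Suc t) \<omega>)) \<le> expectation (\<lambda>\<omega>. F (x t \<omega>) - \<eta> * ?b \<omega> + L\<^sub>\<delta> * \<eta>\<^sup>2 * (?a \<omega>)\<^sup>2)"
    using t F_step(1)[OF t] by (intro integral_mono_AE F_integrable Bochner_Integration.integrable_add i12 i3) auto
  also have "\<dots> = expectation (\<lambda>\<omega>. F (x t \<omega>)) - \<eta> * expectation ?b + L\<^sub>\<delta> * \<eta>\<^sup>2 * expectation (\<lambda>\<omega>. (?a \<omega>)\<^sup>2)"
    unfolding Bochner_Integration.integral_add[OF i12 i3] Bochner_Integration.integral_diff[OF i1 i2] integral_mult_right_zero ..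
  also have "\<dots> \<le> expectation (\<lambda>\<omega>. F (x t \<omega>)) - \<eta> * g t + L\<^sub>\<delta> * \<eta>\<^sup>2 * S"
    unfolding expectation_gradient_step(1)[OF t] using expectation_step_square(2)[OF t] L_delta_pos
    by (intro add_left_mono mult_left_mono) auto
  finally show ?thesis .
qed

lemma sum_descent:
  "n \<le> T \<Longrightarrow> expectation (\<lambda>\<omega>. F (x n \<omega>)) + \<eta> * (\<Sum>t<n. g t) \<le> F x0 + real n * (L\<^sub>\<delta> * \<eta>\<^sup>2 * S)"
proof (induction n)
  case 0
  have "expectation (\<lambda>\<omega>. F (x 0 \<omega>)) = expectation (\<lambda>\<omega>. F x0)"
    by (intro Bochner_Integration.integral_cong) (auto simp: start)
  then show ?case using prob_space by simp
next
  case (Suc n)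
  then show ?case using descent[of n] by (simp add: algebra_simps)
qed

lemma average_gradient_bound:
  assumes b: "\<And>y. b \<le> F y" and T: "T > 0" and eta: "\<eta> > 0"
  shows "(\<Sum>t<T. g t) / real T \<le> (F x0 - b) / (\<eta> * real T) + \<eta> * L\<^sub>\<delta> * S"
proof -
  have "b \<le> expectation (\<lambda>\<omega>. F (x T \<omega>))"
    using integral_mono[of P "\<lambda>_. b" "\<lambda>\<omega>. F (x T \<omega>)"] F_integrable[of T] b prob_space by simp
  then have "\<eta> * (\<Sum>t<T. g t) \<le> (F x0 - b) + real T * (L\<^sub>\<delta> * \<eta>\<^sup>2 * S)"
    using sum_descent[of T] by simp
  then have "\<eta> * (\<Sum>t<T. g t) / (\<eta> * real T) \<le> ((F x0 - b) + real T * (L\<^sub>\<delta> * \<eta>\<^sup>2 * S)) / (\<eta> * real T)"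
    using eta T by (intro divide_right_mono) auto
  also have "\<dots> = (F x0 - b) / (\<eta> * real T) + (\<eta> * real T) * (\<eta> * L\<^sub>\<delta> * S) / (\<eta> * real T)"
    by (simp add: add_divide_distrib power2_eq_square mult_ac)
  also have "(\<eta> * real T) * (\<eta> * L\<^sub>\<delta> * S) / (\<eta> * real T) = \<eta> * L\<^sub>\<delta> * S"
    using eta T by simp
  finally show ?thesis using eta T by simp
qed

end

text \<open>If \<open>\<Delta> = 0\<close>, or if \<open>S = 0\<close> (where the quotient is \<open>0\<close> by convention), the step size is \<open>0\<close>.\<close>

lemma optimal_step_bound:
  fixes Q \<Delta> S k n \<eta> :: real
  assumes k: "k > 0" and n: "n > 0" and S: "S \<ge> 0" and \<Delta>: "\<Delta> \<ge> 0" and QS: "Q \<le> S"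
    and pos: "\<eta> > 0 \<Longrightarrow> Q \<le> \<Delta> / (\<eta> * n) + \<eta> * k * S" and zero: "\<eta> = 0 \<Longrightarrow> Q \<le> 4 * k * \<Delta>"
    and \<eta>: "\<eta> = min (1 / k) (sqrt (2 * \<Delta> / (k * n * S)))"
  shows "Q \<le> 2 * sqrt (2 * k * \<Delta> / n * S)"
proof (cases "S = 0 \<or> \<Delta> = 0")
  case True
  have "Q \<le> 0"
  proof (cases "S = 0")
    case False
    then have "\<eta> = 0" using True \<eta> k by simp
    then show ?thesis using zero True False by simp
  qed (use QS in simp)
  then show ?thesis using k n S \<Delta> by (intro order_trans[OF _ mult_nonneg_nonneg]) auto
next
  case False
  then have S: "S > 0" and \<Delta>: "\<Delta> > 0" using S \<Delta> by auto
  \<comment> \<open>\<open>2 * A\<close> is the target, and \<open>e\<close> is the step size before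
    clipping at \<open>1 / k\<close>. They are tied by \<open>e * k * S = A\<close> and
    \<open>\<Delta> / (e * n) = A / 2\<close>.\<close>
  define A where "A = sqrt (2 * k * \<Delta> / n * S)"
  define e where "e = sqrt (2 * \<Delta> / (k * n * S))"
  have A: "A > 0" and e: "e > 0" using S \<Delta> k n by (simp_all add: A_def e_def)
  have A2: "A * A = 2 * k * \<Delta> / n * S" unfolding A_def using S \<Delta> k n by simp
  have "(e * k * S) * (e * k * S) = (2 * \<Delta> / (k * n * S)) * (k * S) * (k * S)"
    unfolding e_def using S \<Delta> k n by (simp add: mult_ac)
  also have "\<dots> = A * A" unfolding A2 using S k n by (simp add: field_simps)
  finally have "(e * k * S)\<^sup>2 = A\<^sup>2" by (simp only: power2_eq_square)
  then have ekS: "e * k * S = A"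
    by (rule power2_eq_imp_eq) (use A e k S in simp_all)
  show ?thesis
  \<comment> \<open>Without clipping the two terms of \<open>pos\<close> are \<open>A / 2\<close>
    and \<open>A\<close>, together below \<open>2 * A\<close>. With clipping,
    \<open>1 < e * k\<close> gives \<open>S \<le> e * k * S = A\<close>, and \<open>QS\<close>
    finishes.\<close>
  proof (cases "e \<le> 1 / k")
    case True
    then have "\<eta> = e" using \<eta> by (simp add: e_def)
    then have "Q \<le> \<Delta> / (e * n) + A" using pos e ekS by simp
    also have "\<Delta> / (e * n) = A / 2"
    proof -
      have "A * (e * k * S) = 2 * k * \<Delta> / n * S" unfolding ekS by (rule A2)
      then have "A * e * n = 2 * \<Delta>" using k S n by (simp add: field_simps)
      then show ?thesis using e n by (simp add: field_simps)
    qed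
    finally show ?thesis using A unfolding A_def[symmetric] by simp
  next
    case False
    then have "1 < e * k" using k by (simp add: field_simps)
    then have "1 * S \<le> (e * k) * S" using S by (intro mult_right_mono) auto
    then show ?thesis using QS A ekS unfolding A_def[symmetric] by simp
  qed
qed

section \<open>The random output and the number of comparisons\<close>

context lipschitz_comparison_sgd
begin

text \<open>A run with step size 0 never leaves \<open>x0\<close>. When the initial gap is 0, the
  bound forces the gradient there to vanish.\<close>

lemma g_zero_step:
  assumes b: "\<And>y. b \<le> F y" and eta: "\<eta> = 0" and t: "t < T"
  shows "g t \<le> 4 * L\<^sub>\<delta> * (F x0 - b)"
proof -
  have x: "x n \<omega> = x0" if "n \<le> T" "\<omega> \<in> space P" for n \<omega>
    using that by (induction n) (auto simp: start step eta)
  have "g t = expectation (\<lambda>\<omega>. (norm (G x0))\<^sup>2)"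
    using t by (intro Bochner_Integration.integral_cong) (auto simp: x)
  also have "\<dots> = (norm (G x0))\<^sup>2" using prob_space by simp
  also have "\<dots> \<le> 4 * L\<^sub>\<delta> * (F x0 - b)"
    unfolding L_delta by (rule smoothing_gradient_norm_le_gap[OF lip L_pos delta_pos b])
  finally show ?thesis .
qed

lemma random_iterate_measurable:
  assumes R: "R \<in> P \<rightarrow>\<^sub>M count_space {..<T}"
  shows "(\<lambda>\<omega>. x (R \<omega>) \<omega>) \<in> borel_measurable P"
  by (rule measurable_compose_countable'[OF _ R]) (auto intro!: x_measurable)

text \<open>The square is split according to the value of \<open>R\<close>. As \<open>R\<close> is
  independent of the whole history, which determines every iterate, each summand factors into
  \<open>1 / real T\<close> and \<open>g t\<close>.\<close>

lemma expectation_random_iterate: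
  assumes R: "R \<in> P \<rightarrow>\<^sub>M count_space {..<T}"
    and R_uniform: "distr P (count_space {..<T}) R = uniform_count_measure {..<T}"
    and R_indep: "indep_set (sets (vimage_algebra (space P) R (count_space {..<T}))) (sets (H T))"
  shows "expectation (\<lambda>\<omega>. (norm (G (x (R \<omega>) \<omega>)))\<^sup>2) = (\<Sum>t<T. g t) / real T"
    and "integrable P (\<lambda>\<omega>. (norm (G (x (R \<omega>) \<omega>)))\<^sup>2)"
proof -
  let ?V = "vimage_algebra (space P) R (count_space {..<T})"
  have R': "R \<omega> < T" if "\<omega> \<in> space P" for \<omega> using measurable_space[OF R that] by simp
  have RV: "R \<in> ?V \<rightarrow>\<^sub>M count_space {..<T}" by (rule measurable_vimage_algebra1) (use R' in auto)
  have eq: "(norm (G (x (R \<omega>) \<omega>)))\<^sup>2 = (\<Sum>t<T. of_bool (R \<omega> = t) * (norm (G (x t \<omega>)))\<^sup>2)" if "\<omega> \<in> space P" for \<omega>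
    using R'[OF that] by (simp add: of_bool_def if_distrib[of "\<lambda>a. a * _"] sum.delta cong: if_cong)
  have ind: "indep_var borel (\<lambda>\<omega>. of_bool (R \<omega> = t) :: real) borel (\<lambda>\<omega>. (norm (G (x t \<omega>)))\<^sup>2)" if t: "t < T" for t
  proof (rule indep_var_subalgebra[OF R_indep])
    show "subalgebra P ?V" using R by (rule subalgebra_vimage)
    show "subalgebra P (H T)" by (rule subalgebra_H) simp
    show "(\<lambda>\<omega>. of_bool (R \<omega> = t) :: real) \<in> borel_measurable ?V"
      by (rule measurable_compose[OF RV, of "\<lambda>r. of_bool (r = t)"]) simp
    have [measurable]: "x t \<in> borel_measurable (H T)"
      using t by (intro measurable_from_subalg[OF subalgebra_H_mono x_measurable_H]) auto
    show "(\<lambda>\<omega>. (norm (G (x t \<omega>)))\<^sup>2) \<in> borel_measurable (H T)" by measurable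
  qed
  have Rint: "integrable P (\<lambda>\<omega>. of_bool (R \<omega> = t) :: real)" for t
  proof (rule integrable_const_bound[where B=1])
    show "(\<lambda>\<omega>. of_bool (R \<omega> = t) :: real) \<in> borel_measurable P"
      by (rule measurable_compose[OF R, of "\<lambda>r. of_bool (r = t)"]) simp
  qed simp
  have ER: "expectation (\<lambda>\<omega>. of_bool (R \<omega> = t)) = 1 / real T" if t: "t < T" for t
  proof -
    have "expectation (\<lambda>\<omega>. of_bool (R \<omega> = t)) = (\<integral>r. (of_bool (r = t) :: real) \<partial>distr P (count_space {..<T}) R)"
      by (subst integral_distr[OF R]) auto
    also have "\<dots> = (\<integral>r. indicator {t} r \<partial>uniform_count_measure {..<T})"
      unfolding R_uniform by (intro Bochner_Integration.integral_cong) (auto simp: indicator_def)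
    also have "\<dots> = measure (uniform_count_measure {..<T}) {t}"
      using t by (simp add: space_uniform_count_measure)
    also have "\<dots> = 1 / real T" using t by (subst measure_uniform_count_measure) auto
    finally show ?thesis .
  qed
  have prod: "integrable P (\<lambda>\<omega>. of_bool (R \<omega> = t) * (norm (G (x t \<omega>)))\<^sup>2)"
    "expectation (\<lambda>\<omega>. of_bool (R \<omega> = t) * (norm (G (x t \<omega>)))\<^sup>2) = 1 / real T * g t" if t: "t < T" for t
    using indep_var_integrable[OF ind[OF t] Rint G_integrable] indep_var_lebesgue_integral[OF ind[OF t] Rint G_integrable] t
    by (simp_all add: ER)
  show "integrable P (\<lambda>\<omega>. (norm (G (x (R \<omega>) \<omega>)))\<^sup>2)"
  proof (subst Bochner_Integration.integrable_cong[OF refl eq])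
    show "integrable P (\<lambda>\<omega>. \<Sum>t<T. of_bool (R \<omega> = t) * (norm (G (x t \<omega>)))\<^sup>2)"
      by (rule Bochner_Integration.integrable_sum) (rule prod(1), simp)
  qed
  have "expectation (\<lambda>\<omega>. (norm (G (x (R \<omega>) \<omega>)))\<^sup>2) =
      expectation (\<lambda>\<omega>. \<Sum>t<T. of_bool (R \<omega> = t) * (norm (G (x t \<omega>)))\<^sup>2)"
    by (rule Bochner_Integration.integral_cong[OF refl eq])
  also have "\<dots> = (\<Sum>t<T. expectation (\<lambda>\<omega>. of_bool (R \<omega> = t) * (norm (G (x t \<omega>)))\<^sup>2))"
    by (rule Bochner_Integration.integral_sum) (auto intro: prod)
  also have "\<dots> = (\<Sum>t<T. 1 / real T * g t)" by (intro sum.cong refl prod) auto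
  finally show "expectation (\<lambda>\<omega>. (norm (G (x (R \<omega>) \<omega>)))\<^sup>2) = (\<Sum>t<T. g t) / real T"
    by (simp add: sum_divide_distrib)
qed

text \<open>The cost of a step is a function of its roulette variable, so the law \<rho> and
  linearity of expectation give the total.\<close>

lemma expected_comparisons:
  assumes int: "integrable (measure_pmf \<rho>) (\<lambda>n. real (comparisons_used m n))"
  shows "integrable P (\<lambda>\<omega>. real (\<Sum>t<T. comparisons_used m (K t \<omega>)))"
    and "expectation (\<lambda>\<omega>. real (\<Sum>t<T. comparisons_used m (K t \<omega>))) =
      real T * measure_pmf.expectation \<rho> (\<lambda>n. real (comparisons_used m n))"
proof -
  have i: "integrable P (\<lambda>\<omega>. real (comparisons_used m (K t \<omega>)))" if t: "t < T" for t
    using int integrable_distr[OF K_measurable[OF t], of "\<lambda>n. real (comparisons_used m n)"] unfolding K_law[OF t] by simp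
  have e: "expectation (\<lambda>\<omega>. real (comparisons_used m (K t \<omega>))) = measure_pmf.expectation \<rho> (\<lambda>n. real (comparisons_used m n))"
    if t: "t < T" for t
    using integral_distr[OF K_measurable[OF t], of "\<lambda>n. real (comparisons_used m n)"] unfolding K_law[OF t] by simp
  show "integrable P (\<lambda>\<omega>. real (\<Sum>t<T. comparisons_used m (K t \<omega>)))"
    unfolding of_nat_sum by (rule Bochner_Integration.integrable_sum) (auto intro: i)
  show "expectation (\<lambda>\<omega>. real (\<Sum>t<T. comparisons_used m (K t \<omega>))) =
      real T * measure_pmf.expectation \<rho> (\<lambda>n. real (comparisons_used m n))"
    unfolding of_nat_sum by (subst Bochner_Integration.integral_sum) (auto intro: i simp: e)
qed

end

text \<open>A bound on the mean gradient norm does not bound every realization of the output, so its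
  stationarity is asserted in expectation; the implication from a small gradient to stationarity is
  stated beside it for each fixed point. The guard \<open>0 < \<eta>\<close> protects the division
  by \<eta>: the optimal step size may be 0.\<close>

theorem theorem4p8:
  fixes f :: "'a::euclidean_space \<Rightarrow> real"
    and P :: "'w measure"
    and u :: "nat \<Rightarrow> 'w \<Rightarrow> 'a" and K :: "nat \<Rightarrow> 'w \<Rightarrow> nat"
    and Y :: "nat \<Rightarrow> nat \<Rightarrow> nat \<Rightarrow> 'w \<Rightarrow> bool"
    and D :: "nat \<Rightarrow> 'w \<Rightarrow> real" and x :: "nat \<Rightarrow> 'w \<Rightarrow> 'a"
    and R :: "'w \<Rightarrow> nat" and T :: nat and x0 :: 'a
    and \<sigma> :: "real \<Rightarrow> real" and c :: "nat \<Rightarrow> real" and m :: "nat \<Rightarrow> nat" and \<rho> :: "nat pmf"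
    and \<tau> \<delta> \<eta> L L\<^sub>\<delta> B C \<Delta>\<^sub>0 S :: real
    and f\<^sub>\<delta> :: "'a \<Rightarrow> real"
  assumes f_bdd: "bdd_below (range f)"
    and L_pos: "0 < L" and f_lip: "L-lipschitz_on UNIV f"
    and delta_pos: "0 < \<delta>"
    and f_delta: "f\<^sub>\<delta> = ball_smoothing \<delta> f"
    and L_delta: "L\<^sub>\<delta> = L * sqrt (real DIM('a)) / \<delta>"
    and B: "B = 2 * L * \<delta>"
    and Delta0: "\<Delta>\<^sub>0 = f\<^sub>\<delta> x0 - (INF z. f\<^sub>\<delta> z)"
    and S: "S = (real DIM('a))\<^sup>2 / (4 * \<delta>\<^sup>2) * C * B\<^sup>2"
    and link: "symmetric_link \<sigma>" and tau_pos: "0 < \<tau>"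
    and expansion: "link_expansion \<sigma> c m (B / \<tau>)"
    and roulette: "valid_roulette c m \<rho>"
    and T_pos: "0 < T"
    and run: "comparison_sgd P f \<sigma> \<tau> c m \<rho> \<delta> \<eta> x0 T u K Y D x"
    and eta_le: "\<eta> \<le> 1 / L\<^sub>\<delta>"
    and C_nonneg: "0 \<le> C"
    and second_moment: "\<And>t. t < T \<Longrightarrow>
      AE \<omega> in P.
        nn_cond_exp P (vimage_algebra (space P) (\<lambda>\<omega>. (x t \<omega>, u t \<omega>)) (borel \<Otimes>\<^sub>M borel))
          (\<lambda>\<omega>. ennreal ((D t \<omega>)\<^sup>2)) \<omega> \<le> ennreal (C * B\<^sup>2)"
    and R_measurable: "R \<in> P \<rightarrow>\<^sub>M count_space {..<T}"
    and R_uniform: "distr P (count_space {..<T}) R = uniform_count_measure {..<T}"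
    and R_indep: "prob_space.indep_set P
      (sets (vimage_algebra (space P) R (count_space {..<T}))) (sets (sgd_history P u K Y T))"
  shows
    "(integrable P (\<lambda>\<omega>. (norm (gradient f\<^sub>\<delta> (x (R \<omega>) \<omega>)))\<^sup>2) \<and>
      (0 < \<eta> \<longrightarrow>
        (\<integral>\<omega>. (norm (gradient f\<^sub>\<delta> (x (R \<omega>) \<omega>)))\<^sup>2 \<partial>P) \<le> 2 * \<Delta>\<^sub>0 / (\<eta> * real T) + \<eta> * L\<^sub>\<delta> * S)) \<and>
     (\<eta> = min (1 / L\<^sub>\<delta>) (sqrt (2 * \<Delta>\<^sub>0 / (L\<^sub>\<delta> * real T * S))) \<longrightarrow>
        (\<integral>\<omega>. (norm (gradient f\<^sub>\<delta> (x (R \<omega>) \<omega>)))\<^sup>2 \<partial>P) \<le> 2 * sqrt (2 * L\<^sub>\<delta> * \<Delta>\<^sub>0 / real T * S)) \<and>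
     (\<forall>\<epsilon>>0.
        \<eta> = min (1 / L\<^sub>\<delta>) (sqrt (2 * \<Delta>\<^sub>0 / (L\<^sub>\<delta> * real T * S))) \<and>
        real T \<ge> 8 * L\<^sub>\<delta> * \<Delta>\<^sub>0 / \<epsilon> ^ 4 * S \<longrightarrow>
        integrable P (\<lambda>\<omega>. norm (gradient f\<^sub>\<delta> (x (R \<omega>) \<omega>))) \<and>
        (\<integral>\<omega>. norm (gradient f\<^sub>\<delta> (x (R \<omega>) \<omega>)) \<partial>P) \<le> \<epsilon> \<and>
        goldstein_stationary_in_expectation P f \<delta> \<epsilon> (\<lambda>\<omega>. x (R \<omega>) \<omega>)) \<and>
     (\<forall>z \<epsilon>. norm (gradient f\<^sub>\<delta> z) \<le> \<epsilon> \<longrightarrow> goldstein_stationary f \<delta> \<epsilon> z) \<and>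
     (integrable (measure_pmf \<rho>) (\<lambda>n. real (comparisons_used m n)) \<longrightarrow>
        integrable P (\<lambda>\<omega>. real (\<Sum>t<T. comparisons_used m (K t \<omega>))) \<and>
        (\<integral>\<omega>. real (\<Sum>t<T. comparisons_used m (K t \<omega>)) \<partial>P)
          \<le> real T * measure_pmf.expectation \<rho> (\<lambda>n. real (comparisons_used m n)))"
proof -
  interpret sgd: lipschitz_comparison_sgd P f \<sigma> \<tau> c m \<rho> \<delta> \<eta> x0 T u K Y D x L C L\<^sub>\<delta> S
    by (intro lipschitz_comparison_sgd.intro[OF run] lipschitz_comparison_sgd_axioms.intro)
      (fact L_pos f_lip delta_pos tau_pos link expansion[unfolded B] roulette C_nonneg L_delta
        S[unfolded B] second_moment[unfolded B])+
  let ?G = "smoothing_gradient \<delta> f"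
  let ?Q = "\<integral>\<omega>. (norm (?G (x (R \<omega>) \<omega>)))\<^sup>2 \<partial>P"
  let ?dist = "\<lambda>z. infdist 0 (goldstein_subdifferential \<delta> f z)"
  have grad: "gradient f\<^sub>\<delta> z = ?G z" for z
    unfolding f_delta by (rule gradient_ball_smoothing[OF f_lip delta_pos])
  have T: "real T > 0" using T_pos by simp
  define b where "b = (INF z. f\<^sub>\<delta> z)"
  have b: "b \<le> f\<^sub>\<delta> y" for y
    unfolding b_def f_delta by (rule cINF_lower[OF ball_smoothing_bdd_below[OF f_lip f_bdd]]) simp
  have D0: "\<Delta>\<^sub>0 = f\<^sub>\<delta> x0 - b" "\<Delta>\<^sub>0 \<ge> 0" using Delta0 b[of x0] by (simp_all add: b_def)
  have S0: "S \<ge> 0" unfolding S using C_nonneg by simp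
  note random = sgd.expectation_random_iterate[OF R_measurable R_uniform R_indep]
  note [measurable] = sgd.random_iterate_measurable[OF R_measurable]
  have int1: "integrable P (\<lambda>\<omega>. norm (?G (x (R \<omega>) \<omega>)))"
    by (rule sgd.square_integrable_imp_integrable[OF _ random(2)]) measurable
  \<comment> \<open>Bounds that are uniform in \<open>t\<close> carry over to the output, whose mean
    is the average of the \<open>sgd.g t\<close>.\<close>
  have average_le: "?Q \<le> v" if "\<And>t. t < T \<Longrightarrow> sgd.g t \<le> v" for v
    using sum_mono[of "{..<T}" sgd.g "\<lambda>_. v"] that T by (simp add: random(1) pos_divide_le_eq mult.commute)
  have Q_le: "?Q \<le> \<Delta>\<^sub>0 / (\<eta> * real T) + \<eta> * L\<^sub>\<delta> * S" if "0 < \<eta>"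
    using sgd.average_gradient_bound[of b] b T_pos that by (simp add: random(1) D0(1) f_delta)
  have one: "?Q \<le> 2 * \<Delta>\<^sub>0 / (\<eta> * real T) + \<eta> * L\<^sub>\<delta> * S" if "0 < \<eta>"
  proof -
    have "\<Delta>\<^sub>0 / (\<eta> * real T) \<le> 2 * \<Delta>\<^sub>0 / (\<eta> * real T)"
      using D0(2) that by (intro divide_right_mono) auto
    then show ?thesis using Q_le[OF that] by linarith
  qed
  have two: "?Q \<le> 2 * sqrt (2 * L\<^sub>\<delta> * \<Delta>\<^sub>0 / real T * S)"
    if "\<eta> = min (1 / L\<^sub>\<delta>) (sqrt (2 * \<Delta>\<^sub>0 / (L\<^sub>\<delta> * real T * S)))"
  proof (rule optimal_step_bound[OF sgd.L_delta_pos T S0 D0(2) _ Q_le _ that])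
    show "?Q \<le> S" by (rule average_le[OF sgd.g_le_S])
    show "?Q \<le> 4 * L\<^sub>\<delta> * \<Delta>\<^sub>0" if "\<eta> = 0"
      unfolding D0(1) f_delta by (intro average_le sgd.g_zero_step that) (use b f_delta in simp_all)
  qed
  have stationary: "goldstein_stationary f \<delta> \<epsilon> z" if "norm (?G z) \<le> \<epsilon>" for z \<epsilon>
    unfolding goldstein_stationary_def
    using goldstein_subdifferential_nonempty[OF f_lip delta_pos] infdist_goldstein_le[OF f_lip delta_pos] that
    by (blast intro: order_trans)
  have three: "(\<integral>\<omega>. norm (?G (x (R \<omega>) \<omega>)) \<partial>P) \<le> \<epsilon>"
    if "\<epsilon> > 0" "\<eta> = min (1 / L\<^sub>\<delta>) (sqrt (2 * \<Delta>\<^sub>0 / (L\<^sub>\<delta> * real T * S)))"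
      "real T \<ge> 8 * L\<^sub>\<delta> * \<Delta>\<^sub>0 / \<epsilon> ^ 4 * S" for \<epsilon>
  proof -
    \<comment> \<open>The requirement on \<open>T\<close> is exactly what makes the square root in
      \<open>two\<close> at most \<open>\<epsilon>\<^sup>2 / 2\<close>, so that the mean square is
      at most \<open>\<epsilon>\<^sup>2\<close>; nonnegativity of the variance passes from there to
      the mean norm.\<close>
    have "8 * L\<^sub>\<delta> * \<Delta>\<^sub>0 * S \<le> real T * \<epsilon> ^ 4"
      using that(1,3) by (simp add: field_simps)
    then have "2 * L\<^sub>\<delta> * \<Delta>\<^sub>0 / real T * S \<le> (\<epsilon>\<^sup>2 / 2)\<^sup>2"
      using T by (simp add: field_simps power2_eq_square power4_eq_xxxx)
    then have "sqrt (2 * L\<^sub>\<delta> * \<Delta>\<^sub>0 / real T * S) \<le> \<epsilon>\<^sup>2 / 2"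
      by (intro real_le_lsqrt) auto
    then have "?Q \<le> \<epsilon>\<^sup>2" using two[OF that(2)] by linarith
    moreover have "(\<integral>\<omega>. norm (?G (x (R \<omega>) \<omega>)) \<partial>P)\<^sup>2 \<le> ?Q"
      using sgd.variance_positive[of "\<lambda>\<omega>. norm (?G (x (R \<omega>) \<omega>))"] sgd.variance_eq[OF int1 random(2)] by simp
    ultimately have "(\<integral>\<omega>. norm (?G (x (R \<omega>) \<omega>)) \<partial>P)\<^sup>2 \<le> \<epsilon>\<^sup>2" by (rule order_trans[rotated])
    then show ?thesis by (rule power2_le_imp_le) (use that(1) in simp)
  qed
  have dist_int: "integrable P (\<lambda>\<omega>. ?dist (x (R \<omega>) \<omega>))"
  proof (rule Bochner_Integration.integrable_bound[OF int1])
    show "(\<lambda>\<omega>. ?dist (x (R \<omega>) \<omega>)) \<in> borel_measurable P"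
      by (rule measurable_compose[OF sgd.random_iterate_measurable[OF R_measurable] infdist_goldstein_measurable[OF f_lip delta_pos]])
    show "AE \<omega> in P. norm (?dist (x (R \<omega>) \<omega>)) \<le> norm (norm (?G (x (R \<omega>) \<omega>)))"
      using infdist_goldstein_le[OF f_lip delta_pos] by (simp add: infdist_nonneg)
  qed
  have stationary_exp: "goldstein_stationary_in_expectation P f \<delta> \<epsilon> (\<lambda>\<omega>. x (R \<omega>) \<omega>)"
    if "(\<integral>\<omega>. norm (?G (x (R \<omega>) \<omega>)) \<partial>P) \<le> \<epsilon>" for \<epsilon>
    unfolding goldstein_stationary_in_expectation_def
  proof (intro conjI dist_int)
    show "AE \<omega> in P. goldstein_subdifferential \<delta> f (x (R \<omega>) \<omega>) \<noteq> {}"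
      by (rule AE_I2) (rule goldstein_subdifferential_nonempty[OF f_lip delta_pos])
    show "(\<integral>\<omega>. ?dist (x (R \<omega>) \<omega>) \<partial>P) \<le> \<epsilon>"
      by (rule order_trans[OF integral_mono[OF dist_int int1 infdist_goldstein_le[OF f_lip delta_pos]] that])
  qed
  show ?thesis
    unfolding grad
  proof (intro conjI impI allI; (elim conjE)?)
    show "integrable P (\<lambda>\<omega>. (norm (?G (x (R \<omega>) \<omega>)))\<^sup>2)" by (rule random(2))
    show "?Q \<le> 2 * \<Delta>\<^sub>0 / (\<eta> * real T) + \<eta> * L\<^sub>\<delta> * S" if "0 < \<eta>" using that by (rule one)
    show "integrable P (\<lambda>\<omega>. norm (?G (x (R \<omega>) \<omega>)))" by (rule int1)
    show "goldstein_stationary f \<delta> \<epsilon> z" if "norm (?G z) \<le> \<epsilon>" for z \<epsilon> using that by (rule stationary)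
  qed (fact two three stationary_exp[OF three] sgd.expected_comparisons(1) eq_refl[OF sgd.expected_comparisons(2)])+
qed

end
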